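(* Let $(V,J,g)$ be a pseudo-Hermitian vector space of complex signature $(p,q)$, $p+q=n=\dim_{\mathbb C}V$, with $\omega=g(J\cdot,\cdot)$. The cone $C_J(\mathfrak{sp}(V))$ has a stratification $$C_J(\mathfrak{sp}(V))=\bigcup_{k=0}^NC_J(\mathfrak{sp}(V))_k,$$ where the number $N\le n/2$ is the maximal complex dimension of an isotropic complex subspace of $V$; it is given by $N=\min(p,q)$. The $k$-th stratum $$C_J(\mathfrak{sp}(V))_k=\bigcup_{W\in\mathbb G^0_k(V)}S^{3,0}W_{reg}^\rho\cong\bigcup_{W\in\mathbb G^0_k(V)}S^{3,0}W_{reg}$$ is identified with a Zariski open subbundle of the vector bundle $S^3\mathbb U_k$. The action of $\mathrm{Aut}(V,J,\omega)=\mathrm{Aut}(V,J,g)=\mathrm U(p,q)$ on $C_J(\mathfrak{sp}(V))$ preserves the stratification and we have the following identification of orbit spaces: $$C_J(\mathfrak{sp}(V))_k/\mathrm U(p,q)=S^{3,0}W_{reg}^\rho/\mathrm{GL}_{\mathbb C}(W),$$ where $W\subset V$ is a fixed complex $k$-dimensional isotropic subspace.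
   Context: $(V,J,g)$ is a finite-dimensional real vector space with complex structure $J$ and possibly indefinite $J$-invariant scalar product $g$; $\omega=g(J\cdot,\cdot)$. The first prolongation $\mathfrak{sp}(V)^{(1)}$, i.e. the space of linear maps $S:V\to\mathfrak{sp}(V)$ with $S_XY=S_YX$, is identified with $S^3V^*$ via the trilinear form $\omega(S_XY,Z)$, and with $S^3V$ via $V\cong V^*$, $v\mapsto\omega(v,\cdot)$ (and likewise over $\mathbb C$). $C_J(\mathfrak{sp}(V))$ is the set of $S\in\mathfrak{sp}(V)^{(1)}$ with $[S_X,S_Y]=0$ and $S_XJ+JS_X=0$ for all $X,Y\in V$. The support of $S$ is $\Sigma_S=\mathrm{span}\{S_XY\}$; for $S\in C_J(\mathfrak{sp}(V))$ it is a complex ($J$-invariant) subspace, and $C_J(\mathfrak{sp}(V))_k=\{S\in C_J(\mathfrak{sp}(V))\mid\dim_{\mathbb C}\Sigma_S=k\}$. Isotropic means $\omega$-isotropic (equivalently, for complex subspaces, $g$-isotropic). $V^{\mathbb C}=V^{1,0}\oplus V^{0,1}$ is the decomposition of $V\otimes\mathbb C$ into $\pm i$-eigenspaces of $J$; for a complex subspace $W\subset V$, $W^{1,0}=(W\otimes\mathbb C)\cap V^{1,0}$ and $S^{3,0}W=S^3W^{1,0}$. $S^{3,0}W_{reg}$ is the set of $S_c\in S^{3,0}W$ with support $W^{1,0}$, and $S^{3,0}W_{reg}^\rho=\{S_c+\overline{S}_c\mid S_c\in S^{3,0}W_{reg}\}$, i.e. the elements of this form with support $W$; the isomorphism with $S^{3,0}W_{reg}$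 is $S_c+\overline S_c\mapsto S_c$. $\mathbb G_k^0(V)$ is the real submanifold of the complex Grassmannian $\mathbb G_k(V)$ consisting of isotropic complex subspaces of complex dimension $k$, $\mathbb U_k\to\mathbb G^0_k(V)$ the universal (tautological) complex vector bundle, and $S^3\mathbb U_k$ its (complex) third symmetric power. The orbit space identification is induced by inclusion. *)

theory Defs
  imports "HOL-Analysis.Analysis" "HOL-Algebra.Group"
begin

text \<open>
  The finite-dimensional real vector space \<open>V\<close> is a type \<open>'v\<close> of class
  \<^class>\<open>euclidean_space\<close>.  The inner product of that class is auxiliary and unrelated to the
  scalar product \<open>g\<close>: it only serves to embed Grassmannians into endomorphisms (see
  \<open>isotropic_proj\<close> below).
\<close>

text \<open>Complex scalar multiplication induced by an operator \<open>J\<close> with \<open>J \<circ> J = - id\<close>.\<close>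

definition jscale :: "('a::real_vector \<Rightarrow> 'a) \<Rightarrow> complex \<Rightarrow> 'a \<Rightarrow> 'a" where
  "jscale J c x = Re c *\<^sub>R x + Im c *\<^sub>R J x"

abbreviation cspan :: "('a::real_vector \<Rightarrow> 'a) \<Rightarrow> 'a set \<Rightarrow> 'a set" where
  "cspan J \<equiv> module.span (jscale J)"

abbreviation cdim :: "('a::real_vector \<Rightarrow> 'a) \<Rightarrow> 'a set \<Rightarrow> nat" where
  "cdim J \<equiv> vector_space.dim (jscale J)"

definition complex_subspace :: "('a::real_vector \<Rightarrow> 'a) \<Rightarrow> 'a set \<Rightarrow> bool" where
  "complex_subspace J W \<longleftrightarrow> subspace W \<and> (\<forall>x\<in>W. J x \<in> W)"

definition pseudo_hermitian :: "('v::euclidean_space \<Rightarrow> 'v) \<Rightarrow> ('v \<Rightarrow> 'v \<Rightarrow> real) \<Rightarrow> bool" where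
  "pseudo_hermitian J g \<longleftrightarrow>
     linear J \<and> (\<forall>x. J (J x) = - x) \<and>
     bilinear g \<and> (\<forall>x y. g x y = g y x) \<and> (\<forall>x. (\<forall>y. g x y = 0) \<longrightarrow> x = 0) \<and>
     (\<forall>x y. g (J x) (J y) = g x y)"

definition omega :: "('v \<Rightarrow> 'v) \<Rightarrow> ('v \<Rightarrow> 'v \<Rightarrow> real) \<Rightarrow> 'v \<Rightarrow> 'v \<Rightarrow> real" where
  "omega J g x y = g (J x) y"

text \<open>Complex signature \<open>(p, q)\<close>: there is a complex basis that is orthonormal, with \<open>p\<close> signs
  \<open>+1\<close> and \<open>q\<close> signs \<open>-1\<close>, for the Hermitian form with real part \<open>g\<close> and imaginary part
  \<open>\<plusminus> omega J g\<close>.\<close>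

definition signature_sign :: "nat \<Rightarrow> nat \<Rightarrow> 'a::ring_1" where
  "signature_sign p i = (if i < p then 1 else - 1)"

definition complex_signature ::
    "('v::euclidean_space \<Rightarrow> 'v) \<Rightarrow> ('v \<Rightarrow> 'v \<Rightarrow> real) \<Rightarrow> nat \<Rightarrow> nat \<Rightarrow> bool" where
  "complex_signature J g p q \<longleftrightarrow>
     (\<exists>e :: nat \<Rightarrow> 'v.
        (\<forall>i<p + q. \<forall>j<p + q.
            g (e i) (e j) = (if i = j then signature_sign p i else 0) \<and> omega J g (e i) (e j) = 0) \<and>
        cspan J (e ` {..<p + q}) = UNIV)"

definition isotropic :: "('v \<Rightarrow> 'v \<Rightarrow> real) \<Rightarrow> 'v set \<Rightarrow> bool" where
  "isotropic w W \<longleftrightarrow> (\<forall>x\<in>W. \<forall>y\<in>W. w x y = 0)"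

definition max_isotropic_cdim :: "('v::euclidean_space \<Rightarrow> 'v) \<Rightarrow> ('v \<Rightarrow> 'v \<Rightarrow> real) \<Rightarrow> nat" where
  "max_isotropic_cdim J g =
     Max {cdim J W | W. complex_subspace J W \<and> isotropic (omega J g) W}"

definition isotropic_grassmannian ::
    "('v::euclidean_space \<Rightarrow> 'v) \<Rightarrow> ('v \<Rightarrow> 'v \<Rightarrow> real) \<Rightarrow> nat \<Rightarrow> 'v set set" where
  "isotropic_grassmannian J g k =
     {W. complex_subspace J W \<and> isotropic (omega J g) W \<and> cdim J W = k}"

definition Aut :: "('v::real_vector \<Rightarrow> 'v) \<Rightarrow> ('v \<Rightarrow> 'v \<Rightarrow> real) \<Rightarrow> ('v \<Rightarrow> 'v) set" where
  "Aut J b =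
     {A. linear A \<and> bij A \<and> (\<forall>x. A (J x) = J (A x)) \<and> (\<forall>x y. b (A x) (A y) = b x y)}"

definition Aut_group :: "('v::real_vector \<Rightarrow> 'v) \<Rightarrow> ('v \<Rightarrow> 'v \<Rightarrow> real) \<Rightarrow> ('v \<Rightarrow> 'v) monoid" where
  "Aut_group J b = \<lparr>carrier = Aut J b, mult = (\<circ>), one = id\<rparr>"

text \<open>The matrix group \<open>U(p, q)\<close>: complex matrices \<open>M\<close> of size \<open>p + q\<close> with
  \<open>M\<^sup>* I M = I\<close>, where \<open>I\<close> is diagonal with \<open>p\<close> entries \<open>1\<close> and \<open>q\<close> entries \<open>-1\<close>.  Matrices are
  functions of two indices that vanish outside \<open>{..<p + q}\<close>.\<close>

definition U_group :: "nat \<Rightarrow> nat \<Rightarrow> (nat \<Rightarrow> nat \<Rightarrow> complex) monoid" where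
  "U_group p q =
     \<lparr>carrier =
        {M. (\<forall>i j. \<not> (i < p + q \<and> j < p + q) \<longrightarrow> M i j = 0) \<and>
            (\<forall>i<p + q. \<forall>j<p + q.
               (\<Sum>l<p + q. cnj (M l i) * signature_sign p l * M l j) =
               (if i = j then signature_sign p i else 0))},
      mult = (\<lambda>M M' i j. \<Sum>l<p + q. M i l * M' l j),
      one = (\<lambda>i j. if i = j \<and> i < p + q then 1 else 0)\<rparr>"

text \<open>A bilinear map \<open>V \<times> V \<rightarrow> V\<close>, i.e. a linear map \<open>S : V \<rightarrow> End(V)\<close>, is an element of the
  normed space \<open>'v bil\<close>; as \<open>V\<close> is finite-dimensional, boundedness is automatic.  \<open>S\<^sub>X Y\<close> is
  \<open>app2 S X Y\<close>, and \<open>blin2\<close> turns a function that is bilinear into an element of \<open>'v bil\<close>.\<close>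

type_synonym 'v bil = "'v \<Rightarrow>\<^sub>L 'v \<Rightarrow>\<^sub>L 'v"

abbreviation app2 :: "'v::real_normed_vector bil \<Rightarrow> 'v \<Rightarrow> 'v \<Rightarrow> 'v" where
  "app2 S X Y \<equiv> blinfun_apply (blinfun_apply S X) Y"

definition blin2 :: "('v::real_normed_vector \<Rightarrow> 'v \<Rightarrow> 'v) \<Rightarrow> 'v bil" where
  "blin2 f = Blinfun (\<lambda>X. Blinfun (\<lambda>Y. f X Y))"

definition sp :: "('v::real_vector \<Rightarrow> 'v \<Rightarrow> real) \<Rightarrow> ('v \<Rightarrow> 'v) set" where
  "sp w = {A. linear A \<and> (\<forall>x y. w (A x) y + w x (A y) = 0)}"

definition sp_prolongation :: "('v::euclidean_space \<Rightarrow> 'v \<Rightarrow> real) \<Rightarrow> 'v bil set" where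
  "sp_prolongation w =
     {S. (\<forall>X. blinfun_apply (blinfun_apply S X) \<in> sp w) \<and> (\<forall>X Y. app2 S X Y = app2 S Y X)}"

definition CJ :: "('v::euclidean_space \<Rightarrow> 'v) \<Rightarrow> ('v \<Rightarrow> 'v \<Rightarrow> real) \<Rightarrow> 'v bil set" where
  "CJ J g =
     {S \<in> sp_prolongation (omega J g).
        (\<forall>X Y Z. app2 S X (app2 S Y Z) - app2 S Y (app2 S X Z) = 0) \<and>
        (\<forall>X Y. app2 S X (J Y) + J (app2 S X Y) = 0)}"

definition supp :: "'v::real_normed_vector bil \<Rightarrow> 'v set" where
  "supp S = span {app2 S X Y | X Y. True}"

definition CJ_stratum ::
    "('v::euclidean_space \<Rightarrow> 'v) \<Rightarrow> ('v \<Rightarrow> 'v \<Rightarrow> real) \<Rightarrow> nat \<Rightarrow> 'v bil set" where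
  "CJ_stratum J g k = {S \<in> CJ J g. cdim J (supp S) = k}"

definition act :: "('v::euclidean_space \<Rightarrow> 'v) \<Rightarrow> 'v bil \<Rightarrow> 'v bil" where
  "act A S = blin2 (\<lambda>X Y. A (app2 S (inv_into UNIV A X) (inv_into UNIV A Y)))"

text \<open>\<open>V \<otimes> \<complex>\<close> is \<open>'v \<times> 'v\<close>, with \<open>(x, y)\<close> standing for \<open>x + \<i> y\<close>.\<close>

definition iC :: "'v::real_vector \<times> 'v \<Rightarrow> 'v \<times> 'v" where
  "iC z = (- snd z, fst z)"

definition conjC :: "'v::real_vector \<times> 'v \<Rightarrow> 'v \<times> 'v" where
  "conjC z = (fst z, - snd z)"

definition bformC :: "('v \<Rightarrow> 'v \<Rightarrow> real) \<Rightarrow> 'v \<times> 'v \<Rightarrow> 'v \<times> 'v \<Rightarrow> complex" where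
  "bformC w z z' =
     Complex (w (fst z) (fst z') - w (snd z) (snd z')) (w (fst z) (snd z') + w (snd z) (fst z'))"

text \<open>\<open>W\<^sup>1\<^sup>,\<^sup>0\<close>, the intersection of \<open>W \<otimes> \<complex>\<close> with the \<open>\<i>\<close>-eigenspace of the extension of \<open>J\<close>.\<close>

definition W10 :: "('v::real_vector \<Rightarrow> 'v) \<Rightarrow> 'v set \<Rightarrow> ('v \<times> 'v) set" where
  "W10 J W = {z \<in> W \<times> W. map_prod J J z = iC z}"

definition iB :: "('v::euclidean_space \<times> 'v) bil \<Rightarrow> ('v \<times> 'v) bil" where
  "iB T = blin2 (\<lambda>X Y. iC (app2 T X Y))"

text \<open>Symmetric tensors over \<open>V \<otimes> \<complex>\<close> are identified, via \<open>v \<mapsto> \<omega>(v, \<cdot>)\<close>, with symmetric trilinear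
  forms and hence, via \<open>\<omega>(T\<^sub>X Y, Z)\<close>, with bilinear maps \<open>T\<close>.  In this way the symmetric product
  \<open>u\<^sub>1 u\<^sub>2 u\<^sub>3\<close>, whose trilinear form is the sum of
  \<open>\<omega>(a, X) \<omega>(b, Y) \<omega>(c, Z)\<close> over all arrangements \<open>a, b, c\<close> of \<open>u\<^sub>1, u\<^sub>2, u\<^sub>3\<close>, becomes the following
  bilinear map.\<close>

definition sym3 ::
    "('v::euclidean_space \<Rightarrow> 'v \<Rightarrow> real) \<Rightarrow> 'v \<times> 'v \<Rightarrow> 'v \<times> 'v \<Rightarrow> 'v \<times> 'v \<Rightarrow> ('v \<times> 'v) bil" where
  "sym3 w u1 u2 u3 =
     (let t = (\<lambda>a b c X Y. jscale iC (bformC w a X * bformC w b Y) c)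
      in blin2 (\<lambda>X Y. t u1 u2 u3 X Y + t u1 u3 u2 X Y + t u2 u1 u3 X Y
                    + t u2 u3 u1 X Y + t u3 u1 u2 X Y + t u3 u2 u1 X Y))"

definition S3 :: "('v::euclidean_space \<Rightarrow> 'v \<Rightarrow> real) \<Rightarrow> ('v \<times> 'v) set \<Rightarrow> ('v \<times> 'v) bil set" where
  "S3 w U = cspan iB {sym3 w u1 u2 u3 | u1 u2 u3. u1 \<in> U \<and> u2 \<in> U \<and> u3 \<in> U}"

definition suppC :: "('v::euclidean_space \<times> 'v) bil \<Rightarrow> ('v \<times> 'v) set" where
  "suppC T = cspan iC {app2 T X Y | X Y. True}"

definition S30 ::
    "('v::euclidean_space \<Rightarrow> 'v) \<Rightarrow> ('v \<Rightarrow> 'v \<Rightarrow> real) \<Rightarrow> 'v set \<Rightarrow> ('v \<times> 'v) bil set" where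
  "S30 J g W = S3 (omega J g) (W10 J W)"

definition S30_reg ::
    "('v::euclidean_space \<Rightarrow> 'v) \<Rightarrow> ('v \<Rightarrow> 'v \<Rightarrow> real) \<Rightarrow> 'v set \<Rightarrow> ('v \<times> 'v) bil set" where
  "S30_reg J g W = {T \<in> S30 J g W. suppC T = W10 J W}"

definition conjB :: "('v::euclidean_space \<times> 'v) bil \<Rightarrow> ('v \<times> 'v) bil" where
  "conjB T = blin2 (\<lambda>X Y. conjC (app2 T (conjC X) (conjC Y)))"

text \<open>\<open>T + conjB T\<close> is the complex bilinear extension of a real bilinear map; \<open>realify T\<close> is this
  real map.\<close>

definition realify :: "('v::euclidean_space \<times> 'v) bil \<Rightarrow> 'v bil" where
  "realify T = blin2 (\<lambda>X Y. fst (app2 (T + conjB T) (X, 0) (Y, 0)))"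

definition S30_reg_real ::
    "('v::euclidean_space \<Rightarrow> 'v) \<Rightarrow> ('v \<Rightarrow> 'v \<Rightarrow> real) \<Rightarrow> 'v set \<Rightarrow> 'v bil set" where
  "S30_reg_real J g W = realify ` S30_reg J g W"

text \<open>On an open subset of a finite-dimensional space, \<open>Ck_on m\<close> is \<open>m\<close>-fold continuous
  differentiability; it is phrased with directional derivatives so that the type of the map is
  preserved.\<close>

primrec Ck_on :: "nat \<Rightarrow> 'a::real_normed_vector set \<Rightarrow> ('a \<Rightarrow> 'b::real_normed_vector) \<Rightarrow> bool" where
  "Ck_on 0 U f \<longleftrightarrow> continuous_on U f"
| "Ck_on (Suc m) U f \<longleftrightarrow>
     (\<exists>f'. (\<forall>x\<in>U. (f has_derivative f' x) (at x)) \<and> (\<forall>v. Ck_on m U (\<lambda>x. f' x v)))"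

definition smooth_map ::
    "'a::real_normed_vector set \<Rightarrow> ('a \<Rightarrow> 'b::real_normed_vector) \<Rightarrow> bool" where
  "smooth_map A f \<longleftrightarrow>
     (\<forall>x\<in>A. \<exists>U F. open U \<and> x \<in> U \<and> (\<forall>m. Ck_on m U F) \<and> (\<forall>y\<in>A \<inter> U. F y = f y))"

definition diffeomorphism ::
    "'a::real_normed_vector set \<Rightarrow> 'b::real_normed_vector set \<Rightarrow> ('a \<Rightarrow> 'b) \<Rightarrow> bool" where
  "diffeomorphism A B f \<longleftrightarrow>
     bij_betw f A B \<and> smooth_map A f \<and> smooth_map B (inv_into A f)"

inductive_set cpoly :: "('e::real_vector \<Rightarrow> 'e) \<Rightarrow> ('e \<Rightarrow> complex) set"
  for I :: "'e::real_vector \<Rightarrow> 'e" where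
  const: "(\<lambda>x. c) \<in> cpoly I"
| linear_form: "linear l \<Longrightarrow> (\<And>x. l (I x) = \<i> * l x) \<Longrightarrow> l \<in> cpoly I"
| add: "p \<in> cpoly I \<Longrightarrow> q \<in> cpoly I \<Longrightarrow> (\<lambda>x. p x + q x) \<in> cpoly I"
| mult: "p \<in> cpoly I \<Longrightarrow> q \<in> cpoly I \<Longrightarrow> (\<lambda>x. p x * q x) \<in> cpoly I"

definition zariski_open_in :: "('e::real_vector \<Rightarrow> 'e) \<Rightarrow> 'e set \<Rightarrow> 'e set \<Rightarrow> bool" where
  "zariski_open_in I F R \<longleftrightarrow> (\<exists>P \<subseteq> cpoly I. R = {x \<in> F. \<exists>p\<in>P. p x \<noteq> 0})"

text \<open>Here \<open>I\<close> is multiplication by \<open>\<i>\<close> on \<open>'e\<close>.  A complex vector bundle is given as a family \<open>F\<close> of complex subspaces of \<open>('e, I)\<close>, with total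
  space \<open>Sigma B F\<close>.\<close>

definition local_trivialization ::
    "('e::real_normed_vector \<Rightarrow> 'e) \<Rightarrow> ('b::real_normed_vector \<Rightarrow> 'e set) \<Rightarrow> 'b set \<Rightarrow> 'e set
      \<Rightarrow> ('b \<Rightarrow> 'e \<Rightarrow> 'e) \<Rightarrow> bool" where
  "local_trivialization I F U F0 \<Phi> \<longleftrightarrow>
     (\<forall>b\<in>U. (\<forall>x\<in>F b. \<forall>y\<in>F b. \<Phi> b (x + y) = \<Phi> b x + \<Phi> b y) \<and>
             (\<forall>c. \<forall>x\<in>F b. \<Phi> b (jscale I c x) = jscale I c (\<Phi> b x))) \<and>
     diffeomorphism (Sigma U F) (U \<times> F0) (\<lambda>(b, x). (b, \<Phi> b x))"

definition zariski_open_subbundle ::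
    "('e::real_normed_vector \<Rightarrow> 'e) \<Rightarrow> 'b::real_normed_vector set \<Rightarrow> ('b \<Rightarrow> 'e set)
      \<Rightarrow> ('b \<Rightarrow> 'e set) \<Rightarrow> bool" where
  "zariski_open_subbundle I B F R \<longleftrightarrow>
     (\<forall>b\<in>B. R b \<noteq> {} \<and> zariski_open_in I (F b) (R b)) \<and>
     (\<forall>b0\<in>B. \<exists>U \<Phi>. openin (top_of_set B) U \<and> b0 \<in> U \<and>
        local_trivialization I F U (F b0) \<Phi> \<and> (\<forall>b\<in>U. \<Phi> b ` R b = R b0))"

text \<open>The isotropic Grassmannian with its topology and smooth structure: a subspace \<open>W\<close> is
  represented by the orthogonal projector onto \<open>W\<close> for the auxiliary inner product.  Over the
  projector \<open>P\<close>, the bundle \<open>S\<^sup>3 U\<^sub>k\<close> has the fibre \<open>S30 J g (range P)\<close>; here the tautological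
  fibre \<open>(W, J)\<close> is identified with \<open>W\<^sup>1\<^sup>,\<^sup>0\<close> as usual.\<close>

definition isotropic_proj ::
    "('v::euclidean_space \<Rightarrow> 'v) \<Rightarrow> ('v \<Rightarrow> 'v \<Rightarrow> real) \<Rightarrow> nat \<Rightarrow> ('v \<Rightarrow>\<^sub>L 'v) set" where
  "isotropic_proj J g k =
     {P. P o\<^sub>L P = P \<and> (\<forall>x y. blinfun_apply P x \<bullet> y = x \<bullet> blinfun_apply P y) \<and>
         range (blinfun_apply P) \<in> isotropic_grassmannian J g k}"

text \<open>Since the strata are totally ordered, the frontier condition also makes each stratum open in
  its closure relative to \<open>C\<close>.\<close>

definition stratification :: "'a::topological_space set \<Rightarrow> nat \<Rightarrow> (nat \<Rightarrow> 'a set) \<Rightarrow> bool" where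
  "stratification C N Y \<longleftrightarrow>
     C = (\<Union>k\<in>{0..N}. Y k) \<and>
     (\<forall>j\<in>{0..N}. \<forall>k\<in>{0..N}. j \<noteq> k \<longrightarrow> Y j \<inter> Y k = {}) \<and>
     (\<forall>k\<in>{0..N}. C \<inter> closure (Y k) = (\<Union>j\<in>{0..k}. Y j))"

definition orbit_space :: "'a::topological_space set \<Rightarrow> ('a \<Rightarrow> 'a set) \<Rightarrow> 'a set topology" where
  "orbit_space X orb =
     topology (\<lambda>Q. Q \<subseteq> orb ` X \<and> openin (top_of_set X) {x \<in> X. orb x \<in> Q})"

definition U_orbit ::
    "('v::euclidean_space \<Rightarrow> 'v) \<Rightarrow> ('v \<Rightarrow> 'v \<Rightarrow> real) \<Rightarrow> 'v bil \<Rightarrow> 'v bil set" where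
  "U_orbit J g S = {act A S | A. A \<in> Aut J g}"

text \<open>\<open>GL\<^sub>\<complex>(W)\<close>; its elements are given by linear maps on \<open>V\<close>, of which only the restriction to \<open>W\<close>
  matters.\<close>

definition GL :: "('v::real_vector \<Rightarrow> 'v) \<Rightarrow> 'v set \<Rightarrow> ('v \<Rightarrow> 'v) set" where
  "GL J W = {A. linear A \<and> (\<forall>x\<in>W. A (J x) = J (A x)) \<and> bij_betw A W W}"

text \<open>\<open>L\<close> restricts to \<open>S\<^sup>3 A\<close> on \<open>S30 J g W\<close>.\<close>

definition induces_S3 ::
    "('v::euclidean_space \<Rightarrow> 'v) \<Rightarrow> ('v \<Rightarrow> 'v \<Rightarrow> real) \<Rightarrow> 'v set \<Rightarrow> ('v \<Rightarrow> 'v)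
      \<Rightarrow> (('v \<times> 'v) bil \<Rightarrow> ('v \<times> 'v) bil) \<Rightarrow> bool" where
  "induces_S3 J g W A L \<longleftrightarrow>
     Vector_Spaces.linear (jscale iB) (jscale iB) L \<and>
     (\<forall>u1\<in>W10 J W. \<forall>u2\<in>W10 J W. \<forall>u3\<in>W10 J W.
        L (sym3 (omega J g) u1 u2 u3) =
        sym3 (omega J g) (map_prod A A u1) (map_prod A A u2) (map_prod A A u3))"

definition GL_orbit ::
    "('v::euclidean_space \<Rightarrow> 'v) \<Rightarrow> ('v \<Rightarrow> 'v \<Rightarrow> real) \<Rightarrow> 'v set \<Rightarrow> 'v bil \<Rightarrow> 'v bil set" where
  "GL_orbit J g W S =
     {realify (L T) | A L T. A \<in> GL J W \<and> induces_S3 J g W A L \<and> T \<in> S30_reg J g W \<and> realify T = S}"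

end

theory Submission
  imports Defs
begin

text \<open>
  As the \<open>S\<^sub>X\<close> anticommute with \<open>J\<close>, commutativity of the \<open>S\<^sub>X\<close> forces \<open>S\<^sub>X S\<^sub>Y = 0\<close>, so the support
  of \<open>S\<close> is an isotropic complex subspace; conversely isotropy of the support gives commutativity.
  The component \<open>S\<^sub>c\<close> depends linearly on \<open>S\<close>, so each statement about \<open>S\<^sup>3\<^sup>,\<^sup>0W\<close> becomes one about
  real tensors with values in \<open>W\<close>.

  The strata accumulate on each other because adding a small cube \<open>w\<^sup>3\<close> to \<open>S\<close> enlarges the support by
  \<open>\<complex>w\<close>, and dimensions of supports are lower semicontinuous.  The projector onto the support depends
  smoothly on \<open>S\<close> within a stratum by the Gram-Schmidt formulas, and nearby fibres are identified by an operator
  intertwining the projectors.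

  The orbit spaces agree by Witt's theorem: products of unitary reflections act transitively on
  isotropic \<open>k\<close>-dimensional subspaces, and an element of \<open>GL(W)\<close> extends by its inverse adjoint on a dual
  isotropic subspace.  Unipotent isometries provide continuous local sections, whence the orbit map is open.
\<close>

section \<open>Smooth maps\<close>

text \<open>Smoothness on a subset asks for local extensions to open sets of the ambient space.
  Strata and isotropic Grassmannians are in general not open, so each map on them comes from a
  formula that still makes sense nearby. Gram-Schmidt is applied to finitely many values of
  \<open>S\<close> at argument pairs that stay fixed while \<open>S\<close> varies, and adjoints
  with respect to \<open>g\<close> replace inverses of isometries, because the extended operators
  need be isometries only over the stratum. The same replacement lets every complex linear operator
  act on tensors, which the bundle charts require: operators intertwining two projectors need not be
  unitary.

  Computations in the complexification are kept to a minimum. The real and imaginary parts of the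
  single function \<open>theta\<close> are \<open>omega\<close> and \<open>g\<close>; a (3,0)-tensor
  becomes a real bilinear map \<open>S\<close> for which \<open>theta (S_X Y) Z\<close> is symmetric
  in all three arguments, multiplication by \<i> becomes composition with \<open>J\<close>, and
  identities between tensors are checked after pairing with an arbitrary \<open>Z\<close>.\<close>

definition smooth_on :: "'a::real_normed_vector set \<Rightarrow> ('a \<Rightarrow> 'b::real_normed_vector) \<Rightarrow> bool" where
  "smooth_on U f \<longleftrightarrow> (\<forall>m. Ck_on m U f)"

lemma Ck_on_subset: "Ck_on m U f \<Longrightarrow> V \<subseteq> U \<Longrightarrow> Ck_on m V f"
proof (induction m arbitrary: f)
  case 0 then show ?case by (auto intro: continuous_on_subset)
next
  case (Suc m) then show ?case by (auto simp: subset_iff) blast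
qed

lemma Ck_on_Suc_imp: "Ck_on (Suc m) U f \<Longrightarrow> Ck_on m U f"
proof (induction m arbitrary: f)
  case 0
  then show ?case
    by (auto intro!: continuous_at_imp_continuous_on dest!: bspec has_derivative_continuous)
next
  case (Suc m)
  then obtain f' where "\<forall>x\<in>U. (f has_derivative f' x) (at x)" "\<forall>v. Ck_on (Suc m) U (\<lambda>x. f' x v)"
    by (metis Ck_on.simps(2))
  with Suc.IH show ?case by auto
qed

lemma Ck_on_bounded_linear:
  assumes "bounded_linear L"
  shows "Ck_on m U f \<Longrightarrow> Ck_on m U (\<lambda>x. L (f x))"
proof (induction m arbitrary: f)
  case 0 then show ?case using bounded_linear.continuous_on[OF assms] by auto
next
  case (Suc m)
  then obtain f' where f': "\<forall>x\<in>U. (f has_derivative f' x) (at x)" "\<forall>v. Ck_on m U (\<lambda>x. f' x v)"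
    by auto
  show ?case unfolding Ck_on.simps
    using f' Suc.IH by (intro exI[of _ "\<lambda>x v. L (f' x v)"] conjI ballI allI bounded_linear.has_derivative[OF assms]) auto
qed

lemma Ck_on_const: "Ck_on m U (\<lambda>x. c)"
proof (induction m arbitrary: c)
  case (Suc m) then show ?case by (auto intro!: exI[of _ "\<lambda>x v. 0"])
qed auto

lemma Ck_on_ident: "Ck_on m U (\<lambda>x. x)"
  by (cases m) (auto intro!: exI[of _ "\<lambda>x v. v"] continuous_on_id Ck_on_const)

lemma Ck_on_add: "Ck_on m U f \<Longrightarrow> Ck_on m U h \<Longrightarrow> Ck_on m U (\<lambda>x. f x + h x)"
proof (induction m arbitrary: f h)
  case 0 then show ?case by (auto intro: continuous_on_add)
next
  case (Suc m)
  then obtain f' h' where f': "\<forall>x\<in>U. (f has_derivative f' x) (at x)" "\<forall>v. Ck_on m U (\<lambda>x. f' x v)"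
    and h': "\<forall>x\<in>U. (h has_derivative h' x) (at x)" "\<forall>v. Ck_on m U (\<lambda>x. h' x v)"
    by auto
  then show ?case using Suc.IH
    by (auto intro!: exI[of _ "\<lambda>x v. f' x v + h' x v"] has_derivative_add)
qed

text \<open>By Leibniz the derivative is a sum of two products of the same kind, so the induction
  runs with both factors arbitrary; the undifferentiated factor enters with one order less than it
  has.\<close>

lemma (in bounded_bilinear) Ck_on:
  "Ck_on m U f \<Longrightarrow> Ck_on m U h \<Longrightarrow> Ck_on m U (\<lambda>x. prod (f x) (h x))"
proof (induction m arbitrary: f h)
  case 0 then show ?case by (auto intro: continuous_on)
next
  case (Suc m)
  then obtain f' h' where f': "\<forall>x\<in>U. (f has_derivative f' x) (at x)" "\<forall>v. Ck_on m U (\<lambda>x. f' x v)"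
    and h': "\<forall>x\<in>U. (h has_derivative h' x) (at x)" "\<forall>v. Ck_on m U (\<lambda>x. h' x v)"
    by auto
  have f: "Ck_on m U f" and h: "Ck_on m U h" using Suc.prems Ck_on_Suc_imp by blast+
  show ?case
    unfolding Ck_on.simps
  proof (intro exI[of _ "\<lambda>x v. prod (f x) (h' x v) + prod (f' x v) (h x)"] conjI ballI allI)
    fix x assume "x \<in> U"
    with f' h' show "((\<lambda>x. prod (f x) (h x)) has_derivative (\<lambda>v. prod (f x) (h' x v) + prod (f' x v) (h x))) (at x)"
      by (intro FDERIV) auto
  next
    fix v show "Ck_on m U (\<lambda>x. prod (f x) (h' x v) + prod (f' x v) (h x))"
      using f h f' h' Suc.IH by (intro Ck_on_add) auto
  qed
qed

lemma smooth_on_subset: "smooth_on U f \<Longrightarrow> V \<subseteq> U \<Longrightarrow> smooth_on V f"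
  by (auto simp: smooth_on_def intro: Ck_on_subset)

lemma smooth_on_bounded_linear: "bounded_linear L \<Longrightarrow> smooth_on U f \<Longrightarrow> smooth_on U (\<lambda>x. L (f x))"
  by (auto simp: smooth_on_def intro: Ck_on_bounded_linear)

lemma smooth_on_const: "smooth_on U (\<lambda>x. c)"
  by (auto simp: smooth_on_def intro: Ck_on_const)

lemma smooth_on_ident: "smooth_on U (\<lambda>x. x)"
  by (auto simp: smooth_on_def intro: Ck_on_ident)

lemma smooth_on_add: "smooth_on U f \<Longrightarrow> smooth_on U h \<Longrightarrow> smooth_on U (\<lambda>x. f x + h x)"
  by (auto simp: smooth_on_def intro: Ck_on_add)

lemma (in bounded_bilinear) smooth_on:
  "smooth_on U f \<Longrightarrow> smooth_on U h \<Longrightarrow> smooth_on U (\<lambda>x. prod (f x) (h x))"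
  by (auto simp: smooth_on_def intro: Ck_on)

lemma smooth_on_minus: "smooth_on U f \<Longrightarrow> smooth_on U (\<lambda>x. - f x)"
  by (rule smooth_on_bounded_linear[OF bounded_linear_minus[OF bounded_linear_ident]])

lemma smooth_on_diff: "smooth_on U f \<Longrightarrow> smooth_on U h \<Longrightarrow> smooth_on U (\<lambda>x. f x - h x)"
  using smooth_on_add[of U f "\<lambda>x. - h x"] smooth_on_minus[of U h] by simp

lemma smooth_on_sum: "(\<And>i. i \<in> I \<Longrightarrow> smooth_on U (f i)) \<Longrightarrow> smooth_on U (\<lambda>x. \<Sum>i\<in>I. f i x)"
  by (induction I rule: infinite_finite_induct) (auto intro: smooth_on_const smooth_on_add)

text \<open>Openness matters: the derivative at a point depends on all nearby values, and these must
  agree as well.\<close>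

lemma Ck_on_cong:
  assumes "open U" "\<And>x. x \<in> U \<Longrightarrow> f x = h x" "Ck_on m U f"
  shows "Ck_on m U h"
proof (cases m)
  case 0
  then show ?thesis using assms(2,3) by (auto cong: continuous_on_cong)
next
  case (Suc n)
  with assms(3) obtain f' where f': "\<forall>x\<in>U. (f has_derivative f' x) (at x)" "\<forall>v. Ck_on n U (\<lambda>x. f' x v)" by auto
  have "(h has_derivative f' x) (at x)" if "x \<in> U" for x
    by (rule has_derivative_transform_within_open[OF _ assms(1) that assms(2)]) (use f'(1) that in auto)
  with f'(2) Suc show ?thesis by auto
qed

lemma smooth_on_cong:
  "open U \<Longrightarrow> (\<And>x. x \<in> U \<Longrightarrow> f x = h x) \<Longrightarrow> smooth_on U f \<Longrightarrow> smooth_on U h"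
  unfolding smooth_on_def using Ck_on_cong[of U f h] by blast

lemmas smooth_on_scaleR = bounded_bilinear.smooth_on[OF bounded_bilinear_scaleR]
lemmas smooth_on_inner = bounded_bilinear.smooth_on[OF bounded_bilinear_inner]
lemmas smooth_on_blinfun_apply = bounded_bilinear.smooth_on[OF bounded_bilinear_blinfun_apply]
lemmas smooth_on_blinfun_compose = bounded_bilinear.smooth_on[OF bounded_bilinear_blinfun_compose]

lemma smooth_on_fst: "smooth_on U f \<Longrightarrow> smooth_on U (\<lambda>x. fst (f x))"
  by (rule smooth_on_bounded_linear[OF bounded_linear_fst])

lemma smooth_on_snd: "smooth_on U f \<Longrightarrow> smooth_on U (\<lambda>x. snd (f x))"
  by (rule smooth_on_bounded_linear[OF bounded_linear_snd])

lemma smooth_on_Pair: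
  assumes "smooth_on U f" "smooth_on U h"
  shows "smooth_on U (\<lambda>x. (f x, h x))"
proof -
  have "bounded_linear (\<lambda>y::'b. (y, 0::'c))" "bounded_linear (\<lambda>y::'c. (0::'b, y))"
    by (intro bounded_linear_Pair bounded_linear_ident bounded_linear_zero)+
  from smooth_on_add[OF smooth_on_bounded_linear[OF this(1) assms(1)] smooth_on_bounded_linear[OF this(2) assms(2)]]
  show ?thesis by simp
qed

lemma smooth_on_imp_continuous_on: "smooth_on U f \<Longrightarrow> continuous_on U f"
  unfolding smooth_on_def using Ck_on.simps(1) by blast

lemma blinfun_basis_expansion:
  fixes A :: "'a::euclidean_space \<Rightarrow>\<^sub>L 'b::real_normed_vector"
  shows "A = (\<Sum>i\<in>Basis. blinfun_scaleR_left (A i) o\<^sub>L blinfun_inner_left i)"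
proof (rule blinfun_eqI)
  fix x
  have "A x = A (\<Sum>i\<in>Basis. (x \<bullet> i) *\<^sub>R i)" by (simp add: euclidean_representation)
  also have "\<dots> = (\<Sum>i\<in>Basis. (x \<bullet> i) *\<^sub>R A i)"
    by (simp only: blinfun.sum_right blinfun.scaleR_right)
  finally show "A x = (\<Sum>i\<in>Basis. blinfun_scaleR_left (A i) o\<^sub>L blinfun_inner_left i) x"
    by (simp add: blinfun.sum_left blinfun_inner_left.rep_eq)
qed

text \<open>An operator on a finite-dimensional space is a finite combination of rank-one operators
  whose coefficients are its values on a basis, so regularity of operator-valued maps can be tested
  on single vectors.\<close>

lemma smooth_on_blinfunI:
  fixes f :: "'c::real_normed_vector \<Rightarrow> 'a::euclidean_space \<Rightarrow>\<^sub>L 'b::real_normed_vector"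
  assumes "\<And>X. smooth_on U (\<lambda>x. f x X)"
  shows "smooth_on U f"
proof -
  have "smooth_on U (\<lambda>x. \<Sum>i\<in>Basis. blinfun_scaleR_left (f x i) o\<^sub>L blinfun_inner_left i)"
    by (intro smooth_on_sum smooth_on_blinfun_compose smooth_on_const
        smooth_on_bounded_linear[OF bounded_linear_blinfun_scaleR_left] assms)
  then show ?thesis by (simp flip: blinfun_basis_expansion)
qed

lemma Ck_on_inverse:
  fixes f :: "'a::real_normed_vector \<Rightarrow> real"
  assumes "\<And>x. x \<in> U \<Longrightarrow> f x \<noteq> 0"
  shows "Ck_on m U f \<Longrightarrow> Ck_on m U (\<lambda>x. inverse (f x))"
proof (induction m)
  case 0 then show ?case using assms by (auto intro: continuous_on_inverse)
next
  case (Suc m)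
  then obtain f' where f': "\<forall>x\<in>U. (f has_derivative f' x) (at x)" "\<forall>v. Ck_on m U (\<lambda>x. f' x v)"
    by auto
  have i: "Ck_on m U (\<lambda>x. inverse (f x))" using Suc Ck_on_Suc_imp by blast
  show ?case unfolding Ck_on.simps
  proof (intro exI[of _ "\<lambda>x v. - (inverse (f x) * f' x v * inverse (f x))"] conjI ballI allI)
    fix x assume "x \<in> U"
    then show "((\<lambda>x. inverse (f x)) has_derivative (\<lambda>v. - (inverse (f x) * f' x v * inverse (f x)))) (at x)"
      using f' assms by (intro Deriv.has_derivative_inverse) auto
  next
    fix v show "Ck_on m U (\<lambda>x. - (inverse (f x) * f' x v * inverse (f x)))"
      using f' i by (intro Ck_on_bounded_linear[OF bounded_linear_minus[OF bounded_linear_ident]] bounded_bilinear.Ck_on[OF bounded_bilinear_mult]) auto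
  qed
qed

lemma smooth_on_inverse:
  fixes f :: "'a::real_normed_vector \<Rightarrow> real"
  shows "(\<And>x. x \<in> U \<Longrightarrow> f x \<noteq> 0) \<Longrightarrow> smooth_on U f \<Longrightarrow> smooth_on U (\<lambda>x. inverse (f x))"
  by (auto simp: smooth_on_def intro: Ck_on_inverse)

text \<open>The term of the product rule with the derivative of \<open>k\<close> would be multiplied
  by \<open>u x = 0\<close>, so continuity of \<open>k\<close> suffices. This is what makes the
  inverse of an operator differentiable once it is known to be continuous.\<close>

lemma (in bounded_bilinear) has_derivative_continuous_times_zero:
  assumes "isCont k x" "(u has_derivative u') (at x)" "u x = 0"
  shows "((\<lambda>y. prod (k y) (u y)) has_derivative (\<lambda>v. prod (k x) (u' v))) (at x)"
proof -
  obtain K where K: "K > 0" "\<And>a b. norm (prod a b) \<le> norm a * norm b * K"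
    using pos_bounded by blast
  have u': "bounded_linear u'" using assms(2) has_derivative_bounded_linear by blast
  have lim: "((\<lambda>y. norm (u y - u' (y - x)) / norm (y - x)) \<longlongrightarrow> 0) (at x)"
    using assms(2,3) by (simp add: has_derivative_iff_norm)
  obtain M where M: "M \<ge> 0" "\<And>v. norm (u' v) \<le> norm v * M"
    using bounded_linear.nonneg_bounded[OF u'] by blast
  have bl: "bounded_linear (\<lambda>v. prod (k x) (u' v))"
    by (rule bounded_linear_compose[OF bounded_linear_right u'])
  have "((\<lambda>y. norm (k y) * (norm (u y - u' (y - x)) / norm (y - x)) * K + norm (k y - k x) * M * K) \<longlongrightarrow>
      norm (k x) * 0 * K + norm (k x - k x) * M * K) (at x)"
    using assms(1) lim by (intro tendsto_intros) (auto simp: isCont_def)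
  then have lim2: "((\<lambda>y. norm (k y) * (norm (u y - u' (y - x)) / norm (y - x)) * K + norm (k y - k x) * M * K) \<longlongrightarrow> 0) (at x)"
    by simp
  have bd: "norm (prod (k y) (u y) - prod (k x) (u x) - prod (k x) (u' (y - x))) / norm (y - x)
      \<le> norm (k y) * (norm (u y - u' (y - x)) / norm (y - x)) * K + norm (k y - k x) * M * K" if "y \<noteq> x" for y
  proof -
    have "prod (k y) (u y) - prod (k x) (u x) - prod (k x) (u' (y - x))
        = prod (k y) (u y - u' (y - x)) + prod (k y - k x) (u' (y - x))"
      by (simp add: assms(3) zero_right diff_right diff_left)
    then have "norm (prod (k y) (u y) - prod (k x) (u x) - prod (k x) (u' (y - x)))
       \<le> norm (k y) * norm (u y - u' (y - x)) * K + norm (k y - k x) * norm (u' (y - x)) * K"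
      using K(2) norm_triangle_le add_mono by metis
    also have "\<dots> \<le> norm (k y) * norm (u y - u' (y - x)) * K + norm (k y - k x) * (norm (y - x) * M) * K"
      using K(1) M by (intro add_left_mono mult_right_mono mult_left_mono) auto
    also have "\<dots> = (norm (k y) * (norm (u y - u' (y - x)) / norm (y - x)) * K + norm (k y - k x) * M * K) * norm (y - x)"
      using that by (simp add: field_simps)
    finally show ?thesis using that by (simp add: pos_divide_le_eq)
  qed
  show ?thesis unfolding has_derivative_iff_norm
  proof (intro conjI bl tendsto_0_le[OF lim2, of _ 1])
    show "\<forall>\<^sub>F y in at x. norm (norm (prod (k y) (u y) - prod (k x) (u x) - prod (k x) (u' (y - x))) / norm (y - x))
      \<le> norm (norm (k y) * (norm (u y - u' (y - x)) / norm (y - x)) * K + norm (k y - k x) * M * K) * 1"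
      unfolding eventually_at_filter real_norm_def
      by (intro always_eventually allI impI) (use bd in \<open>auto intro: order.trans[OF _ abs_ge_self]\<close>)
  qed
qed

section \<open>Inverses of operators near the identity\<close>

definition binv :: "('v::euclidean_space \<Rightarrow>\<^sub>L 'v) \<Rightarrow> 'v \<Rightarrow>\<^sub>L 'v" where
  "binv A = Blinfun (inv_into UNIV (blinfun_apply A))"

lemma linear_blinfun: "linear (blinfun_apply A)"
  using blinfun.bounded_linear_right bounded_linear.linear by blast

lemma binv_bij:
  fixes A :: "'v::euclidean_space \<Rightarrow>\<^sub>L 'v"
  assumes "inj (blinfun_apply A)"
  shows "binv A (A x) = x" "A (binv A x) = x" "bij (blinfun_apply A)"
proof -
  have s: "surj (blinfun_apply A)" using linear_inj_imp_surj[OF linear_blinfun assms] .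
  show b: "bij (blinfun_apply A)" using assms s by (simp add: bij_def)
  have "linear (inv_into UNIV (blinfun_apply A))"
    using inj_linear_imp_inv_linear[OF linear_blinfun assms] .
  then have bi: "blinfun_apply (binv A) = inv_into UNIV (blinfun_apply A)"
    unfolding binv_def by (intro bounded_linear_Blinfun_apply linear_conv_bounded_linear[THEN iffD1])
  show "binv A (A x) = x" "A (binv A x) = x"
    unfolding bi using assms s by (auto simp: surj_f_inv_f)
qed

text \<open>In \<open>norm x \<le> norm (A x) + norm (x - A x)\<close> the last term is at most half
  of \<open>norm x\<close> and is absorbed; no Neumann series enters. The bound on the inverse is
  uniform, which gives a Lipschitz estimate for inversion.\<close>

lemma near_id_inj:
  fixes A :: "'v::euclidean_space \<Rightarrow>\<^sub>L 'v"
  assumes "norm (id_blinfun - A) \<le> 1/2"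
  shows "norm x \<le> 2 * norm (A x)" "inj (blinfun_apply A)" "norm (binv A) \<le> 2"
proof -
  have *: "norm x \<le> 2 * norm (A x)" for x
  proof -
    have "norm x \<le> norm (A x) + norm (x - A x)" by norm
    also have "norm (x - A x) \<le> norm (id_blinfun - A) * norm x"
      using norm_blinfun[of "id_blinfun - A" x] by (simp add: blinfun.diff_left)
    also have "\<dots> \<le> 1/2 * norm x" using assms by (intro mult_right_mono) auto
    finally show ?thesis by simp
  qed
  then show "norm x \<le> 2 * norm (A x)" .
  show inj: "inj (blinfun_apply A)"
    unfolding linear_injective_0[OF linear_blinfun] using *
    by (metis mult_zero_right norm_le_zero_iff norm_zero)
  show "norm (binv A) \<le> 2"
    using *[of "binv A _"] binv_bij(2)[OF inj] by (intro norm_blinfun_bound) auto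
qed

text \<open>The resolvent identity; continuity and the derivative of inversion both come from
  it.\<close>

lemma binv_diff:
  assumes "inj (blinfun_apply A)" "inj (blinfun_apply B)"
  shows "binv A - binv B = binv A o\<^sub>L (B - A) o\<^sub>L binv B"
  by (rule blinfun_eqI) (simp add: blinfun.diff_left blinfun.diff_right binv_bij assms)

text \<open>The derivative of the inverse is a product of two inverses and the derivative of
  \<open>f\<close>, so it is as regular as the inverse is already known to be.\<close>

lemma Ck_on_binv:
  fixes f :: "'a::real_normed_vector \<Rightarrow> 'v::euclidean_space \<Rightarrow>\<^sub>L 'v"
  assumes near: "\<And>x. x \<in> U \<Longrightarrow> norm (id_blinfun - f x) \<le> 1/2" and "open U"
  shows "Ck_on m U f \<Longrightarrow> Ck_on m U (\<lambda>x. binv (f x))"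
proof (induction m)
  case 0
  \<comment> \<open>The constant 4 is the product of the bounds 2 on the two inverses in the
    resolvent identity.\<close>
  have dist: "norm (binv (f y) - binv (f x)) \<le> 4 * norm (f y - f x)" if "x \<in> U" "y \<in> U" for x y
  proof -
    have "norm (binv (f y) - binv (f x)) = norm (binv (f y) o\<^sub>L (f x - f y) o\<^sub>L binv (f x))"
      unfolding binv_diff[OF near_id_inj(2)[OF near[OF that(2)]] near_id_inj(2)[OF near[OF that(1)]]] ..
    also have "\<dots> \<le> norm (binv (f y)) * norm (f x - f y) * norm (binv (f x))"
      by (meson norm_blinfun_compose mult_right_mono norm_ge_zero order.trans)
    also have "\<dots> \<le> 2 * norm (f x - f y) * 2"
      using that near near_id_inj(3) by (intro mult_mono) auto
    finally show ?thesis by (simp add: norm_minus_commute)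
  qed
  have c: "continuous_on U f" using 0 by simp
  show ?case unfolding Ck_on.simps continuous_on_def
  proof
    fix x assume x: "x \<in> U"
    have "(f \<longlongrightarrow> f x) (at x within U)" using c x by (simp add: continuous_on_def)
    then have "((\<lambda>y. norm (f y - f x)) \<longlongrightarrow> 0) (at x within U)"
      by (simp add: LIM_zero tendsto_norm_zero)
    then have "((\<lambda>y. binv (f y) - binv (f x)) \<longlongrightarrow> 0) (at x within U)"
      by (rule tendsto_0_le[of _ _ _ 4]) (auto simp: eventually_at_filter mult.commute intro!: always_eventually dist[OF x])
    then show "((\<lambda>y. binv (f y)) \<longlongrightarrow> binv (f x)) (at x within U)" by (simp add: LIM_zero_iff)
  qed
next
  case (Suc m)
  then obtain f' where f': "\<forall>x\<in>U. (f has_derivative f' x) (at x)" "\<forall>v. Ck_on m U (\<lambda>x. f' x v)"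
    by auto
  have i: "Ck_on m U (\<lambda>x. binv (f x))" using Suc Ck_on_Suc_imp by blast
  have "Ck_on 0 U (\<lambda>x. binv (f x))" using i by (induction m) (use Ck_on_Suc_imp in blast)+
  then have cont: "continuous_on U (\<lambda>x. binv (f x))" by simp
  show ?case unfolding Ck_on.simps
  proof (intro exI[of _ "\<lambda>x v. - ((binv (f x) o\<^sub>L f' x v) o\<^sub>L binv (f x))"] conjI ballI allI)
    fix x assume x: "x \<in> U"
    have isc: "isCont (\<lambda>x. binv (f x)) x" using cont x \<open>open U\<close> continuous_on_eq_continuous_at by blast
    have d: "((\<lambda>y. f x - f y) has_derivative (\<lambda>v. - f' x v)) (at x)"
      using f' x by (auto intro!: derivative_eq_intros)
    \<comment> \<open>Only the left inverse varies with \<open>y\<close>, and the middle factor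
      vanishes at \<open>x\<close>; hence continuity of inversion, known from the lower order, is
      enough here.\<close>
    have "((\<lambda>y. binv (f y) o\<^sub>L (f x - f y)) has_derivative (\<lambda>v. binv (f x) o\<^sub>L (- f' x v))) (at x)"
      by (rule bounded_bilinear.has_derivative_continuous_times_zero[OF bounded_bilinear_blinfun_compose isc d]) simp
    from has_derivative_add[OF bounded_linear.has_derivative[OF
        bounded_bilinear.bounded_linear_left[OF bounded_bilinear_blinfun_compose] this] has_derivative_const]
    have "((\<lambda>y. ((binv (f y) o\<^sub>L (f x - f y)) o\<^sub>L binv (f x)) + binv (f x))
        has_derivative (\<lambda>v. ((binv (f x) o\<^sub>L (- f' x v)) o\<^sub>L binv (f x)) + 0)) (at x)" .
    also have "(\<lambda>v. ((binv (f x) o\<^sub>L (- f' x v)) o\<^sub>L binv (f x)) + 0) = (\<lambda>v. - ((binv (f x) o\<^sub>L f' x v) o\<^sub>L binv (f x)))"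
      by (intro ext blinfun_eqI) (simp add: blinfun.minus_left blinfun.minus_right)
    finally have D: "((\<lambda>y. ((binv (f y) o\<^sub>L (f x - f y)) o\<^sub>L binv (f x)) + binv (f x))
        has_derivative (\<lambda>v. - ((binv (f x) o\<^sub>L f' x v) o\<^sub>L binv (f x)))) (at x)" .
    have "((binv (f y) o\<^sub>L (f x - f y)) o\<^sub>L binv (f x)) + binv (f x) = binv (f y)" if "y \<in> U" for y
      by (simp flip: binv_diff[OF near_id_inj(2)[OF near[OF that]] near_id_inj(2)[OF near[OF x]]])
    from has_derivative_transform_within_open[OF D \<open>open U\<close> x this]
    show "((\<lambda>x. binv (f x)) has_derivative (\<lambda>v. - ((binv (f x) o\<^sub>L f' x v) o\<^sub>L binv (f x)))) (at x)" .
  next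
    fix v show "Ck_on m U (\<lambda>x. - ((binv (f x) o\<^sub>L f' x v) o\<^sub>L binv (f x)))"
      using f' i by (intro Ck_on_bounded_linear[OF bounded_linear_minus[OF bounded_linear_ident]]
          bounded_bilinear.Ck_on[OF bounded_bilinear_blinfun_compose]) auto
  qed
qed

lemma smooth_on_binv:
  fixes f :: "'a::real_normed_vector \<Rightarrow> 'v::euclidean_space \<Rightarrow>\<^sub>L 'v"
  assumes "\<And>x. x \<in> U \<Longrightarrow> norm (id_blinfun - f x) \<le> 1/2" and "open U" and "smooth_on U f"
  shows "smooth_on U (\<lambda>x. binv (f x))"
  using assms by (auto simp: smooth_on_def intro: Ck_on_binv)

lemma smooth_mapI:
  assumes "\<And>x. x \<in> A \<Longrightarrow> \<exists>U F. open U \<and> x \<in> U \<and> smooth_on U F \<and> (\<forall>y\<in>A \<inter> U. F y = f y)"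
  shows "smooth_map A f"
  using assms by (auto simp: smooth_map_def smooth_on_def)

lemma smooth_map_linear:
  assumes "bounded_linear L" "\<And>x. x \<in> A \<Longrightarrow> f x = L x"
  shows "smooth_map A f"
  by (rule smooth_mapI, intro exI[of _ UNIV] exI[of _ L])
    (use assms smooth_on_bounded_linear[OF assms(1) smooth_on_ident] in auto)

lemma diffeomorphismI:
  assumes "\<And>x. x \<in> A \<Longrightarrow> f x \<in> B" "\<And>y. y \<in> B \<Longrightarrow> h y \<in> A"
    "\<And>x. x \<in> A \<Longrightarrow> h (f x) = x" "\<And>y. y \<in> B \<Longrightarrow> f (h y) = y"
    "smooth_map A f" "smooth_map B h"
  shows "diffeomorphism A B f"
proof -
  have bij: "bij_betw f A B" by (rule bij_betw_byWitness[where f' = h]) (use assms in auto)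
  have "inv_into A f y = h y" if "y \<in> B" for y
    using assms that bij by (metis bij_betw_inv_into_left)
  with assms(6) have "smooth_map B (inv_into A f)" unfolding smooth_map_def by (metis IntE)
  with bij assms show ?thesis by (simp add: diffeomorphism_def)
qed

section \<open>Complex structures\<close>

locale complex_structure =
  fixes J :: "'a::real_vector \<Rightarrow> 'a"
  assumes linJ: "linear J" and JJ [simp]: "J (J x) = - x"
begin

lemma J_simps [simp]:
  "J 0 = 0" "J (x + y) = J x + J y" "J (x - y) = J x - J y" "J (- x) = - J x" "J (r *\<^sub>R x) = r *\<^sub>R J x"
  using linJ by (auto simp: linear_0 linear_add linear_diff linear_neg linear_scale)

sublocale C: vector_space "jscale J"
  by unfold_locales (auto simp: jscale_def algebra_simps)

lemma jscale_simps [simp]: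
  "jscale J (complex_of_real r) x = r *\<^sub>R x" "jscale J \<i> x = J x" "J (jscale J c x) = jscale J c (J x)"
  "jscale J c (J x) = jscale J (\<i> * c) x" "jscale J c (r *\<^sub>R x) = r *\<^sub>R jscale J c x"
  by (auto simp: jscale_def algebra_simps)

lemma complex_subspace_iff: "complex_subspace J W \<longleftrightarrow> C.subspace W"
proof
  assume "complex_subspace J W"
  then show "C.subspace W"
    by (auto simp: complex_subspace_def C.subspace_def jscale_def subspace_def)
next
  assume W: "C.subspace W"
  have "r *\<^sub>R x \<in> W" "J x \<in> W" if "x \<in> W" for r x
    using C.subspace_scale[OF W that, of "complex_of_real r"] C.subspace_scale[OF W that, of \<i>] by auto
  with W show "complex_subspace J W"
    by (auto simp: complex_subspace_def C.subspace_def subspace_def)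
qed

lemma complex_subspace_cspan: "complex_subspace J (cspan J S)"
  by (simp add: complex_subspace_iff C.subspace_span)

lemma cspan_eq_span:
  assumes "\<And>x. x \<in> S \<Longrightarrow> J x \<in> span S"
  shows "cspan J S = span S"
proof
  have "J x \<in> span S" if "x \<in> span S" for x
    using that by (induction rule: span_induct_alt) (auto intro: span_add span_scale span_zero assms)
  then have "C.subspace (span S)"
    unfolding complex_subspace_iff[symmetric] by (simp add: complex_subspace_def)
  then show "cspan J S \<subseteq> span S" using C.span_minimal span_superset by blast
  show "span S \<subseteq> cspan J S"
    using complex_subspace_cspan[of S] C.span_superset[of S] span_minimal
    unfolding complex_subspace_def by blast
qed

text \<open>Stated for indexed families rather than sets: a repeated vector counts as a dependence,
  and elimination can modify the vectors in place without making their set smaller.\<close>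

definition cindep :: "nat \<Rightarrow> (nat \<Rightarrow> 'a) \<Rightarrow> bool" where
  "cindep k v \<longleftrightarrow> (\<forall>c. (\<Sum>i<k. jscale J (c i) (v i)) = 0 \<longrightarrow> (\<forall>i<k. c i = 0))"

lemma cindepD: "cindep k v \<Longrightarrow> (\<Sum>i<k. jscale J (c i) (v i)) = 0 \<Longrightarrow> i < k \<Longrightarrow> c i = 0"
  unfolding cindep_def by blast

lemma cindep_inj:
  assumes "cindep k v" shows "inj_on v {..<k}"
proof (rule inj_onI, rule ccontr)
  fix i j assume ij: "i \<in> {..<k}" "j \<in> {..<k}" "v i = v j" "i \<noteq> j"
  let ?c = "\<lambda>l. if l = i then 1 else if l = j then -1 else (0::complex)"
  have "(\<Sum>l<k. jscale J (?c l) (v l)) = (\<Sum>l\<in>{i, j}. jscale J (?c l) (v l))"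
    using ij by (intro sum.mono_neutral_right) auto
  also have "\<dots> = 0" using ij by simp
  finally show False using cindepD[OF assms, of ?c i] ij by simp
qed

lemma cindep_independent:
  assumes "cindep k v" shows "C.independent (v ` {..<k})"
proof (rule C.independent_if_scalars_zero)
  fix f x assume "(\<Sum>x\<in>v ` {..<k}. jscale J (f x) x) = 0" "x \<in> v ` {..<k}"
  then show "f x = 0"
    using assms unfolding cindep_def by (auto simp: sum.reindex[OF cindep_inj[OF assms]])
qed simp

lemma independent_cindep:
  assumes "C.independent B" "bij_betw v {..<k} B"
  shows "cindep k v"
  unfolding cindep_def
proof (intro allI impI)
  fix c :: "nat \<Rightarrow> complex" and i assume c: "(\<Sum>i<k. jscale J (c i) (v i)) = 0" "i < k"
  have "(\<Sum>b\<in>B. jscale J (c (inv_into {..<k} v b)) b) = (\<Sum>i<k. jscale J (c (inv_into {..<k} v (v i))) (v i))"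
    by (rule sum.reindex_bij_betw[OF assms(2), symmetric])
  also have "\<dots> = (\<Sum>i<k. jscale J (c i) (v i))"
    using assms(2) by (intro sum.cong) (auto simp: bij_betw_def inv_into_f_f)
  finally have "(\<Sum>b\<in>B. jscale J (c (inv_into {..<k} v b)) b) = 0" using c by simp
  moreover have "finite B" "v i \<in> B" using assms(2) bij_betw_finite c(2) by (auto simp: bij_betw_def)
  ultimately have "c (inv_into {..<k} v (v i)) = 0"
    using C.independentD[OF assms(1), of B "\<lambda>b. c (inv_into {..<k} v b)" "v i"] by auto
  then show "c i = 0" using assms(2) c(2) by (simp add: bij_betw_def inv_into_f_f)
qed

text \<open>Fraction-free Gaussian elimination; it exhibits linear independence as the nonvanishing of
  polynomials in the coordinates without determinants.\<close>

lemma cindep_Suc_iff: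
  assumes phi: "\<And>b. b \<in> I \<Longrightarrow> Vector_Spaces.linear (jscale J) (*) (\<phi> b)"
    and sep: "\<And>x. (\<And>b. b \<in> I \<Longrightarrow> \<phi> b x = 0) \<Longrightarrow> x = 0"
  shows "cindep (Suc k) v \<longleftrightarrow>
    (\<exists>b\<in>I. \<phi> b (v k) \<noteq> 0 \<and> cindep k (\<lambda>i. jscale J (\<phi> b (v k)) (v i) - jscale J (\<phi> b (v i)) (v k)))"
    (is "?L \<longleftrightarrow> ?R")
proof
  assume L: ?L
  have "v k \<noteq> 0"
  proof
    assume "v k = 0"
    then have "(\<Sum>i<Suc k. jscale J (if i = k then 1 else 0) (v i)) = 0" by simp
    from cindepD[OF L this, of k] show False by simp
  qed
  then obtain b where b: "b \<in> I" "\<phi> b (v k) \<noteq> 0" using sep by blast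
  show ?R
    unfolding cindep_def
  proof (intro bexI[OF _ b(1)] conjI b(2) allI impI)
    fix c i assume c: "(\<Sum>i<k. jscale J (c i) (jscale J (\<phi> b (v k)) (v i) - jscale J (\<phi> b (v i)) (v k))) = 0"
      and "i < k"
    \<comment> \<open>The same relation in terms of the original family: each coefficient picks up
      the pivot, and the last one collects all subtracted multiples of \<open>v k\<close>.\<close>
    let ?d = "\<lambda>i. if i = k then - (\<Sum>i<k. c i * \<phi> b (v i)) else c i * \<phi> b (v k)"
    have "(\<Sum>i<Suc k. jscale J (?d i) (v i)) =
       (\<Sum>i<k. jscale J (c i * \<phi> b (v k)) (v i)) - jscale J (\<Sum>i<k. c i * \<phi> b (v i)) (v k)"
      by (simp add: C.scale_minus_left)
    also have "\<dots> = 0"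
      using c by (simp add: C.scale_right_diff_distrib sum_subtractf C.scale_sum_left)
    finally have "?d i = 0" by (rule cindepD[OF L]) (use \<open>i < k\<close> in simp)
    then show "c i = 0" using b \<open>i < k\<close> by simp
  qed
next
  assume ?R
  then obtain b where b: "b \<in> I" "\<phi> b (v k) \<noteq> 0"
    and R: "cindep k (\<lambda>i. jscale J (\<phi> b (v k)) (v i) - jscale J (\<phi> b (v i)) (v k))" by blast
  interpret l: Vector_Spaces.linear "jscale J" "(*)" "\<phi> b" by (rule phi[OF b(1)])
  show ?L
    unfolding cindep_def
  proof (intro allI impI)
    fix c i assume c: "(\<Sum>i<Suc k. jscale J (c i) (v i)) = 0" and "i < Suc k"
    have "\<phi> b (\<Sum>i<Suc k. jscale J (c i) (v i)) = 0" using c l.zero by simp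
    then have phi0: "(\<Sum>i<k. c i * \<phi> b (v i)) + c k * \<phi> b (v k) = 0"
      by (simp add: l.add l.sum l.scale)
    have "(\<Sum>i<k. jscale J (c i) (jscale J (\<phi> b (v k)) (v i) - jscale J (\<phi> b (v i)) (v k)))
        = jscale J (\<phi> b (v k)) (\<Sum>i<k. jscale J (c i) (v i)) - jscale J (\<Sum>i<k. c i * \<phi> b (v i)) (v k)"
      by (simp add: C.scale_right_diff_distrib sum_subtractf C.scale_sum_left C.scale_sum_right mult.commute)
    also have "(\<Sum>i<k. c i * \<phi> b (v i)) = - (\<phi> b (v k) * c k)"
      using phi0 by (simp add: add_eq_0_iff2 mult.commute)
    also have "jscale J (\<phi> b (v k)) (\<Sum>i<k. jscale J (c i) (v i)) - jscale J (- (\<phi> b (v k) * c k)) (v k)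
        = jscale J (\<phi> b (v k)) (\<Sum>i<Suc k. jscale J (c i) (v i))"
      by (simp add: C.scale_minus_left C.scale_right_distrib)
    also have "\<dots> = 0" using c by simp
    finally have z: "\<forall>i<k. c i = 0" using cindepD[OF R] by blast
    moreover have "c k = 0" using phi0 b z by simp
    ultimately show "c i = 0" using \<open>i < Suc k\<close> by (auto simp: less_Suc_eq)
  qed
qed

end

locale complex_structure_euclidean = complex_structure J
  for J :: "'v::euclidean_space \<Rightarrow> 'v"
begin

lemma span_insert_J: "span (insert (J x) (insert x (cspan J B))) = cspan J (insert x B)"
proof (intro equalityI)
  have "subspace (cspan J (insert x B))" "\<And>y. y \<in> cspan J (insert x B) \<Longrightarrow> J y \<in> cspan J (insert x B)"
    using complex_subspace_cspan[of "insert x B"] by (auto simp: complex_subspace_def)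
  moreover have "x \<in> cspan J (insert x B)" "cspan J B \<subseteq> cspan J (insert x B)"
    by (auto intro: C.span_base C.span_mono[THEN subsetD])
  ultimately show "span (insert (J x) (insert x (cspan J B))) \<subseteq> cspan J (insert x B)"
    by (intro span_minimal) auto
  show "cspan J (insert x B) \<subseteq> span (insert (J x) (insert x (cspan J B)))"
  proof
    fix y assume "y \<in> cspan J (insert x B)"
    then obtain c where c: "y - jscale J c x \<in> cspan J B" by (auto simp: C.span_insert)
    have "y = (y - jscale J c x) + Re c *\<^sub>R x + Im c *\<^sub>R J x" by (simp add: jscale_def)
    also have "\<dots> \<in> span (insert (J x) (insert x (cspan J B)))"
      using c by (intro span_add span_scale span_base) auto
    finally show "y \<in> span (insert (J x) (insert x (cspan J B)))" .
  qed
qed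

text \<open>A relation \<open>J x - r x\<close> in the complex span would put the multiple of
  \<open>x\<close> by \<open>\<i> - r\<close> there; that scalar is invertible, so \<open>x\<close>
  would lie there too. Hence \<open>x\<close> and \<open>J x\<close> both raise the real
  dimension.\<close>

lemma dim_cspan_insert:
  assumes "x \<notin> cspan J B"
  shows "dim (cspan J (insert x B)) = dim (cspan J B) + 2"
proof -
  have s: "span (cspan J B) = cspan J B"
    using complex_subspace_cspan[of B] by (simp add: complex_subspace_def)
  have "J x \<notin> span (insert x (cspan J B))"
  proof
    assume "J x \<in> span (insert x (cspan J B))"
    then obtain r where r: "J x - r *\<^sub>R x \<in> cspan J B" using span_insert[of x "cspan J B"] s by auto
    have "jscale J (\<i> - complex_of_real r) x \<in> cspan J B"
      using r by (simp add: C.scale_left_diff_distrib)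
    then have "jscale J (inverse (\<i> - complex_of_real r)) (jscale J (\<i> - complex_of_real r) x) \<in> cspan J B"
      by (rule C.span_scale)
    moreover have "\<i> - complex_of_real r \<noteq> 0" by (simp add: complex_eq_iff)
    ultimately show False using assms by simp
  qed
  then have "dim (insert (J x) (insert x (cspan J B))) = dim (cspan J B) + 2"
    using assms by (simp add: dim_insert s del: span_eq_iff)
  then show ?thesis by (metis span_insert_J dim_span)
qed

text \<open>Real spans lie in complex spans, so complex independence implies real independence,
  which bounds the cardinality.\<close>

lemma cindependent_finite: "C.independent B \<Longrightarrow> finite B"
proof -
  assume "C.independent B"
  moreover have "independent B" if "C.independent B"
  proof -
    have "span (B - {a}) \<subseteq> cspan J (B - {a})" for a
      using complex_subspace_cspan[of "B - {a}"] C.span_superset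
      by (intro span_minimal) (auto simp: complex_subspace_def)
    with that show ?thesis unfolding C.dependent_def dependent_def by blast
  qed
  ultimately show ?thesis using independent_bound by blast
qed

lemma dim_cspan_independent: "C.independent B \<Longrightarrow> dim (cspan J B) = 2 * card B"
proof -
  assume B: "C.independent B"
  from cindependent_finite[OF this] this show ?thesis
  proof (induction B)
    case (insert x B)
    then have "x \<notin> cspan J B" "C.independent B" by (auto simp: C.independent_insert)
    with insert show ?case by (simp add: dim_cspan_insert)
  qed (simp add: C.span_empty)
qed

lemma cdim_cspan_independent: "C.independent B \<Longrightarrow> cdim J (cspan J B) = card B"
  by (rule C.dim_span_eq_card_independent)

lemma obtain_cbasis:
  assumes "complex_subspace J W"
  obtains B where "B \<subseteq> W" "C.independent B" "finite B" "cspan J B = W" "card B = cdim J W" "dim W = 2 * card B"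
proof -
  obtain B where B: "B \<subseteq> W" "C.independent B" "W \<subseteq> cspan J B" "card B = cdim J W"
    using C.basis_exists[of W] by blast
  moreover have "cspan J B \<subseteq> W" using B(1) assms by (simp add: complex_subspace_iff C.span_minimal)
  ultimately show thesis using that cindependent_finite dim_cspan_independent
    by (metis subset_antisym)
qed

lemma dim_eq_cdim: "complex_subspace J W \<Longrightarrow> dim W = 2 * cdim J W"
  by (metis obtain_cbasis)

lemma cindep_dim:
  assumes "cindep k v" "complex_subspace J W" "\<And>i. i < k \<Longrightarrow> v i \<in> W"
  shows "k \<le> cdim J W"
proof -
  have i: "C.independent (v ` {..<k})" using cindep_independent assms by blast
  have d: "dim (cspan J (v ` {..<k})) = 2 * k"
    using dim_cspan_independent[OF i] card_image[OF cindep_inj[OF assms(1)]] by simp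
  have s: "cspan J (v ` {..<k}) \<subseteq> W"
    using assms(2,3) by (intro C.span_minimal) (auto simp: complex_subspace_iff)
  show ?thesis using dim_subset[OF s] d dim_eq_cdim[OF assms(2)] by simp
qed

lemma obtain_cindep:
  assumes "cdim J (cspan J X) = k"
  obtains v where "cindep k v" "\<And>i. i < k \<Longrightarrow> v i \<in> X"
proof -
  obtain B where B: "B \<subseteq> X" "C.independent B" "X \<subseteq> cspan J B"
    using C.maximal_independent_subset[of X] by blast
  then have "cspan J X = cspan J B" by (metis C.span_mono C.span_span subset_antisym C.span_minimal C.subspace_span)
  then have c: "card B = k" using assms cdim_cspan_independent[OF B(2)] by simp
  obtain v where "bij_betw v {0..<card B} B" using ex_bij_betw_nat_finite cindependent_finite[OF B(2)] by blast
  then have v: "bij_betw v {..<k} B" using c by (simp add: atLeast0LessThan)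
  with independent_cindep[OF B(2) v] B(1) show thesis by (intro that[of v]) (auto simp: bij_betw_def)
qed

end

section \<open>Pseudo-Hermitian vector spaces\<close>

text \<open>\<open>Blinfun\<close> returns the given function only if that function is bounded
  linear. Each tensor built with \<open>blin2\<close> therefore pays for bilinearity once and is
  afterwards handled through \<open>app2\<close> alone.\<close>

lemma blin2_apply:
  fixes f :: "'v::euclidean_space \<Rightarrow> 'v \<Rightarrow> 'v"
  assumes "bilinear f"
  shows "app2 (blin2 f) X Y = f X Y"
proof -
  have 1: "blinfun_apply (Blinfun (f X)) = f X" for X
    using assms by (intro bounded_linear_Blinfun_apply linear_conv_bounded_linear[THEN iffD1]) (simp add: bilinear_def)
  have "linear (\<lambda>X. Blinfun (f X))"
    using assms by (intro linearI blinfun_eqI)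
      (auto simp: 1 blinfun.add_left blinfun.scaleR_left bilinear_ladd bilinear_lmul)
  then have "blinfun_apply (Blinfun (\<lambda>X. Blinfun (f X))) = (\<lambda>X. Blinfun (f X))"
    by (intro bounded_linear_Blinfun_apply linear_conv_bounded_linear[THEN iffD1])
  then show ?thesis by (simp add: blin2_def 1)
qed

lemma bil_eqI: "(\<And>X Y. app2 S X Y = app2 T X Y) \<Longrightarrow> S = T"
  by (intro blinfun_eqI)

lemmas bil_simps = blinfun.add_left blinfun.add_right blinfun.scaleR_left blinfun.scaleR_right
  blinfun.diff_left blinfun.diff_right blinfun.minus_left blinfun.minus_right
  blinfun.zero_left blinfun.zero_right

lemma bilinearI:
  assumes "\<And>x y z. f (x + y) z = f x z + f y z" "\<And>r x z. f (r *\<^sub>R x) z = r *\<^sub>R f x z"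
    "\<And>x y z. f x (y + z) = f x y + f x z" "\<And>r x z. f x (r *\<^sub>R z) = r *\<^sub>R f x z"
  shows "bilinear f"
  using assms by (auto simp: bilinear_def intro!: linearI)

interpretation iC: complex_structure "iC :: 'v::euclidean_space \<times> 'v \<Rightarrow> 'v \<times> 'v"
  by unfold_locales (auto simp: iC_def intro!: linearI)

interpretation iC: complex_structure_euclidean "iC :: 'v::euclidean_space \<times> 'v \<Rightarrow> 'v \<times> 'v"
  by unfold_locales

lemma app2_iB [simp]: "app2 (iB T) X Y = iC (app2 T X Y)"
  unfolding iB_def by (rule blin2_apply, rule bilinearI) (simp_all add: bil_simps)

interpretation iB: complex_structure "iB :: ('v::euclidean_space \<times> 'v) bil \<Rightarrow> ('v \<times> 'v) bil"
  by unfold_locales (auto simp: bil_simps intro!: linearI bil_eqI)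

lemma app2_jscale_iB [simp]: "app2 (jscale iB c T) X Y = jscale iC c (app2 T X Y)"
  by (simp add: jscale_def bil_simps)

text \<open>Conjugation fixes real vectors, so adding the conjugate doubles the real part. The
  factor 2 is what the factor 1/2 in \<open>lift\<close> undoes.\<close>

lemma app2_realify [simp]: "app2 (realify T) X Y = 2 *\<^sub>R fst (app2 T (X, 0) (Y, 0))"
proof -
  have lin: "conjC (x + y) = conjC x + conjC y" "conjC (r *\<^sub>R x) = r *\<^sub>R conjC x" for x y :: "'a \<times> 'a" and r
    by (auto simp: conjC_def)
  have conj: "app2 (conjB T) X Y = conjC (app2 T (conjC X) (conjC Y))" for X Y
    unfolding conjB_def by (rule blin2_apply, rule bilinearI) (simp_all add: lin bil_simps)
  have pr: "(x + y, 0::'a) = (x, 0) + (y, 0)" "(r *\<^sub>R x, 0::'a) = r *\<^sub>R (x, 0)" for x y :: 'a and r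
    by auto
  have "app2 (realify T) X Y = fst (app2 (T + conjB T) (X, 0) (Y, 0))"
    unfolding realify_def by (rule blin2_apply, rule bilinearI) (simp_all only: pr bil_simps fst_add fst_scaleR)
  then show ?thesis by (simp add: bil_simps conj) (simp add: conjC_def scaleR_2)
qed

lemma realify_add: "realify (S + T) = realify S + realify T"
  by (auto intro!: bil_eqI simp: bil_simps algebra_simps)

lemma bounded_linear_bilI:
  fixes L :: "'a::real_normed_vector \<Rightarrow> 'v::euclidean_space bil"
  assumes "\<And>X Y. bounded_linear (\<lambda>T. app2 (L T) X Y)"
  shows "bounded_linear L"
proof -
  have 1: "bounded_linear (\<lambda>T. L T X)" for X
  proof -
    have "bounded_linear (\<lambda>T. \<Sum>i\<in>Basis. blinfun_scaleR_left (L T X i) o\<^sub>L blinfun_inner_left i)"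
      by (intro bounded_linear_sum bounded_linear_compose[OF
            bounded_bilinear.bounded_linear_left[OF bounded_bilinear_blinfun_compose]]
          bounded_linear_compose[OF bounded_linear_blinfun_scaleR_left] assms)
    then show ?thesis by (simp flip: blinfun_basis_expansion)
  qed
  have "bounded_linear (\<lambda>T. \<Sum>i\<in>Basis. blinfun_scaleR_left (L T i) o\<^sub>L blinfun_inner_left i)"
    by (intro bounded_linear_sum bounded_linear_compose[OF
          bounded_bilinear.bounded_linear_left[OF bounded_bilinear_blinfun_compose]]
        bounded_linear_compose[OF bounded_linear_blinfun_scaleR_left] 1)
  then show ?thesis by (simp flip: blinfun_basis_expansion)
qed

lemma bounded_linear_app2: "bounded_linear (\<lambda>S. app2 S X Y)"
  by (intro bounded_linear_compose[OF blinfun.bounded_linear_left] blinfun.bounded_linear_left)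

lemma bounded_linear_realify: "bounded_linear realify"
  by (intro bounded_linear_bilI) (auto intro!: bounded_linear_intros bounded_linear_compose[OF bounded_linear_fst] bounded_linear_app2 bounded_linear_compose[OF bounded_linear_scaleR_right])

lemma supp_subset_iff: "subspace W \<Longrightarrow> supp S \<subseteq> W \<longleftrightarrow> (\<forall>X Y. app2 S X Y \<in> W)"
  unfolding supp_def using span_minimal[of "{app2 S X Y |X Y. True}" W] span_superset[of "{app2 S X Y |X Y. True}"] by blast

lemma app2_in_supp: "app2 S X Y \<in> supp S"
  unfolding supp_def by (rule span_base) blast

lemma subspace_supp: "subspace (supp S)"
  by (simp add: supp_def)

locale pseudo_hermitian_space =
  fixes J :: "'v::euclidean_space \<Rightarrow> 'v" and g :: "'v \<Rightarrow> 'v \<Rightarrow> real"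
  assumes ph: "pseudo_hermitian J g"
begin

sublocale complex_structure_euclidean J
  using ph by unfold_locales (auto simp: pseudo_hermitian_def linear_add linear_scale)

lemma bilinear_g: "bilinear g" and g_sym: "g x y = g y x" and g_J [simp]: "g (J x) (J y) = g x y"
  and g_nondeg: "(\<And>y. g x y = 0) \<Longrightarrow> x = 0"
  using ph by (auto simp: pseudo_hermitian_def)

lemma g_simps [simp]:
  "g 0 y = 0" "g y 0 = 0" "g (x + z) y = g x y + g z y" "g y (x + z) = g y x + g y z"
  "g (x - z) y = g x y - g z y" "g y (x - z) = g y x - g y z" "g (- x) y = - g x y" "g y (- x) = - g y x"
  "g (r *\<^sub>R x) y = r * g x y" "g y (r *\<^sub>R x) = r * g y x"
  using bilinear_g by (auto simp: bilinear_lzero bilinear_rzero bilinear_ladd bilinear_radd bilinear_lsub bilinear_rsub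
      bilinear_lneg bilinear_rneg bilinear_lmul bilinear_rmul)

lemma g_sum: "g (\<Sum>i\<in>I. f i) y = (\<Sum>i\<in>I. g (f i) y)" "g y (\<Sum>i\<in>I. f i) = (\<Sum>i\<in>I. g y (f i))"
  by (induction I rule: infinite_finite_induct) auto

lemma g_J_right: "g x (J y) = - g (J x) y"
  using g_J[of x "J y"] by simp

lemma g_J_self [simp]: "g (J x) x = 0" "g x (J x) = 0"
  using g_J_right[of x x] g_sym[of x "J x"] by auto

lemma g_eqI: "(\<And>z. g z x = g z y) \<Longrightarrow> x = y"
  using g_nondeg[of "x - y"] by (simp add: g_sym[of x] g_sym[of y])

text \<open>The Riesz representation for \<open>g\<close>: the Gram operator is injective because
  \<open>g\<close> is nondegenerate, hence surjective in finite dimension.\<close>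

lemma g_representation: "\<exists>z. \<forall>y. g z y = v \<bullet> y"
proof -
  define \<Gamma> where "\<Gamma> z = (\<Sum>b\<in>Basis. g z b *\<^sub>R b)" for z
  have \<Gamma>: "\<Gamma> z \<bullet> y = g z y" for z y
  proof -
    have "\<Gamma> z \<bullet> y = g z (\<Sum>b\<in>Basis. (b \<bullet> y) *\<^sub>R b)" by (simp add: \<Gamma>_def inner_sum_left g_sum mult.commute)
    then show ?thesis by (simp add: inner_commute[of _ y] euclidean_representation)
  qed
  have lin: "linear \<Gamma>" by (intro linearI) (auto simp: \<Gamma>_def sum.distrib scaleR_left_distrib scaleR_sum_right)
  have "inj \<Gamma>" unfolding linear_injective_0[OF lin]
  proof (intro allI impI g_nondeg)
    fix z y assume "\<Gamma> z = 0"
    then show "g z y = 0" using \<Gamma>[of z y] by simp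
  qed
  then have "surj \<Gamma>" using linear_inj_imp_surj[OF lin] by blast
  then show ?thesis using \<Gamma> by (metis surjD)
qed

text \<open>\<open>theta x\<close> is the conjugate-linear form \<open>\<omega>(x, \<cdot>) - \<i> \<omega>(J x, \<cdot>)\<close>, i.e. \<open>\<omega>(u, \<cdot>)\<close> for the
  \<open>(1,0)\<close>-vector \<open>u = x - \<i> J x\<close>, restricted to \<open>V\<close>.\<close>

definition theta :: "'v \<Rightarrow> 'v \<Rightarrow> complex" where
  "theta x Z = Complex (g (J x) Z) (g x Z)"

lemma theta_simps [simp]:
  "theta 0 Z = 0" "theta x 0 = 0"
  "theta (x + y) Z = theta x Z + theta y Z" "theta (x - y) Z = theta x Z - theta y Z"
  "theta x (Y + Z) = theta x Y + theta x Z" "theta x (Y - Z) = theta x Y - theta x Z"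
  "theta (- x) Z = - theta x Z" "theta x (- Z) = - theta x Z"
  "theta (r *\<^sub>R x) Z = r *\<^sub>R theta x Z" "theta x (r *\<^sub>R Z) = r *\<^sub>R theta x Z"
  "theta (J x) Z = \<i> * theta x Z" "theta x (J Z) = - \<i> * theta x Z"
  by (auto simp: theta_def complex_eq_iff g_J_right)

lemma theta_jscale [simp]:
  "theta (jscale J c x) Z = c * theta x Z" "theta x (jscale J c Z) = cnj c * theta x Z"
  by (auto simp: jscale_def complex_eq_iff)

lemma theta_sum: "theta (\<Sum>i\<in>I. f i) Z = (\<Sum>i\<in>I. theta (f i) Z)"
  by (induction I rule: infinite_finite_induct) auto

lemma theta_swap: "theta x y = - cnj (theta y x)"
  by (auto simp: theta_def complex_eq_iff g_sym[of y x] g_sym[of "J y" x] g_J_right)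

lemma theta_eqI: "(\<And>Z. theta x Z = theta y Z) \<Longrightarrow> x = y"
  by (rule g_eqI) (simp add: theta_def g_sym)

text \<open>Take the component \<open>v\<close> of \<open>x\<close> that is Euclidean-orthogonal to
  \<open>D\<close> and represent it through \<open>g\<close> by a vector \<open>z\<close>. Since
  \<open>D\<close> is stable under \<open>J\<close>, both parts of \<open>theta d z\<close> vanish
  on \<open>D\<close>, while \<open>g x z\<close> is the square of the norm of
  \<open>v\<close>.\<close>

lemma theta_separation:
  assumes "complex_subspace J D" "x \<notin> D"
  obtains z where "\<And>d. d \<in> D \<Longrightarrow> theta d z = 0" "theta x z = 1"
proof -
  have D: "subspace D" using assms(1) by (simp add: complex_subspace_def)
  obtain y v where yv: "y \<in> span D" "\<And>w. w \<in> span D \<Longrightarrow> orthogonal v w" "x = y + v"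
    using orthogonal_subspace_decomp_exists[of D x] by blast
  have "v \<noteq> 0" using yv assms(2) D by (auto simp: span_eq_iff[THEN iffD2])
  obtain z where z: "\<And>y. g z y = v \<bullet> y" using g_representation by blast
  have 1: "theta d z = 0" if "d \<in> D" for d
  proof -
    have "d \<in> span D" "J d \<in> span D" using that assms(1) by (auto simp: complex_subspace_def span_base)
    then show ?thesis using yv(2) by (auto simp: theta_def complex_eq_iff g_sym[of _ z] z orthogonal_def)
  qed
  have "v \<bullet> y = 0" using yv(1,2) by (auto simp: orthogonal_def)
  then have "g x z \<noteq> 0" using yv(3) \<open>v \<noteq> 0\<close> by (simp add: g_sym[of _ z] z inner_add_right)
  then have 2: "theta x z \<noteq> 0" by (auto simp: theta_def complex_eq_iff)
  \<comment> \<open>The normalizing scalar is conjugated because \<open>theta\<close> is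
    conjugate-linear in its second argument.\<close>
  show thesis
    by (rule that[of "jscale J (cnj (inverse (theta x z))) z"]) (use 1 2 in auto)
qed

section \<open>Adjoints with respect to g\<close>

definition dual :: "'v \<Rightarrow> 'v" where
  "dual v = (SOME z. \<forall>y. g z y = v \<bullet> y)"

lemma g_dual: "g (dual v) y = v \<bullet> y"
  using someI_ex[OF g_representation[of v]] by (simp add: dual_def)

text \<open>An explicit basis sum, linear in \<open>A\<close>, instead of a choice of adjoint:
  smooth dependence of the adjoint on the operator can be read off from it.\<close>

definition adj :: "('v \<Rightarrow> 'v) \<Rightarrow> 'v \<Rightarrow> 'v" where
  "adj A y = (\<Sum>b\<in>Basis. g (A b) y *\<^sub>R dual b)"

lemma g_adj: assumes "linear A" shows "g (A x) y = g x (adj A y)"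
proof -
  have "g x (adj A y) = (\<Sum>b\<in>Basis. (x \<bullet> b) * g (A b) y)"
    by (simp add: adj_def g_sum g_sym[of x] g_dual inner_commute mult.commute)
  also have "\<dots> = g (\<Sum>b\<in>Basis. (x \<bullet> b) *\<^sub>R A b) y" by (simp add: g_sum)
  also have "(\<Sum>b\<in>Basis. (x \<bullet> b) *\<^sub>R A b) = A (\<Sum>b\<in>Basis. (x \<bullet> b) *\<^sub>R b)"
    by (simp add: linear_sum[OF assms] linear_scale[OF assms])
  finally show ?thesis by (simp add: euclidean_representation)
qed

lemma linear_adj: "linear (adj A)"
  by (intro linearI) (auto simp: adj_def scaleR_left_distrib sum.distrib scaleR_sum_right)

lemmas adj_lin [simp] = linear_0[OF linear_adj] linear_add[OF linear_adj] linear_diff[OF linear_adj]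
  linear_neg[OF linear_adj] linear_scale[OF linear_adj]

lemma adj_eqI: "linear A \<Longrightarrow> (\<And>x y. g (A x) y = g x (B y)) \<Longrightarrow> adj A = B"
  by (intro ext g_eqI) (simp flip: g_adj)

lemma g_adj': "linear A \<Longrightarrow> g (adj A x) y = g x (A y)"
  using g_adj[of A y x] by (simp add: g_sym)

lemma adj_adj: "linear A \<Longrightarrow> adj (adj A) = A"
  by (rule adj_eqI[OF linear_adj]) (simp add: g_adj')

definition clin :: "('v \<Rightarrow> 'v) \<Rightarrow> bool" where
  "clin A \<longleftrightarrow> linear A \<and> (\<forall>x. A (J x) = J (A x))"

lemma clinD: "clin A \<Longrightarrow> linear A" "clin A \<Longrightarrow> A (J x) = J (A x)"
  by (auto simp: clin_def)

lemma clin_simps: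
  assumes "clin A"
  shows "A 0 = 0" "A (x + y) = A x + A y" "A (x - y) = A x - A y" "A (- x) = - A x" "A (r *\<^sub>R x) = r *\<^sub>R A x"
    "A (J x) = J (A x)" "A (jscale J c x) = jscale J c (A x)"
  using assms by (auto simp: clin_def linear_0 linear_add linear_diff linear_neg linear_scale jscale_def)

lemma clin_adj: assumes "clin A" shows "clin (adj A)"
  unfolding clin_def
proof (intro conjI linear_adj allI g_eqI)
  fix x z
  note [simp] = g_adj[OF clinD(1)[OF assms], symmetric]
  show "g z (adj A (J x)) = g z (J (adj A x))"
    by (simp add: g_J_right) (simp flip: clinD(2)[OF assms])
qed

lemma clinI:
  "(\<And>x y. A (x + y) = A x + A y) \<Longrightarrow> (\<And>r x. A (r *\<^sub>R x) = r *\<^sub>R A x) \<Longrightarrow> (\<And>x. A (J x) = J (A x)) \<Longrightarrow> clin A"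
  unfolding clin_def by (intro conjI linearI) auto

lemma theta_adj: "clin A \<Longrightarrow> theta (A x) y = theta x (adj A y)"
  by (simp add: theta_def clin_simps(6)[symmetric] g_adj clinD(1))

lemma clin_compose: "clin A \<Longrightarrow> clin B \<Longrightarrow> clin (\<lambda>x. A (B x))"
  by (rule clinI) (simp_all add: clin_simps)

lemma adj_compose: "clin A \<Longrightarrow> clin B \<Longrightarrow> adj (\<lambda>x. A (B x)) = (\<lambda>x. adj B (adj A x))"
  by (rule adj_eqI) (auto simp: g_adj[OF clinD(1), symmetric] intro: clinD(1) clin_compose)

end

section \<open>Real tensors and their \<open>(3,0)\<close>-components\<close>

context pseudo_hermitian_space
begin

text \<open>The real model of the whole space of (3,0)-tensors. Besides the symmetry of
  \<open>omega\<close> on values, the condition on \<open>theta\<close> contains that of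
  \<open>g\<close>; by anticommutation with \<open>J\<close> the first implies the second, as
  \<open>tensors_eq\<close> shows.\<close>

definition tensors :: "'v bil set" where
  "tensors = {S. (\<forall>X Y. app2 S X Y = app2 S Y X) \<and> (\<forall>X Y. app2 S X (J Y) = - J (app2 S X Y)) \<and>
     (\<forall>X Y Z. theta (app2 S X Y) Z = theta (app2 S X Z) Y)}"

lemma tensorsD:
  assumes "S \<in> tensors"
  shows "app2 S X Y = app2 S Y X" "app2 S X (J Y) = - J (app2 S X Y)" "app2 S (J X) Y = - J (app2 S X Y)"
    "theta (app2 S X Y) Z = theta (app2 S X Z) Y" "theta (app2 S X Y) Z = theta (app2 S Z Y) X"
  using assms unfolding tensors_def by auto

lemma tensors_eq: "tensors = {S \<in> sp_prolongation (omega J g). \<forall>X Y. app2 S X (J Y) + J (app2 S X Y) = 0}"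
proof (intro equalityI subsetI CollectI conjI)
  fix S assume S: "S \<in> tensors"
  note tensorsD[OF S]
  then show "\<forall>X Y. app2 S X (J Y) + J (app2 S X Y) = 0" by (metis add.left_inverse)
  have "omega J g (app2 S X Y) Z = omega J g (app2 S X Z) Y" for X Y Z
    using tensorsD(4)[OF S, of X Y Z] by (simp add: theta_def omega_def)
  moreover have "omega J g x y = - omega J g y x" for x y
    by (simp add: omega_def g_sym[of "J x"] g_J_right)
  ultimately have "omega J g (app2 S X Y) Z + omega J g Y (app2 S X Z) = 0" for X Y Z
    by (metis add.right_inverse)
  then show "S \<in> sp_prolongation (omega J g)"
    unfolding sp_prolongation_def sp_def using tensorsD(1)[OF S] linear_blinfun by auto
next
  fix S assume S: "S \<in> {S \<in> sp_prolongation (omega J g). \<forall>X Y. app2 S X (J Y) + J (app2 S X Y) = 0}"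
  then have 1: "app2 S X (J Y) = - J (app2 S X Y)" for X Y by (simp add: add_eq_0_iff2)
  have 2: "g (J (app2 S X Y)) Z = g (J (app2 S X Z)) Y" for X Y Z
  proof -
    have "omega J g (app2 S X Y) Z + omega J g Y (app2 S X Z) = 0"
      using S unfolding sp_prolongation_def sp_def by auto
    then show ?thesis by (simp add: omega_def g_J_right g_sym[of "J Y"])
  qed
  have "g (app2 S X Y) Z = g (app2 S X Z) Y" for X Y Z
    using 2[of X "J Y" Z] by (simp add: 1 g_J_right)
  with 1 2 S show "S \<in> tensors"
    by (auto simp: tensors_def theta_def sp_prolongation_def)
qed

lemma tensors_closed:
  shows "0 \<in> tensors" "S \<in> tensors \<Longrightarrow> T \<in> tensors \<Longrightarrow> S + T \<in> tensors" "S \<in> tensors \<Longrightarrow> r *\<^sub>R S \<in> tensors"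
  by (auto simp: tensors_def bil_simps)

definition Jbil :: "'v bil \<Rightarrow> 'v bil" where
  "Jbil S = blin2 (\<lambda>X Y. J (app2 S X Y))"

lemma app2_Jbil [simp]: "app2 (Jbil S) X Y = J (app2 S X Y)"
  unfolding Jbil_def by (rule blin2_apply, rule bilinearI) (simp_all add: bil_simps)

lemma Jbil_tensors: "S \<in> tensors \<Longrightarrow> Jbil S \<in> tensors"
  by (auto simp: tensors_def)

lemma J_supp: assumes "S \<in> tensors" "u \<in> supp S" shows "J u \<in> supp S"
  using assms(2) unfolding supp_def
proof (induction rule: span_induct_alt)
  case (step c x y)
  then obtain X Y where "x = app2 S X Y" by auto
  then have "J x = - app2 S X (J Y)" using tensorsD(2)[OF assms(1)] by simp
  then have "J x \<in> span {app2 S X Y |X Y. True}" by (metis (mono_tags, lifting) mem_Collect_eq span_base span_neg)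
  then show ?case using step by (auto intro: span_add span_scale)
qed (auto intro: span_zero)

lemma complex_subspace_supp: "S \<in> tensors \<Longrightarrow> complex_subspace J (supp S)"
  using J_supp by (auto simp: complex_subspace_def subspace_supp)

text \<open>By total symmetry \<open>theta (S_z Y) Z = theta (S_Y Z) z\<close>: the argument
  \<open>z\<close> moves to the outer slot, where it is paired with a vector of the support.\<close>

lemma tensor_kernel:
  assumes "S \<in> tensors" "\<And>u. u \<in> supp S \<Longrightarrow> theta u z = 0"
  shows "app2 S z Y = 0" "app2 S Y z = 0"
proof -
  show "app2 S z Y = 0"
    by (rule theta_eqI) (metis assms(2) app2_in_supp tensorsD(1,4)[OF assms(1)] theta_simps(1))
  then show "app2 S Y z = 0" using tensorsD(1)[OF assms(1)] by metis
qed

text \<open>On a complex subspace \<open>x\<close> may be replaced by \<open>J x\<close>, so the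
  vanishing of \<open>omega\<close> forces that of \<open>g\<close>.\<close>

lemma omega_isotropic_iff:
  assumes "complex_subspace J W"
  shows "isotropic (omega J g) W \<longleftrightarrow> (\<forall>x\<in>W. \<forall>y\<in>W. theta x y = 0)"
proof
  assume i: "isotropic (omega J g) W"
  have "theta x y = 0" if "x \<in> W" "y \<in> W" for x y
  proof -
    have "J x \<in> W" using assms that by (simp add: complex_subspace_def)
    with i that have "omega J g x y = 0" "omega J g (J x) y = 0" by (auto simp: isotropic_def)
    then show ?thesis by (simp add: theta_def omega_def complex_eq_iff)
  qed
  then show "\<forall>x\<in>W. \<forall>y\<in>W. theta x y = 0" by blast
qed (auto simp: isotropic_def omega_def theta_def complex_eq_iff)

lemma CJ_eq: "CJ J g = {S \<in> tensors. isotropic (omega J g) (supp S)}"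
proof (intro equalityI subsetI CollectI conjI)
  fix S assume S: "S \<in> CJ J g"
  then show t: "S \<in> tensors" by (auto simp: tensors_eq CJ_def)
  have com: "app2 S X (app2 S Y Z) = app2 S Y (app2 S X Z)" for X Y Z
    using S by (simp add: CJ_def)
  have zero: "app2 S X (app2 S Y Z) = 0" for X Y Z
  proof -
    \<comment> \<open>Putting \<open>J X\<close> for \<open>X\<close> in the commutation relation
      produces \<open>- J\<close> on the left, but \<open>J\<close> on the right, where it has to
      pass the second operator as well. Thus each product equals its own negative.\<close>
    have "app2 S (J X) (app2 S Y Z) = app2 S Y (app2 S (J X) Z)" by (rule com)
    then have "- J (app2 S X (app2 S Y Z)) = J (app2 S Y (app2 S X Z))"
      by (simp add: tensorsD(2,3)[OF t] bil_simps)
    then have "J (app2 S X (app2 S Y Z)) + J (app2 S X (app2 S Y Z)) = 0"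
      unfolding com[of Y X] by (metis add.left_inverse)
    then have "J (app2 S X (app2 S Y Z)) = 0" by (simp flip: scaleR_2)
    then have "J (J (app2 S X (app2 S Y Z))) = 0" by simp
    then show ?thesis by simp
  qed
  \<comment> \<open>Symmetry turns the pairing of two values into a pairing with a double product,
    which is zero.\<close>
  have gen: "theta (app2 S X Y) (app2 S Z U) = 0" for X Y Z U
    using tensorsD(4)[OF t, of X Y "app2 S Z U"] by (simp add: zero)
  have sub: "subspace {y. \<forall>X Y. theta (app2 S X Y) y = 0}" "subspace {x. \<forall>y\<in>supp S. theta x y = 0}"
    by (auto simp: subspace_def)
  have "supp S \<subseteq> {y. \<forall>X Y. theta (app2 S X Y) y = 0}"
    unfolding supp_subset_iff[OF sub(1)] using gen by simp
  then have "supp S \<subseteq> {x. \<forall>y\<in>supp S. theta x y = 0}"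
    unfolding supp_subset_iff[OF sub(2)] by auto
  then show "isotropic (omega J g) (supp S)"
    unfolding omega_isotropic_iff[OF complex_subspace_supp[OF t]] by blast
next
  fix S assume S: "S \<in> {S \<in> tensors. isotropic (omega J g) (supp S)}"
  then have t: "S \<in> tensors" by simp
  have "theta u y = 0" if "u \<in> supp S" "y \<in> supp S" for u y
    using S that omega_isotropic_iff[OF complex_subspace_supp[OF t]] by blast
  \<comment> \<open>A value lies in the support, hence pairs to zero with it and is annihilated;
    with all products zero the operators commute.\<close>
  then have "app2 S X (app2 S Y Z) = 0" for X Y Z
    by (intro tensor_kernel(2)[OF t]) (simp add: app2_in_supp)
  with S show "S \<in> CJ J g" by (auto simp: tensors_eq CJ_def)
qed

section \<open>Passage to the (1,0)-part of the complexification\<close>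

definition iota :: "'v \<Rightarrow> 'v \<times> 'v" where
  "iota x = (x, - J x)"

text \<open>It vanishes on the vectors \<open>iota x\<close> and carries \<open>iC\<close> to
  \<open>- J\<close>, so it sees only the (0,1)-part. As \<open>omega\<close> pairs (1,0)-vectors
  with (0,1)-vectors alone, this is all that a (3,0)-tensor sees of its arguments.\<close>

definition rho :: "'v \<times> 'v \<Rightarrow> 'v" where
  "rho Z = fst Z - J (snd Z)"

lemma iota_simps [simp]:
  "iota 0 = 0" "iota (x + y) = iota x + iota y" "iota (x - y) = iota x - iota y" "iota (r *\<^sub>R x) = r *\<^sub>R iota x"
  "iC (iota x) = iota (J x)" "fst (iota x) = x" "iota x = iota y \<longleftrightarrow> x = y"
  by (auto simp: iota_def iC_def zero_prod_def)

lemma jscale_iota [simp]: "jscale iC c (iota x) = iota (jscale J c x)"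
  by (simp add: jscale_def)

lemma rho_simps [simp]:
  "rho 0 = 0" "rho (x + y) = rho x + rho y" "rho (x - y) = rho x - rho y" "rho (r *\<^sub>R x) = r *\<^sub>R rho x"
  "rho (X, 0) = X"
  by (auto simp: rho_def algebra_simps)

lemma W10_eq: assumes "complex_subspace J W" shows "W10 J W = iota ` W"
proof
  show "W10 J W \<subseteq> iota ` W"
    by (auto simp: W10_def iC_def iota_def)
  show "iota ` W \<subseteq> W10 J W"
    using assms by (auto simp: W10_def iC_def iota_def complex_subspace_def subspace_neg)
qed

lemma bformC_iota: "bformC (omega J g) (iota a) Z = theta a (rho Z)"
  by (simp add: bformC_def iota_def rho_def theta_def omega_def complex_eq_iff g_J_right)

text \<open>\<open>lift S\<close> is the element of \<open>S\<^sup>3\<^sup>,\<^sup>0V\<close> with \<open>realify (lift S) = S\<close>: the component \<open>S\<^sub>c\<close> in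
  \<open>S = S\<^sub>c + conj S\<^sub>c\<close>.  Up to scalars, \<open>iota\<close> and \<open>rho\<close> are the projections to the \<open>(1,0)\<close>- and
  \<open>(0,1)\<close>-parts.\<close>

definition lift :: "'v bil \<Rightarrow> ('v \<times> 'v) bil" where
  "lift S = blin2 (\<lambda>Z1 Z2. (1/2) *\<^sub>R iota (app2 S (rho Z1) (rho Z2)))"

lemma app2_lift [simp]: "app2 (lift S) Z1 Z2 = (1/2) *\<^sub>R iota (app2 S (rho Z1) (rho Z2))"
  unfolding lift_def by (rule blin2_apply, rule bilinearI) (simp_all add: bil_simps algebra_simps)

lemma realify_lift [simp]: "realify (lift S) = S"
  by (rule bil_eqI) simp

lemma lift_eq_iff: "lift S = lift T \<longleftrightarrow> S = T"
  by (metis realify_lift)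

lemma lift_add: "lift (S + T) = lift S + lift T"
  and lift_scaleR: "lift (r *\<^sub>R S) = r *\<^sub>R lift S"
  and lift_Jbil: "lift (Jbil S) = iB (lift S)"
  by (rule bil_eqI; simp add: bil_simps algebra_simps)+

lemma lift_jscale: "lift (jscale Jbil c S) = jscale iB c (lift S)"
  by (simp add: jscale_def lift_add lift_scaleR lift_Jbil)

lemma bounded_linear_iota: "bounded_linear iota"
  by (intro linear_conv_bounded_linear[THEN iffD1] linearI) auto

lemma bounded_linear_lift: "bounded_linear lift"
  by (intro bounded_linear_bilI) (auto intro!: bounded_linear_compose[OF bounded_linear_scaleR_right]
      bounded_linear_compose[OF bounded_linear_iota] bounded_linear_app2)

text \<open>The decomposable tensor built from \<open>a\<close>, \<open>b\<close> and
  \<open>c\<close>: paired with \<open>Z\<close> it becomes a product of three scalars, so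
  identities between tensors reduce to commutative algebra.\<close>

definition trip :: "'v \<Rightarrow> 'v \<Rightarrow> 'v \<Rightarrow> 'v \<Rightarrow> 'v \<Rightarrow> 'v" where
  "trip a b c X Y = jscale J (theta a X * theta b Y) c"

lemma trip_bilinear: "bilinear (trip a b c)"
  by (rule bilinearI)
    (simp_all add: trip_def jscale_def algebra_simps)

definition sprod :: "'v \<Rightarrow> 'v \<Rightarrow> 'v \<Rightarrow> 'v bil" where
  "sprod a b c = blin2 (\<lambda>X Y. trip a b c X Y + trip a c b X Y + trip b a c X Y
     + trip b c a X Y + trip c a b X Y + trip c b a X Y)"

lemmas bilinear_arg_simps = bilinear_ladd bilinear_radd bilinear_lmul bilinear_rmul

lemma app2_sprod: "app2 (sprod a b c) X Y = trip a b c X Y + trip a c b X Y + trip b a c X Y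
     + trip b c a X Y + trip c a b X Y + trip c b a X Y"
  unfolding sprod_def
  by (rule blin2_apply, rule bilinearI) (simp_all add: bilinear_arg_simps[OF trip_bilinear] algebra_simps)

lemma theta_trip: "theta (trip a b c X Y) Z = theta a X * theta b Y * theta c Z"
  by (simp add: trip_def)

lemma sprod_tensors: "sprod a b c \<in> tensors"
  unfolding tensors_def
proof (intro CollectI conjI allI theta_eqI)
  fix X Y Z
  show "theta (app2 (sprod a b c) X Y) Z = theta (app2 (sprod a b c) Y X) Z"
    "theta (app2 (sprod a b c) X Y) Z = theta (app2 (sprod a b c) X Z) Y"
    "theta (app2 (sprod a b c) X (J Y)) Z = theta (- J (app2 (sprod a b c) X Y)) Z"
    by (simp_all add: app2_sprod theta_trip algebra_simps)
qed

text \<open>On vectors of the form \<open>iota a\<close> the pairing \<open>bformC\<close> becomes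
  \<open>theta\<close> precomposed with \<open>rho\<close>; the factor 2 cancels the 1/2 contained
  in \<open>lift\<close>.\<close>

lemma sym3_iota: "sym3 (omega J g) (iota a) (iota b) (iota c) = lift (2 *\<^sub>R sprod a b c)"
proof (rule bil_eqI)
  fix X Y
  have t: "jscale iC (bformC (omega J g) (iota a) X * bformC (omega J g) (iota b) Y) (iota c)
      = iota (trip a b c (rho X) (rho Y))" for a b c X Y
    by (simp add: bformC_iota trip_def)
  have bl: "bilinear (\<lambda>X Y. iota (trip a b c (rho X) (rho Y)))" for a b c
    by (rule bilinearI) (simp_all add: bilinear_arg_simps[OF trip_bilinear])
  have "app2 (sym3 (omega J g) (iota a) (iota b) (iota c)) X Y =
    iota (trip a b c (rho X) (rho Y)) + iota (trip a c b (rho X) (rho Y)) + iota (trip b a c (rho X) (rho Y))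
    + iota (trip b c a (rho X) (rho Y)) + iota (trip c a b (rho X) (rho Y)) + iota (trip c b a (rho X) (rho Y))"
    unfolding sym3_def Let_def t
    by (rule blin2_apply, rule bilinearI) (simp_all add: bilinear_arg_simps[OF trip_bilinear] algebra_simps)
  then show "app2 (sym3 (omega J g) (iota a) (iota b) (iota c)) X Y = app2 (lift (2 *\<^sub>R sprod a b c)) X Y"
    by (simp add: bil_simps app2_sprod)
qed

section \<open>Expansion in symmetric products\<close>

lemma dual_basis:
  assumes "C.independent B" "b \<in> B"
  obtains z where "theta b z = 1" "\<And>a. a \<in> B \<Longrightarrow> a \<noteq> b \<Longrightarrow> theta a z = 0"
proof -
  have "b \<notin> cspan J (B - {b})" using assms unfolding C.dependent_def by blast
  from theta_separation[OF complex_subspace_cspan this] obtain z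
    where "\<And>d. d \<in> cspan J (B - {b}) \<Longrightarrow> theta d z = 0" "theta b z = 1" by blast
  then show thesis by (intro that[of z]) (auto intro: C.span_base)
qed

definition tensors_in :: "'v set \<Rightarrow> 'v bil set" where
  "tensors_in W = {S \<in> tensors. \<forall>X Y. app2 S X Y \<in> W}"

lemma tensors_in_supp: "complex_subspace J W \<Longrightarrow> S \<in> tensors_in W \<longleftrightarrow> S \<in> tensors \<and> supp S \<subseteq> W"
  by (auto simp: tensors_in_def complex_subspace_def supp_subset_iff)

text \<open>Only the values of \<open>S\<close> are known to lie in \<open>W\<close>. Total symmetry
  moves each argument in turn into the value slot, so the basis expansion in \<open>W\<close>
  applies three times; the coefficients are the values of the trilinear form on the dual vectors
  \<open>z\<close>.\<close>

lemma tensor_expansion: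
  assumes W: "complex_subspace J W" and S: "S \<in> tensors_in W"
  obtains B \<tau> where "B \<subseteq> W" "finite B" "\<And>a b c. \<tau> a b c = \<tau> b a c" "\<And>a b c. \<tau> a b c = \<tau> a c b"
    "\<And>X Y. app2 S X Y = (\<Sum>a\<in>B. \<Sum>b\<in>B. \<Sum>c\<in>B. jscale J (\<tau> a b c) (trip a b c X Y))"
proof -
  have t: "S \<in> tensors" using S by (simp add: tensors_in_def)
  obtain B where B: "B \<subseteq> W" "C.independent B" "finite B" "cspan J B = W" using obtain_cbasis[OF W] by metis
  have "\<forall>b\<in>B. \<exists>z. theta b z = 1 \<and> (\<forall>a\<in>B. a \<noteq> b \<longrightarrow> theta a z = 0)"
    using dual_basis[OF B(2)] by metis
  then obtain z where z: "\<And>a b. a \<in> B \<Longrightarrow> b \<in> B \<Longrightarrow> theta a (z b) = (if a = b then 1 else 0)" by metis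
  have exp: "u = (\<Sum>b\<in>B. jscale J (theta u (z b)) b)" if u: "u \<in> W" for u
  proof -
    obtain c where c: "u = (\<Sum>b\<in>B. jscale J (c b) b)" using u B(3,4) C.span_finite by auto
    have "theta u (z b) = c b" if "b \<in> B" for b
    proof -
      have "theta u (z b) = (\<Sum>a\<in>B. if a = b then c b else 0)"
        using that by (auto simp: c theta_sum z intro!: sum.cong)
      then show ?thesis using that B(3) by simp
    qed
    then show ?thesis by (subst c) (auto intro: sum.cong)
  qed
  have SW: "app2 S X Y \<in> W" for X Y using S by (simp add: tensors_in_def)
  \<comment> \<open>Expanding the value also moves \<open>Y\<close> to the outer slot, which
    prepares the next application.\<close>
  have th: "theta (app2 S X Y) Z = (\<Sum>b\<in>B. theta (app2 S X (z b)) Y * theta b Z)" for X Y Z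
  proof -
    have "theta (app2 S X Y) Z = theta (\<Sum>b\<in>B. jscale J (theta (app2 S X Y) (z b)) b) Z"
      using exp[OF SW] by metis
    also have "\<dots> = (\<Sum>b\<in>B. theta (app2 S X (z b)) Y * theta b Z)"
      by (simp add: theta_sum tensorsD(4)[OF t, of X Y])
    finally show ?thesis .
  qed
  define \<tau> where "\<tau> a b c = theta (app2 S (z a) (z b)) (z c)" for a b c
  have "app2 S X Y = (\<Sum>a\<in>B. \<Sum>b\<in>B. \<Sum>c\<in>B. jscale J (\<tau> a b c) (trip a b c X Y))" for X Y
  proof (rule theta_eqI)
    fix Z
    have "theta (app2 S X Y) Z = (\<Sum>c\<in>B. theta (app2 S X (z c)) Y * theta c Z)" by (rule th)
    also have "\<dots> = (\<Sum>c\<in>B. (\<Sum>b\<in>B. theta (app2 S X (z b)) (z c) * theta b Y) * theta c Z)"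
      by (subst th) rule
    also have "\<dots> = (\<Sum>c\<in>B. (\<Sum>b\<in>B. (\<Sum>a\<in>B. \<tau> a b c * theta a X) * theta b Y) * theta c Z)"
    proof -
      have "theta (app2 S X (z b)) (z c) = (\<Sum>a\<in>B. \<tau> a b c * theta a X)" for b c
      proof -
        have "theta (app2 S X (z b)) (z c) = theta (app2 S (z b) (z c)) X"
          using tensorsD(1,4)[OF t] by metis
        also have "\<dots> = (\<Sum>a\<in>B. theta (app2 S (z b) (z a)) (z c) * theta a X)" by (rule th)
        finally show ?thesis by (simp add: \<tau>_def tensorsD(1)[OF t, of "z b"])
      qed
      then show ?thesis by simp
    qed
    also have "\<dots> = (\<Sum>c\<in>B. \<Sum>b\<in>B. \<Sum>a\<in>B. \<tau> a b c * (theta a X * theta b Y * theta c Z))"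
      by (simp add: sum_distrib_right mult.assoc)
    also have "\<dots> = (\<Sum>a\<in>B. \<Sum>b\<in>B. \<Sum>c\<in>B. \<tau> a b c * (theta a X * theta b Y * theta c Z))"
      by (subst sum.swap, subst (2) sum.swap, subst sum.swap) rule
    finally show "theta (app2 S X Y) Z = theta (\<Sum>a\<in>B. \<Sum>b\<in>B. \<Sum>c\<in>B. jscale J (\<tau> a b c) (trip a b c X Y)) Z"
      by (simp add: theta_sum theta_trip)
  qed
  moreover have "\<tau> a b c = \<tau> b a c" "\<tau> a b c = \<tau> a c b" for a b c
    using tensorsD(1,4)[OF t] by (auto simp: \<tau>_def)
  ultimately show thesis using that B by blast
qed

text \<open>The coefficients are symmetric, so averaging over permutations replaces decomposable
  tensors by symmetric products. The 12 consists of the 6 orderings and the factor 2 of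
  \<open>sym3_iota\<close>.\<close>

lemma sprod_expansion:
  assumes W: "complex_subspace J W" and S: "S \<in> tensors_in W"
  obtains B \<tau> where "B \<subseteq> W" "finite B"
    "lift S = (\<Sum>a\<in>B. \<Sum>b\<in>B. \<Sum>c\<in>B. jscale iB (\<tau> a b c / 12) (sym3 (omega J g) (iota a) (iota b) (iota c)))"
proof -
  obtain B \<tau> where B: "B \<subseteq> W" "finite B" and t1: "\<And>a b c. \<tau> a b c = \<tau> b a c" and t2: "\<And>a b c. \<tau> a b c = \<tau> a c b"
    and e: "\<And>X Y. app2 S X Y = (\<Sum>a\<in>B. \<Sum>b\<in>B. \<Sum>c\<in>B. jscale J (\<tau> a b c) (trip a b c X Y))"
    by (rule tensor_expansion[OF assms]) blast
  let ?s = "\<lambda>f. \<Sum>a\<in>B. \<Sum>b\<in>B. \<Sum>c\<in>B. f a b c :: complex"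
  \<comment> \<open>Exchanging neighbouring summations gives the two transpositions that generate
    all six permutations of the indices.\<close>
  have s1: "?s f = ?s (\<lambda>a b c. f b a c)" for f by (subst sum.swap) rule
  have s2: "?s f = ?s (\<lambda>a b c. f a c b)" for f by (subst (2) sum.swap) rule
  have "lift S = (\<Sum>a\<in>B. \<Sum>b\<in>B. \<Sum>c\<in>B. jscale iB (\<tau> a b c / 12) (sym3 (omega J g) (iota a) (iota b) (iota c)))"
  proof (rule bil_eqI)
    fix X Y
    let ?X = "rho X" and ?Y = "rho Y"
    have "app2 S ?X ?Y = (\<Sum>a\<in>B. \<Sum>b\<in>B. \<Sum>c\<in>B. jscale J (\<tau> a b c / 6) (app2 (sprod a b c) ?X ?Y))"
    proof (rule theta_eqI)
      fix Z
      let ?t = "\<lambda>a b c. \<tau> a b c * (theta a ?X * theta b ?Y * theta c Z)"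
      have v: "theta (app2 S ?X ?Y) Z = ?s ?t" by (simp add: e theta_sum theta_trip)
      have "?s (\<lambda>a b c. \<tau> a b c / 6 * (theta (app2 (sprod a b c) ?X ?Y) Z)) =
        (?s (\<lambda>a b c. ?t a b c) + ?s (\<lambda>a b c. ?t a c b) + ?s (\<lambda>a b c. ?t b a c)
        + ?s (\<lambda>a b c. ?t b c a) + ?s (\<lambda>a b c. ?t c a b) + ?s (\<lambda>a b c. ?t c b a)) / 6"
        unfolding sum_divide_distrib sum.distrib[symmetric]
      proof (intro sum.cong refl)
        fix a b c
        have "\<tau> a c b = \<tau> a b c" "\<tau> b a c = \<tau> a b c" "\<tau> b c a = \<tau> a b c" "\<tau> c a b = \<tau> a b c" "\<tau> c b a = \<tau> a b c"
          using t1 t2 by metis+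
        then show "\<tau> a b c / 6 * (theta (app2 (sprod a b c) ?X ?Y) Z) = (?t a b c + ?t a c b + ?t b a c + ?t b c a + ?t c a b + ?t c b a) / 6"
          by (simp add: app2_sprod theta_trip algebra_simps)
      qed
      also have "\<dots> = (6 * ?s ?t) / 6"
      proof -
        have "?s (\<lambda>a b c. ?t a c b) = ?s ?t" by (rule s2[symmetric])
        moreover have "?s (\<lambda>a b c. ?t b a c) = ?s ?t" by (rule s1[symmetric])
        moreover have "?s (\<lambda>a b c. ?t b c a) = ?s ?t"
          using s2[of ?t] s1[of "\<lambda>a b c. ?t a c b"] by simp
        moreover have "?s (\<lambda>a b c. ?t c a b) = ?s ?t"
          using s1[of ?t] s2[of "\<lambda>a b c. ?t b a c"] by simp
        moreover have "?s (\<lambda>a b c. ?t c b a) = ?s ?t"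
          using s2[of ?t] s1[of "\<lambda>a b c. ?t a c b"] s2[of "\<lambda>a b c. ?t b c a"] by simp
        ultimately show ?thesis by (simp only:) simp
      qed
      finally show "theta (app2 S ?X ?Y) Z = theta (\<Sum>a\<in>B. \<Sum>b\<in>B. \<Sum>c\<in>B. jscale J (\<tau> a b c / 6) (app2 (sprod a b c) ?X ?Y)) Z"
        by (simp add: v theta_sum)
    qed
    moreover have "app2 (\<Sum>a\<in>B. \<Sum>b\<in>B. \<Sum>c\<in>B. jscale iB (\<tau> a b c / 12) (sym3 (omega J g) (iota a) (iota b) (iota c))) X Y
      = (\<Sum>a\<in>B. \<Sum>b\<in>B. \<Sum>c\<in>B. (1/2) *\<^sub>R iota (jscale J (\<tau> a b c / 6) (app2 (sprod a b c) ?X ?Y)))"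
      unfolding blinfun.sum_left
    proof (intro sum.cong refl)
      fix a b c
      have "app2 (jscale iB (\<tau> a b c / 12) (sym3 (omega J g) (iota a) (iota b) (iota c))) X Y =
        iota (jscale J (\<tau> a b c / 12) (app2 (sprod a b c) ?X ?Y))"
        by (simp add: sym3_iota bil_simps)
      also have "jscale J (\<tau> a b c / 12) = (\<lambda>x. (1/2) *\<^sub>R jscale J (\<tau> a b c / 6) x)"
        by (simp add: jscale_def fun_eq_iff scaleR_add_right)
      finally show "app2 (jscale iB (\<tau> a b c / 12) (sym3 (omega J g) (iota a) (iota b) (iota c))) X Y =
        (1/2) *\<^sub>R iota (jscale J (\<tau> a b c / 6) (app2 (sprod a b c) ?X ?Y))" by simp
    qed
    moreover have "(\<Sum>a\<in>B. \<Sum>b\<in>B. \<Sum>c\<in>B. (1/2) *\<^sub>R iota (f a b c)) = (1/2) *\<^sub>R iota (\<Sum>a\<in>B. \<Sum>b\<in>B. \<Sum>c\<in>B. f a b c)" for f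
      by (simp add: linear_sum[OF bounded_linear.linear[OF bounded_linear_iota]] scaleR_sum_right)
    ultimately show "app2 (lift S) X Y = app2 (\<Sum>a\<in>B. \<Sum>b\<in>B. \<Sum>c\<in>B. jscale iB (\<tau> a b c / 12) (sym3 (omega J g) (iota a) (iota b) (iota c))) X Y"
      by simp
  qed
  with B show thesis by (rule that)
qed

text \<open>The generators are lifts of symmetric products with values in \<open>W\<close>, and such
  lifts are closed under \<i> because \<open>Jbil\<close> preserves the values; conversely
  \<open>sprod_expansion\<close> writes each lift in generators. From here on everything can be done
  with real tensors.\<close>

lemma S30_eq:
  assumes W: "complex_subspace J W"
  shows "S30 J g W = lift ` tensors_in W"
proof
  have sW: "C.subspace W" using W by (simp add: complex_subspace_iff)
  note W' = C.subspace_scale[OF sW] C.subspace_add[OF sW]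
  have "iB.C.subspace (lift ` tensors_in W)"
    unfolding iB.complex_subspace_iff[symmetric] complex_subspace_def
  proof (intro conjI ballI)
    have ss: "subspace W" using W by (simp add: complex_subspace_def)
    have "subspace (tensors_in W)"
      using subspace_0[OF ss] subspace_add[OF ss] subspace_scale[OF ss]
      by (auto simp: subspace_def tensors_in_def tensors_closed bil_simps)
    then show "subspace (lift ` tensors_in W)"
      by (intro linear_subspace_image bounded_linear.linear[OF bounded_linear_lift])
    fix T assume "T \<in> lift ` tensors_in W"
    then obtain S where "S \<in> tensors_in W" "T = lift S" by blast
    then show "iB T \<in> lift ` tensors_in W"
      using W by (intro image_eqI[of _ _ "Jbil S"]) (auto simp: lift_Jbil tensors_in_def Jbil_tensors complex_subspace_def)
  qed
  moreover have "sym3 (omega J g) u1 u2 u3 \<in> lift ` tensors_in W" if u: "u1 \<in> W10 J W" "u2 \<in> W10 J W" "u3 \<in> W10 J W" for u1 u2 u3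
  proof -
    obtain a b c where "a \<in> W" "b \<in> W" "c \<in> W" "u1 = iota a" "u2 = iota b" "u3 = iota c"
      using u W10_eq[OF W] by blast
    moreover have "app2 (sprod a b c) X Y \<in> W" for X Y
      unfolding app2_sprod trip_def using calculation by (intro W') auto
    then have "2 *\<^sub>R sprod a b c \<in> tensors_in W"
      using subspace_scale[of W] W
      by (auto simp: tensors_in_def bil_simps complex_subspace_def intro: tensors_closed sprod_tensors)
    ultimately show ?thesis by (simp add: sym3_iota)
  qed
  ultimately show "S30 J g W \<subseteq> lift ` tensors_in W"
    unfolding S30_def S3_def by (intro iB.C.span_minimal) auto
  show "lift ` tensors_in W \<subseteq> S30 J g W"
  proof safe
    fix S assume "S \<in> tensors_in W"
    then obtain B \<tau> where B: "B \<subseteq> W" and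
      e: "lift S = (\<Sum>a\<in>B. \<Sum>b\<in>B. \<Sum>c\<in>B. jscale iB (\<tau> a b c / 12) (sym3 (omega J g) (iota a) (iota b) (iota c)))"
      by (rule sprod_expansion[OF W]) blast
    have "iota a \<in> W10 J W" if "a \<in> B" for a using that B W10_eq[OF W] by blast
    then show "lift S \<in> S30 J g W"
      unfolding e S30_def S3_def by (intro iB.C.span_sum iB.C.span_scale iB.C.span_base) blast
  qed
qed

text \<open>The values of \<open>lift S\<close> are half the images under \<open>iota\<close> of
  values of \<open>S\<close>, and all of these occur already at real arguments.\<close>

lemma suppC_lift:
  assumes S: "S \<in> tensors" shows "suppC (lift S) = iota ` supp S"
proof
  have "iC.C.subspace (iota ` supp S)"
    unfolding iC.complex_subspace_iff[symmetric] complex_subspace_def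
    using J_supp[OF S] by (auto intro!: linear_subspace_image bounded_linear.linear[OF bounded_linear_iota] subspace_supp)
  moreover have "app2 (lift S) X Y \<in> iota ` supp S" for X Y
    by (simp flip: iota_simps(4)) (intro imageI subspace_scale[OF subspace_supp] app2_in_supp)
  ultimately show "suppC (lift S) \<subseteq> iota ` supp S"
    unfolding suppC_def by (intro iC.C.span_minimal) auto
  have ss: "subspace (suppC (lift S))"
    using iC.complex_subspace_cspan unfolding suppC_def complex_subspace_def by blast
  have "iota (app2 S X Y) \<in> suppC (lift S)" for X Y
  proof -
    have "app2 (lift S) (X, 0) (Y, 0) \<in> suppC (lift S)" unfolding suppC_def by (intro iC.C.span_base) blast
    from subspace_scale[OF ss this, of 2] show ?thesis by simp
  qed
  moreover have "subspace (iota -` suppC (lift S))"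
    by (intro linear_subspace_vimage bounded_linear.linear[OF bounded_linear_iota] ss)
  ultimately have "supp S \<subseteq> iota -` suppC (lift S)"
    by (subst supp_subset_iff) auto
  then show "iota ` supp S \<subseteq> suppC (lift S)" by blast
qed

lemma S30_reg_eq:
  assumes W: "complex_subspace J W"
  shows "S30_reg J g W = lift ` {S \<in> tensors. supp S = W}"
proof -
  have "suppC (lift S) = W10 J W \<longleftrightarrow> supp S = W" if "S \<in> tensors" for S
    unfolding suppC_lift[OF that] W10_eq[OF W] by (intro inj_image_eq_iff injI) simp
  then show ?thesis
    unfolding S30_reg_def S30_eq[OF W] using tensors_in_supp[OF W] by auto
qed

lemma S30_reg_real_eq: "complex_subspace J W \<Longrightarrow> S30_reg_real J g W = {S \<in> tensors. supp S = W}"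
  by (auto simp: S30_reg_real_def S30_reg_eq image_image)

end

section \<open>Isometries and supports\<close>

context pseudo_hermitian_space
begin

text \<open>The natural action of \<open>G\<close> on cubic tensors: three vectors go to their
  images, see \<open>tw_sprod\<close>. Arguments are pulled back by the adjoint, so \<open>G\<close>
  may be any complex linear operator; for an isometry the adjoint is the inverse and this is
  \<open>act\<close>.\<close>

definition tw :: "('v \<Rightarrow> 'v) \<Rightarrow> 'v bil \<Rightarrow> 'v bil" where
  "tw G S = blin2 (\<lambda>X Y. G (app2 S (adj G X) (adj G Y)))"

lemma app2_tw: "clin G \<Longrightarrow> app2 (tw G S) X Y = G (app2 S (adj G X) (adj G Y))"
  unfolding tw_def by (rule blin2_apply, rule bilinearI) (simp_all add: bil_simps clin_simps)

lemma tw_tensors: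
  assumes "clin G" "S \<in> tensors" shows "tw G S \<in> tensors"
  unfolding tensors_def
proof (intro CollectI conjI allI)
  fix X Y Z
  show "app2 (tw G S) X Y = app2 (tw G S) Y X"
    "app2 (tw G S) X (J Y) = - J (app2 (tw G S) X Y)"
    using assms tensorsD(1)[OF assms(2), of "adj G X" "adj G Y"]
    by (simp_all add: app2_tw clin_simps(6)[OF clin_adj[OF assms(1)]] tensorsD(2)[OF assms(2)] clin_simps[OF assms(1)])
  show "theta (app2 (tw G S) X Y) Z = theta (app2 (tw G S) X Z) Y"
    using assms tensorsD(4)[OF assms(2), of "adj G X" "adj G Y" "adj G Z"] by (simp add: app2_tw theta_adj)
qed

lemma tw_compose: "clin G \<Longrightarrow> clin H \<Longrightarrow> tw (\<lambda>x. G (H x)) S = tw G (tw H S)"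
  by (rule bil_eqI) (simp add: app2_tw clin_compose adj_compose)

lemma clin_id: "clin (\<lambda>x. x)"
  by (rule clinI) auto

lemma adj_id: "adj (\<lambda>x. x) = (\<lambda>x. x)"
  by (rule adj_eqI) (auto intro: clinD(1)[OF clin_id])

lemma tw_id: "tw (\<lambda>x. x) S = S"
  by (rule bil_eqI) (simp add: app2_tw clin_id adj_id)

lemma clin_inv:
  assumes "clin G" "bij G" shows "clin (inv_into UNIV G)"
proof (rule clinI)
  have [simp]: "G (inv_into UNIV G x) = x" for x using assms(2) by (simp add: bij_def surj_f_inv_f)
  have eq: "inv_into UNIV G x = y" if "x = G y" for x y using assms(2) that by (simp add: bij_def)
  fix x y r
  show "inv_into UNIV G (x + y) = inv_into UNIV G x + inv_into UNIV G y"
    "inv_into UNIV G (r *\<^sub>R x) = r *\<^sub>R inv_into UNIV G x" "inv_into UNIV G (J x) = J (inv_into UNIV G x)"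
    by (rule eq; simp add: clin_simps[OF assms(1)])+
qed

lemma adj_inv:
  assumes "clin G" "bij G"
  shows "adj G (adj (inv_into UNIV G) x) = x" "adj (inv_into UNIV G) (adj G x) = x"
proof -
  have "(\<lambda>x. inv_into UNIV G (G x)) = (\<lambda>x. x)" "(\<lambda>x. G (inv_into UNIV G x)) = (\<lambda>x. x)"
    using assms(2) by (auto simp: bij_def surj_f_inv_f)
  then show "adj G (adj (inv_into UNIV G) x) = x" "adj (inv_into UNIV G) (adj G x) = x"
    using adj_compose[OF clin_inv[OF assms] assms(1)] adj_compose[OF assms(1) clin_inv[OF assms]]
    by (metis adj_id)+
qed

text \<open>With \<open>G\<close> also \<open>adj G\<close> is invertible, so the pulled back
  arguments exhaust the space and no value is lost.\<close>

lemma supp_tw: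
  assumes "clin G" "bij G" shows "supp (tw G S) = G ` supp S"
proof -
  have "{app2 (tw G S) X Y |X Y. True} = G ` {app2 S X Y |X Y. True}"
  proof (intro equalityI subsetI)
    fix u assume "u \<in> G ` {app2 S X Y |X Y. True}"
    then obtain X Y where "u = G (app2 S X Y)" by auto
    then have "u = app2 (tw G S) (adj (inv_into UNIV G) X) (adj (inv_into UNIV G) Y)"
      by (simp add: app2_tw assms adj_inv)
    then show "u \<in> {app2 (tw G S) X Y |X Y. True}" by blast
  qed (auto simp: app2_tw assms)
  then show ?thesis unfolding supp_def using linear_span_image[OF clinD(1)[OF assms(1)]] by simp
qed

lemma clin_complex_subspace: "clin G \<Longrightarrow> complex_subspace J W \<Longrightarrow> complex_subspace J (G ` W)"
  unfolding complex_subspace_def by (auto simp: clin_def linear_subspace_image) (metis imageI)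

lemma AutI:
  assumes "clin A" "\<And>x y. g (A x) (A y) = g x y"
  shows "A \<in> Aut J g"
proof -
  have "inj A" unfolding linear_injective_0[OF clinD(1)[OF assms(1)]]
  proof (intro allI impI g_nondeg)
    fix x y assume "A x = 0"
    then show "g x y = 0" using assms(2)[of x y] by simp
  qed
  then have "bij A" using linear_inj_imp_surj[OF clinD(1)[OF assms(1)]] by (simp add: bij_def)
  then show ?thesis using assms by (auto simp: Aut_def clin_def)
qed

lemma AutD:
  assumes "A \<in> Aut J g"
  shows "clin A" "bij A" "g (A x) (A y) = g x y" "theta (A x) (A y) = theta x y"
proof -
  show c: "clin A" using assms by (auto simp: Aut_def clin_def)
  show "bij A" "g (A x) (A y) = g x y" using assms by (auto simp: Aut_def)
  have *: "g (A x) (A y) = g x y" for x y using assms by (auto simp: Aut_def)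
  show "theta (A x) (A y) = theta x y" by (simp add: theta_def * flip: clin_simps(6)[OF c])
qed

lemma Aut_omega: "Aut J (omega J g) = Aut J g"
proof -
  have "(\<forall>x y. omega J g (A x) (A y) = omega J g x y) \<longleftrightarrow> (\<forall>x y. g (A x) (A y) = g x y)"
    if c: "\<forall>x. A (J x) = J (A x)" for A
  proof
    assume *: "\<forall>x y. omega J g (A x) (A y) = omega J g x y"
    show "\<forall>x y. g (A x) (A y) = g x y"
    proof (intro allI)
      fix x y
      have "omega J g (A (J x)) (A y) = omega J g (J x) y" using * by blast
      then show "g (A x) (A y) = g x y" using c by (simp add: omega_def)
    qed
  next
    assume *: "\<forall>x y. g (A x) (A y) = g x y"
    show "\<forall>x y. omega J g (A x) (A y) = omega J g x y"
    proof (intro allI)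
      fix x y
      have "g (A (J x)) (A y) = g (J x) y" using * by blast
      then show "omega J g (A x) (A y) = omega J g x y" using c by (simp add: omega_def)
    qed
  qed
  then show ?thesis unfolding Aut_def by blast
qed

lemma adj_Aut: "A \<in> Aut J g \<Longrightarrow> adj A = inv_into UNIV A"
  by (rule adj_eqI[OF clinD(1)[OF AutD(1)]], assumption)
    (metis AutD(2,3) bij_def surj_f_inv_f)

lemma act_eq_tw: "A \<in> Aut J g \<Longrightarrow> act A S = tw A S"
  by (simp add: act_def tw_def adj_Aut)

lemma Aut_id: "(\<lambda>x. x) \<in> Aut J g"
  by (rule AutI) (auto intro: clin_id)

lemma Aut_compose: "A \<in> Aut J g \<Longrightarrow> B \<in> Aut J g \<Longrightarrow> (\<lambda>x. A (B x)) \<in> Aut J g"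
  by (rule AutI) (auto intro: clin_compose AutD(1) simp: AutD(3))

lemma Aut_inv:
  assumes "A \<in> Aut J g" shows "inv_into UNIV A \<in> Aut J g"
proof (rule AutI)
  show "clin (inv_into UNIV A)" using assms by (simp add: clin_inv AutD)
  have "A (inv_into UNIV A x) = x" for x using AutD(2)[OF assms] by (simp add: bij_def surj_f_inv_f)
  then show "g (inv_into UNIV A x) (inv_into UNIV A y) = g x y" for x y
    using AutD(3)[OF assms, of "inv_into UNIV A x" "inv_into UNIV A y"] by simp
qed

lemma act_compose: "A \<in> Aut J g \<Longrightarrow> B \<in> Aut J g \<Longrightarrow> act A (act B S) = act (\<lambda>x. A (B x)) S"
  by (simp add: act_eq_tw Aut_compose tw_compose AutD(1))

lemma act_id: "act (\<lambda>x. x) (S :: 'v bil) = S"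
  unfolding act_eq_tw[OF Aut_id] by (rule tw_id)

lemma act_inv:
  assumes "A \<in> Aut J g"
  shows "act (inv_into UNIV A) (act A S) = S" "act A (act (inv_into UNIV A) S) = S"
proof -
  have "(\<lambda>x. inv_into UNIV A (A x)) = (\<lambda>x. x)" "(\<lambda>x. A (inv_into UNIV A x)) = (\<lambda>x. x)"
    using AutD(2)[OF assms] by (auto simp: bij_def surj_f_inv_f)
  then show "act (inv_into UNIV A) (act A S) = S" "act A (act (inv_into UNIV A) S) = S"
    by (simp_all add: act_compose Aut_inv assms act_id)
qed

definition isotropic_subspace :: "'v set \<Rightarrow> bool" where
  "isotropic_subspace W \<longleftrightarrow> complex_subspace J W \<and> (\<forall>x\<in>W. \<forall>y\<in>W. theta x y = 0)"

lemma isotropic_subspace_iff: "isotropic_subspace W \<longleftrightarrow> complex_subspace J W \<and> isotropic (omega J g) W"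
  using omega_isotropic_iff isotropic_subspace_def by blast

lemma isotropic_grassmannian_eq:
  "isotropic_grassmannian J g k = {W. isotropic_subspace W \<and> dim W = 2 * k}"
  by (auto simp: isotropic_grassmannian_def isotropic_subspace_iff dim_eq_cdim)

lemma isotropic_subspaceD:
  assumes "isotropic_subspace W"
  shows "complex_subspace J W" "subspace W" "x \<in> W \<Longrightarrow> y \<in> W \<Longrightarrow> theta x y = 0"
    "x \<in> W \<Longrightarrow> y \<in> W \<Longrightarrow> g x y = 0" "x \<in> W \<Longrightarrow> J x \<in> W"
  using assms by (auto simp: isotropic_subspace_def complex_subspace_def theta_def complex_eq_iff)

lemma isotropic_subspace_image:
  assumes "A \<in> Aut J g" "isotropic_subspace W"
  shows "isotropic_subspace (A ` W)" "dim (A ` W) = dim W"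
proof -
  show "isotropic_subspace (A ` W)"
    using assms clin_complex_subspace[OF AutD(1)[OF assms(1)]]
    by (auto simp: isotropic_subspace_def AutD(4))
  show "dim (A ` W) = dim W"
    using AutD(2)[OF assms(1)] clinD(1)[OF AutD(1)[OF assms(1)]]
    by (intro dim_image_eq) (auto intro: inj_on_subset bij_is_inj)
qed

lemma CJ_eq': "CJ J g = {S \<in> tensors. isotropic_subspace (supp S)}"
  using complex_subspace_supp by (auto simp: CJ_eq isotropic_subspace_iff)

lemma CJ_stratum_eq: "CJ_stratum J g k = {S \<in> tensors. isotropic_subspace (supp S) \<and> dim (supp S) = 2 * k}"
  using dim_eq_cdim complex_subspace_supp by (auto simp: CJ_stratum_def CJ_eq')

lemma stratum_eq_Union:
  "CJ_stratum J g k = (\<Union>W\<in>isotropic_grassmannian J g k. {S \<in> tensors. supp S = W})"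
  by (auto simp: CJ_stratum_eq isotropic_grassmannian_eq)

lemma act_CJ:
  assumes "A \<in> Aut J g"
  shows "S \<in> CJ J g \<Longrightarrow> act A S \<in> CJ J g" "S \<in> CJ_stratum J g k \<Longrightarrow> act A S \<in> CJ_stratum J g k"
    "supp (act A S) = A ` supp S"
  using assms by (auto simp: CJ_eq' CJ_stratum_eq act_eq_tw supp_tw AutD tw_tensors isotropic_subspace_image)

lemma act_image:
  assumes "A \<in> Aut J g"
  shows "act A ` CJ J g = CJ J g" "act A ` CJ_stratum J g k = CJ_stratum J g k"
proof -
  have "act A ` X = X" if "\<And>T. T \<in> X \<Longrightarrow> act A T \<in> X" "\<And>T. T \<in> X \<Longrightarrow> act (inv_into UNIV A) T \<in> X" for X
  proof (intro equalityI subsetI)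
    fix S assume "S \<in> X"
    then show "S \<in> act A ` X"
      using that(2) by (intro image_eqI[of _ _ "act (inv_into UNIV A) S"]) (simp_all add: act_inv(2)[OF assms])
  qed (use that(1) in auto)
  from this[of "CJ J g", OF act_CJ(1)[OF assms] act_CJ(1)[OF Aut_inv[OF assms]]]
    this[of "CJ_stratum J g k", OF act_CJ(2)[OF assms] act_CJ(2)[OF Aut_inv[OF assms]]]
  show "act A ` CJ J g = CJ J g" "act A ` CJ_stratum J g k = CJ_stratum J g k" by simp_all
qed

section \<open>Enlarging a support by a cube\<close>

lemma app2_sprod_cube: "app2 (sprod w w w) X Y = jscale J (6 * (theta w X * theta w Y)) w"
  by (rule theta_eqI) (simp add: app2_sprod theta_trip)

text \<open>A vector \<open>z\<close> that annihilates the support of \<open>S\<close> and satisfies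
  \<open>theta w z = 1\<close> is killed by \<open>S\<close>, so the new tensor takes the value
  \<open>6 r w\<close> at \<open>z, z\<close>. Once \<open>w\<close> lies in the new support, the
  cube can be subtracted and the values of \<open>S\<close> lie there too.\<close>

lemma supp_add_cube:
  assumes S: "S \<in> tensors" and w: "w \<notin> supp S" and r: "r \<noteq> 0"
  shows "supp (S + r *\<^sub>R sprod w w w) = cspan J (insert w (supp S))"
proof
  let ?T = "S + r *\<^sub>R sprod w w w"
  have T: "?T \<in> tensors" using S by (intro tensors_closed sprod_tensors)
  have TC: "C.subspace (supp ?T)" using complex_subspace_supp[OF T] by (simp add: complex_subspace_iff)
  have "app2 ?T X Y \<in> cspan J (insert w (supp S))" for X Y
  proof -
    have "app2 ?T X Y = app2 S X Y + jscale J (complex_of_real r * (6 * (theta w X * theta w Y))) w"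
      by (simp add: bil_simps app2_sprod_cube flip: C.scale_scale jscale_simps(1))
    moreover have "w \<in> cspan J (insert w (supp S))" "app2 S X Y \<in> cspan J (insert w (supp S))"
      by (rule C.span_base, simp add: app2_in_supp)+
    ultimately show ?thesis by (simp only: C.span_add C.span_scale)
  qed
  then show "supp ?T \<subseteq> cspan J (insert w (supp S))"
    using complex_subspace_cspan by (subst supp_subset_iff) (auto simp: complex_subspace_def)
  obtain z where z: "\<And>d. d \<in> supp S \<Longrightarrow> theta d z = 0" "theta w z = 1"
    using theta_separation[OF complex_subspace_supp[OF S] w] by blast
  have "app2 ?T z z = jscale J (complex_of_real (6 * r)) w"
    using z tensor_kernel[OF S z(1)] by (simp add: bil_simps app2_sprod_cube scaleR_conv_of_real mult.commute jscale_def)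
  then have "jscale J (complex_of_real (6 * r)) w \<in> supp ?T" by (metis app2_in_supp)
  from C.subspace_scale[OF TC this, of "inverse (complex_of_real (6 * r))"] r
  have w': "w \<in> supp ?T" by (simp del: of_real_mult of_real_numeral jscale_simps)
  have "app2 S X Y \<in> supp ?T" for X Y
  proof -
    have "app2 S X Y = app2 ?T X Y - jscale J (complex_of_real r * (6 * (theta w X * theta w Y))) w"
      by (simp add: bil_simps app2_sprod_cube flip: C.scale_scale jscale_simps(1))
    then show ?thesis using C.subspace_diff[OF TC app2_in_supp C.subspace_scale[OF TC w']] by simp
  qed
  then have "supp S \<subseteq> supp ?T" by (subst supp_subset_iff) (auto simp: subspace_supp)
  with w' show "cspan J (insert w (supp S)) \<subseteq> supp ?T" by (intro C.span_minimal TC) auto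
qed

text \<open>A tensor of Fermat type works: the sum of the cubes of a complex basis, assembled one
  vector at a time.\<close>

lemma obtain_regular:
  assumes W: "complex_subspace J W"
  obtains S where "S \<in> tensors" "supp S = W"
proof -
  obtain B where B: "finite B" "C.independent B" "cspan J B = W" using obtain_cbasis[OF W] by metis
  from B(1,2) have "\<exists>S\<in>tensors. supp S = cspan J B"
  proof (induction B)
    case empty
    have "supp (0 :: 'v bil) = {0}" unfolding supp_def by (auto simp: bil_simps)
    then show ?case using tensors_closed(1) by (auto simp: C.span_empty)
  next
    case (insert w B)
    then obtain S where S: "S \<in> tensors" "supp S = cspan J B" by (auto simp: C.independent_insert)
    have w: "w \<notin> supp S" using insert by (auto simp: C.independent_insert S)
    have "supp (S + 1 *\<^sub>R sprod w w w) = cspan J (insert w B)"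
      unfolding supp_add_cube[OF S(1) w zero_neq_one[symmetric]] S(2)
      by (simp add: C.span_insert C.span_span)
    then show ?case using S(1) by (intro bexI[of _ "S + 1 *\<^sub>R sprod w w w"] tensors_closed sprod_tensors)
  qed
  with B(3) that show thesis by blast
qed

end

section \<open>Witt's theorem for isotropic subspaces\<close>

context pseudo_hermitian_space
begin

definition cproj :: "('v \<Rightarrow> 'v) \<Rightarrow> 'v set \<Rightarrow> bool" where
  "cproj C W \<longleftrightarrow> clin C \<and> (\<forall>x. C x \<in> W) \<and> (\<forall>w\<in>W. C w = w)"

lemma cprojD: "cproj C W \<Longrightarrow> clin C" "cproj C W \<Longrightarrow> C x \<in> W" "cproj C W \<Longrightarrow> w \<in> W \<Longrightarrow> C w = w"
  by (auto simp: cproj_def)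

text \<open>Averaging over \<open>J\<close> turns any projector onto a complex subspace into a complex linear one.\<close>

lemma cproj_average:
  assumes "linear P" "\<And>x. P x \<in> W" "\<And>w. w \<in> W \<Longrightarrow> P w = w" "complex_subspace J W"
  shows "cproj (\<lambda>x. (1/2) *\<^sub>R (P x - J (P (J x)))) W"
  unfolding cproj_def
proof (intro conjI allI ballI)
  have W: "subspace W" "\<And>x. x \<in> W \<Longrightarrow> J x \<in> W" using assms(4) by (auto simp: complex_subspace_def)
  show "clin (\<lambda>x. (1/2) *\<^sub>R (P x - J (P (J x))))"
    using assms(1) by (intro clinI) (simp_all add: linear_add linear_scale linear_neg algebra_simps)
  fix x
  show "(1/2) *\<^sub>R (P x - J (P (J x))) \<in> W"
    using W assms(2) by (intro subspace_scale subspace_diff) auto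
next
  fix w assume "w \<in> W"
  then show "(1/2) *\<^sub>R (P w - J (P (J w))) = w"
    using assms(3,4) by (simp add: complex_subspace_def flip: scaleR_2)
qed

lemma obtain_cproj:
  assumes "complex_subspace J W"
  obtains C where "cproj C W"
proof -
  have W: "subspace W" using assms by (simp add: complex_subspace_def)
  obtain P where P: "linear P" "P ` UNIV = W" "\<And>x. x \<in> W \<Longrightarrow> P x = x"
  proof -
    obtain B where B: "B \<subseteq> W" "independent B" "W \<subseteq> span B" using maximal_independent_subset by blast
    then have sB: "span B = W" using W by (meson span_minimal subset_antisym)
    obtain P where P: "linear P" "range P = span B" "\<And>x. x \<in> B \<Longrightarrow> P x = x"
    proof -
      obtain P where "linear P" "\<And>x. x \<in> B \<Longrightarrow> P x = x" "range P = span (id ` B)"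
        using linear_independent_extend_subspace[OF B(2), of id] by auto
      then show thesis using that by auto
    qed
    have "P x = x" if "x \<in> span B" for x
      using linear_eq_on[OF P(1) linear_id, of x B] that P(3) by auto
    then show thesis using that P sB by metis
  qed
  have "cproj (\<lambda>x. (1/2) *\<^sub>R (P x - J (P (J x)))) W"
    using P by (intro cproj_average assms) auto
  then show thesis by (rule that)
qed

lemma adj_sub: "linear A \<Longrightarrow> linear B \<Longrightarrow> adj (\<lambda>x. A x - r *\<^sub>R B x) = (\<lambda>x. adj A x - r *\<^sub>R adj B x)"
  by (rule adj_eqI) (auto simp: g_adj intro!: linear_compose_sub linear_compose_scale_right)

text \<open>The range of \<open>adj \<pi>\<close> is an isotropic complement of the orthogonal space of \<open>W\<close>.\<close>

definition witt_proj :: "('v \<Rightarrow> 'v) \<Rightarrow> 'v set \<Rightarrow> bool" where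
  "witt_proj \<pi> W \<longleftrightarrow> isotropic_subspace W \<and> cproj \<pi> W \<and> (\<forall>x. \<pi> (adj \<pi> x) = 0)"

lemma witt_projD:
  assumes "witt_proj \<pi> W"
  shows "clin \<pi>" "\<pi> x \<in> W" "w \<in> W \<Longrightarrow> \<pi> w = w" "\<pi> (adj \<pi> x) = 0" "\<pi> (\<pi> x) = \<pi> x" "isotropic_subspace W"
    "w \<in> W \<Longrightarrow> adj \<pi> w = 0"
proof -
  show p: "clin \<pi>" "\<pi> x \<in> W" "w \<in> W \<Longrightarrow> \<pi> w = w" "\<pi> (adj \<pi> x) = 0" "\<pi> (\<pi> x) = \<pi> x" "isotropic_subspace W"
    for x w using assms by (auto simp: witt_proj_def cproj_def)
  show "adj \<pi> w = 0" if "w \<in> W"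
  proof (rule g_eqI)
    fix z
    show "g z (adj \<pi> w) = g z 0"
      using isotropic_subspaceD(4)[OF p(6), of "\<pi> z" w] that p(2)[of z] by (simp add: g_adj[OF clinD(1)[OF p(1)], symmetric])
  qed
qed

text \<open>Start with any complex linear projector \<open>C\<close> onto \<open>W\<close>. Isotropy
  gives \<open>adj C = 0\<close> on \<open>W\<close>, so subtracting half of \<open>C\<close>
  composed with \<open>adj C\<close> keeps a projector onto \<open>W\<close>. In the product of the
  corrected projector with its adjoint each of the two corrections removes half of that composite,
  and nothing remains.\<close>

lemma obtain_witt_proj:
  assumes W: "isotropic_subspace W"
  obtains \<pi> where "witt_proj \<pi> W"
proof -
  obtain C where C: "cproj C W" using obtain_cproj isotropic_subspaceD(1)[OF W] by blast
  note c = cprojD(1)[OF C] and c' = clin_adj[OF cprojD(1)[OF C]]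
  define \<pi> where "\<pi> x = C x - (1/2) *\<^sub>R C (adj C x)" for x
  have ann: "adj C w = 0" if "w \<in> W" for w
  proof (rule g_eqI)
    fix z
    show "g z (adj C w) = g z 0"
      using isotropic_subspaceD(4)[OF W, of "C z" w] that cprojD(2)[OF C] by (simp add: g_adj[OF clinD(1)[OF c], symmetric])
  qed
  have cc: "clin (\<lambda>x. C (adj C x))" using c c' by (rule clin_compose)
  have adjcc: "adj (\<lambda>x. C (adj C x)) = (\<lambda>x. C (adj C x))"
    using adj_compose[OF c c'] adj_adj[OF clinD(1)[OF c]] by simp
  have adjp: "adj \<pi> = (\<lambda>x. adj C x - (1/2) *\<^sub>R C (adj C x))"
    unfolding \<pi>_def[abs_def] using adj_sub[OF clinD(1)[OF c] clinD(1)[OF cc]] adjcc by simp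
  have acC: "adj C (adj C x) = adj C x" for x
  proof (rule g_eqI)
    fix z show "g z (adj C (adj C x)) = g z (adj C x)"
      using cprojD(3)[OF C cprojD(2)[OF C]] by (simp add: g_adj[OF clinD(1)[OF c], symmetric])
  qed
  have W0: "subspace W" using isotropic_subspaceD(2)[OF W] .
  have "witt_proj \<pi> W"
    unfolding witt_proj_def cproj_def
  proof (intro conjI W allI ballI)
    show "clin \<pi>" unfolding \<pi>_def[abs_def] by (rule clinI) (simp_all add: clin_simps[OF c] clin_simps[OF c'] algebra_simps)
    show "\<pi> x \<in> W" for x unfolding \<pi>_def using W0 cprojD(2)[OF C] by (intro subspace_diff subspace_scale)
    show "\<pi> w = w" if "w \<in> W" for w using cprojD(3)[OF C that] ann[OF that] by (simp add: \<pi>_def clin_simps[OF c])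
    fix x
    have "\<pi> (adj \<pi> x) = C (adj C x) - (1/2) *\<^sub>R C (adj C x) - (1/2) *\<^sub>R C (adj C x)"
      by (simp add: adjp \<pi>_def clin_simps[OF c] ann[OF cprojD(2)[OF C]] acC cprojD(3)[OF C cprojD(2)[OF C]])
    also have "\<dots> = 0" by (simp flip: scaleR_left_diff_distrib scaleR_add_left add: diff_diff_eq)
    finally show "\<pi> (adj \<pi> x) = 0" .
  qed
  then show thesis by (rule that)
qed

text \<open>\<open>A\<close> acts as \<open>M\<close> on \<open>W\<close>, by the inverse adjoint on the dual isotropic subspace, and trivially on the rest.\<close>

lemma witt_extension:
  assumes p: "witt_proj \<pi> W" and M: "clin M" "\<And>x. M x \<in> W" "\<And>x. M (\<pi> x) = M x"
    and N: "clin N" "\<And>x. N x \<in> W" "\<And>x. N (\<pi> x) = N x" and NM: "\<And>x. N (M x) = \<pi> x"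
  defines "A \<equiv> \<lambda>x. M x + adj N x + (x - \<pi> x - adj \<pi> x)"
  shows "A \<in> Aut J g" "w \<in> W \<Longrightarrow> A w = M w"
proof -
  note pD = witt_projD[OF p]
  note lin = clin_simps[OF M(1)] clin_simps[OF N(1)] clin_simps[OF pD(1)]
    clin_simps[OF clin_adj[OF N(1)]] clin_simps[OF clin_adj[OF pD(1)]]
  note a\<pi> = g_adj[OF clinD(1)[OF pD(1)], symmetric] g_adj'[OF clinD(1)[OF pD(1)]]
  note aN = g_adj[OF clinD(1)[OF N(1)], symmetric] g_adj'[OF clinD(1)[OF N(1)]]
  note iso = isotropic_subspaceD(4)[OF pD(6)]
  have N0: "N (adj \<pi> x) = 0" for x using N(3)[of "adj \<pi> x"] by (simp add: pD(4) lin)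
  have "\<pi> (adj N x) = 0" for x
  proof -
    have "adj N = adj (\<lambda>x. N (\<pi> x))" by (simp only: N(3))
    also have "\<dots> = (\<lambda>x. adj \<pi> (adj N x))" by (rule adj_compose[OF N(1) pD(1)])
    finally have "adj N x = adj \<pi> (adj N x)" by (rule fun_cong)
    then have "\<pi> (adj N x) = \<pi> (adj \<pi> (adj N x))" by (rule arg_cong)
    then show ?thesis by (simp only: pD(4))
  qed
  then have Na: "N (adj N x) = 0" for x using N(3)[of "adj N x"] by (simp add: lin)
  \<comment> \<open>The component orthogonal to both \<open>W\<close> and the range of
    \<open>adj \<pi>\<close>; isometry is then checked on the three blocks of
    \<open>x\<close>.\<close>
  define E where "E x = x - \<pi> x - adj \<pi> x" for x
  have \<pi>E: "\<pi> (E x) = 0" and NE: "N (E x) = 0" for x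
    by (simp_all add: E_def lin pD N0 N(3))
  have E1: "g u (E x) = 0" if "u \<in> W" for u x
    using iso[OF that pD(2)[of x]] pD(3)[OF that] by (simp add: E_def a\<pi>)
  have E2: "g (E x) (E y) = g x y - g (\<pi> x) y - g x (\<pi> y)" for x y
  proof -
    have "g (E x) (E y) = g x (E y) - g (\<pi> x) (E y) - g x (\<pi> (E y))" by (simp add: E_def[of x] a\<pi>)
    then show ?thesis by (simp add: E1[OF pD(2)] \<pi>E) (simp add: E_def a\<pi>)
  qed
  have A: "A x = M x + adj N x + E x" for x by (simp add: A_def E_def)
  note ME = E1[OF M(2)]
  have "g (A x) (A y) = g x y" for x y
  proof -
    have "g (A x) (A y) = g (M x) (M y) + g (N (M x)) y + g (M x) (E y)
        + g x (N (M y)) + g (N (adj N x)) y + g x (N (E y))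
        + g (E x) (M y) + g (N (E x)) y + g (E x) (E y)"
      by (simp add: A aN lin)
    also have "\<dots> = g x y"
      using iso[OF M(2) M(2), of x y] ME[of x y] ME[of y x] by (simp add: NM Na NE E2 g_sym[of "E x" "M y"])
    finally show ?thesis .
  qed
  moreover have "clin A" unfolding A_def by (rule clinI) (simp_all add: lin algebra_simps)
  ultimately show "A \<in> Aut J g" by (intro AutI)
  show "A w = M w" if "w \<in> W"
  proof -
    have "adj N w = 0"
    proof (rule g_eqI)
      fix z show "g z (adj N w) = g z 0" using iso[OF N(2) that] by (simp add: aN)
    qed
    then show ?thesis using pD(3,7)[OF that] by (simp add: A_def)
  qed
qed

text \<open>Composed with \<pi>, the map \<open>A\<close> and its inverse on \<open>W\<close> become
  complex linear on all of \<open>V\<close> and serve as \<open>M\<close> and \<open>N\<close> in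
  \<open>witt_extension\<close>.\<close>

lemma GL_extends:
  assumes W: "isotropic_subspace W" and A: "A \<in> GL J W"
  obtains B where "B \<in> Aut J g" "\<And>w. w \<in> W \<Longrightarrow> B w = A w" "B ` W = W"
proof -
  obtain \<pi> where p: "witt_proj \<pi> W" using obtain_witt_proj[OF W] .
  note pD = witt_projD[OF p]
  have A': "linear A" "\<And>x. x \<in> W \<Longrightarrow> A (J x) = J (A x)" "bij_betw A W W" using A by (auto simp: GL_def)
  have AW: "A x \<in> W" if "x \<in> W" for x using A'(3) that by (auto simp: bij_betw_def)
  define A1 where "A1 = inv_into W A"
  have A1: "A1 x \<in> W" "A (A1 x) = x" if "x \<in> W" for x
    using A'(3) that unfolding A1_def bij_betw_def by (metis inv_into_into, metis f_inv_into_f)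
  have A1I: "A1 (A x) = x" if "x \<in> W" for x
    using A'(3) that unfolding A1_def bij_betw_def by (simp add: inv_into_f_f)
  have eqA1: "A1 u = x" if "u = A x" "x \<in> W" for u x using A1I that by simp
  note sW = isotropic_subspaceD(2)[OF W] and JW = isotropic_subspaceD(5)[OF W]
  have M: "clin (\<lambda>x. A (\<pi> x))"
    using A' pD by (intro clinI) (simp_all add: clin_simps[OF pD(1)] linear_add linear_scale)
  have N: "clin (\<lambda>x. A1 (\<pi> x))"
  proof (rule clinI)
    show "A1 (\<pi> (x + y)) = A1 (\<pi> x) + A1 (\<pi> y)" for x y
      by (rule eqA1) (use A' A1 pD(2) sW in \<open>auto simp: clin_simps[OF pD(1)] linear_add intro: subspace_add\<close>)
    show "A1 (\<pi> (r *\<^sub>R x)) = r *\<^sub>R A1 (\<pi> x)" for r x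
      by (rule eqA1) (use A' A1 pD(2) sW in \<open>auto simp: clin_simps[OF pD(1)] linear_scale intro: subspace_scale\<close>)
    show "A1 (\<pi> (J x)) = J (A1 (\<pi> x))" for x
      by (rule eqA1) (use A' A1 pD(2) JW in \<open>auto simp: clin_simps[OF pD(1)]\<close>)
  qed
  from witt_extension[OF p M AW[OF pD(2)] _ N A1(1)[OF pD(2)]] obtain B where
    B: "B \<in> Aut J g" "\<And>w. w \<in> W \<Longrightarrow> B w = A (\<pi> w)"
    using pD(3)[OF AW[OF pD(2)]] A1I[OF pD(2)] pD(5) by auto
  then have "\<And>w. w \<in> W \<Longrightarrow> B w = A w" using pD(3) by simp
  moreover from this have "B ` W = W" using A'(3) by (auto simp: bij_betw_def)
  ultimately show thesis using that B(1) by blast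
qed

text \<open>\<open>R\<close> is the projector onto an isotropic subspace \<open>W'\<close> along \<open>ker \<pi>\<close>; the isometry below is
  unipotent and maps \<open>W\<close> to \<open>W'\<close>.\<close>

lemma graph_isometry:
  assumes p: "witt_proj \<pi> W" and W': "isotropic_subspace W'"
    and R: "clin R" "\<And>x. R x \<in> W'" "\<And>x. R (\<pi> x) = R x" "\<And>x. \<pi> (R x) = \<pi> x"
  defines "A \<equiv> \<lambda>x. R x + (x - \<pi> x - adj \<pi> x) - adj R (x - \<pi> x - adj \<pi> x) + adj \<pi> x"
  shows "A \<in> Aut J g" "w \<in> W \<Longrightarrow> A w = R w"
proof -
  note pD = witt_projD[OF p]
  note lin = clin_simps[OF R(1)] clin_simps[OF pD(1)]
    clin_simps[OF clin_adj[OF R(1)]] clin_simps[OF clin_adj[OF pD(1)]]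
  note a\<pi> = g_adj[OF clinD(1)[OF pD(1)], symmetric] g_adj'[OF clinD(1)[OF pD(1)]]
  note aR = g_adj[OF clinD(1)[OF R(1)], symmetric] g_adj'[OF clinD(1)[OF R(1)]]
  note iso = isotropic_subspaceD(4)[OF pD(6)]
  have RR: "R (R x) = R x" for x using R(3)[of "R x"] by (simp add: R(3,4))
  have R0: "R (adj \<pi> x) = 0" for x using R(3)[of "adj \<pi> x"] by (simp add: pD(4) lin)
  have \<pi>R: "\<pi> (adj R x) = 0" for x
  proof -
    have "adj R = adj (\<lambda>x. R (\<pi> x))" by (simp only: R(3))
    also have "\<dots> = (\<lambda>x. adj \<pi> (adj R x))" by (rule adj_compose[OF R(1) pD(1)])
    finally have "adj R x = adj \<pi> (adj R x)" by (rule fun_cong)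
    then have "\<pi> (adj R x) = \<pi> (adj \<pi> (adj R x))" by (rule arg_cong)
    then show ?thesis by (simp only: pD(4))
  qed
  then have Ra: "R (adj R x) = 0" for x using R(3)[of "adj R x"] by (simp add: lin)
  define E where "E x = x - \<pi> x - adj \<pi> x" for x
  have \<pi>E: "\<pi> (E x) = 0" and RE: "R (E x) = 0" for x
    by (simp_all add: E_def lin pD R0 R(3))
  have E1: "g u (E x) = 0" if "u \<in> W" for u x
    using iso[OF that pD(2)[of x]] pD(3)[OF that] by (simp add: E_def a\<pi>)
  have E3: "g (\<pi> x) (E y) = 0" for x y
    by (rule E1[OF pD(2)])
  have E2: "g (E x) (E y) = g x y - g (\<pi> x) y - g x (\<pi> y)" for x y
  proof -
    have "g (E x) (E y) = g x (E y) - g (\<pi> x) (E y) - g x (\<pi> (E y))" by (simp add: E_def[of x] a\<pi>)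
    then show ?thesis by (simp add: E3 \<pi>E) (simp add: E_def a\<pi>)
  qed
  \<comment> \<open>The term with \<open>adj R\<close> cancels the pairings of \<open>R x\<close>
    with \<open>E y\<close>, since \<open>R\<close> is idempotent. The pairings of
    \<open>R x\<close> with \<open>adj \<pi> y\<close> restore those lost in passing to
    \<open>E\<close>, because \<pi> after \<open>R\<close> is \<pi>.\<close>
  have A: "A x = R x + E x - adj R (E x) + adj \<pi> x" for x by (simp add: A_def E_def)
  have "g (A x) (A y) = g x y" for x y
  proof -
    have "g (A x) (A y) = g (R x) (R y) + g (R x) (E y) - g (R (R x)) (E y) + g (\<pi> (R x)) y
        + g (E x) (R y) + g (E x) (E y) - g (R (E x)) (E y) + g (\<pi> (E x)) y
        - g (E x) (R (R y)) - g (E x) (R (E y)) + g (E x) (R (adj R (E y))) - g (E x) (R (adj \<pi> y))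
        + g x (\<pi> (R y)) + g x (\<pi> (E y)) - g (R (adj \<pi> x)) (E y) + g x (\<pi> (adj \<pi> y))"
      by (simp add: A aR a\<pi> lin Ra R0 pD(4) \<pi>R)
    also have "\<dots> = g x y"
      using isotropic_subspaceD(4)[OF W' R(2) R(2), of x y] by (simp add: RR RE \<pi>E Ra R0 R(4) pD(4) E2 lin)
    finally show ?thesis .
  qed
  moreover have "clin A" unfolding A_def by (rule clinI) (simp_all add: lin algebra_simps)
  ultimately show "A \<in> Aut J g" by (intro AutI)
  show "A w = R w" if "w \<in> W"
    using pD(3,7)[OF that] by (simp add: A_def lin)
qed

text \<open>The reflection in the complex line through \<open>v = x - y\<close>. The hypothesis says
  \<open>g x y = 1\<close> and \<open>g (J x) y = 0\<close>, so \<open>g v v = -2\<close> and the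
  usual coefficient \<open>-2 / g v v\<close> is 1.\<close>

lemma reflection:
  assumes "theta x x = 0" "theta y y = 0" "theta x y = \<i>"
  obtains A where "A \<in> Aut J g" "A x = y" "\<And>d. theta d x = 0 \<Longrightarrow> theta d y = 0 \<Longrightarrow> A d = d"
proof -
  define v where "v = x - y"
  define A where "A z = z + g v z *\<^sub>R v + g (J v) z *\<^sub>R J v" for z
  have xy: "g x x = 0" "g y y = 0" "g x y = 1" "g (J x) y = 0" "g (J y) x = 0"
    using assms by (auto simp: theta_def complex_eq_iff g_J_right g_sym[of "J y"])
  have vv: "g v v = - 2" using xy by (simp add: v_def g_sym[of y x])
  show thesis
  proof (rule that[of A])
    have "g (A z) (A w) = g z w" for z w
      by (simp add: A_def vv g_sym[of z v] g_sym[of z "J v"] algebra_simps)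
    moreover have "clin A"
      by (rule clinI) (simp_all add: A_def algebra_simps g_J_right)
    ultimately show "A \<in> Aut J g" by (intro AutI)
    show "A x = y" using xy by (simp add: A_def v_def g_sym[of y x])
    show "A d = d" if "theta d x = 0" "theta d y = 0" for d
    proof -
      have "g v d = 0" "g (J v) d = 0"
        using that by (auto simp: v_def theta_def complex_eq_iff g_sym[of _ d] g_J_right)
      then show ?thesis by (simp add: A_def)
    qed
  qed
qed

lemma move_transverse:
  assumes "theta x x = 0" "theta y y = 0" "theta x y \<noteq> 0"
  obtains A c where "A \<in> Aut J g" "c \<noteq> 0" "A x = jscale J c y" "\<And>d. theta d x = 0 \<Longrightarrow> theta d y = 0 \<Longrightarrow> A d = d"
proof -
  \<comment> \<open>Rescales \<open>y\<close> so that its pairing with \<open>x\<close> becomes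
    \<i>, as \<open>reflection\<close> demands.\<close>
  let ?c = "cnj (\<i> / theta x y)"
  have "theta x (jscale J ?c y) = \<i>" "theta (jscale J ?c y) (jscale J ?c y) = 0" using assms by simp_all
  with reflection[OF assms(1), of "jscale J ?c y"] obtain A where
    "A \<in> Aut J g" "A x = jscale J ?c y" "\<And>d. theta d x = 0 \<Longrightarrow> theta d (jscale J ?c y) = 0 \<Longrightarrow> A d = d" by metis
  then show thesis using assms(3) by (intro that[of A ?c]) auto
qed

text \<open>When \<open>x\<close> and \<open>y\<close> are orthogonal no single reflection of the
  above kind applies. An isotropic vector \<open>z\<close>, orthogonal to \<open>D\<close> but
  paired nontrivially with both, serves as an intermediate stop.\<close>

lemma move:
  assumes "theta x x = 0" "theta y y = 0" and D: "complex_subspace J D"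
    and xy: "x \<notin> D" "y \<notin> D" and Dxy: "\<And>d. d \<in> D \<Longrightarrow> theta d x = 0" "\<And>d. d \<in> D \<Longrightarrow> theta d y = 0"
  obtains A c where "A \<in> Aut J g" "c \<noteq> 0" "A x = jscale J c y" "\<And>d. d \<in> D \<Longrightarrow> A d = d"
proof (cases "theta x y = 0")
  case False
  then show ?thesis using move_transverse[OF assms(1,2)] that Dxy by metis
next
  case True
  obtain z1 where z1: "\<And>d. d \<in> D \<Longrightarrow> theta d z1 = 0" "theta x z1 = 1" using theta_separation[OF D xy(1)] by metis
  obtain z2 where z2: "\<And>d. d \<in> D \<Longrightarrow> theta d z2 = 0" "theta y z2 = 1" using theta_separation[OF D xy(2)] by metis
  \<comment> \<open>If neither separating vector pairs with both \<open>x\<close> and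
    \<open>y\<close>, their sum does.\<close>
  obtain z0 where z0: "\<And>d. d \<in> D \<Longrightarrow> theta d z0 = 0" "theta x z0 \<noteq> 0" "theta y z0 \<noteq> 0"
  proof (cases "theta y z1 = 0")
    case yz1: True
    show ?thesis
    proof (cases "theta x z2 = 0")
      case True
      with yz1 z1 z2 show ?thesis by (intro that[of "z1 + z2"]) auto
    next
      case False
      with z2 show ?thesis by (intro that[of z2]) auto
    qed
  next
    case False
    with z1 show ?thesis by (intro that[of z1]) auto
  qed
  \<comment> \<open>Adding a multiple of \<open>x\<close> leaves the pairings with \<open>x\<close>,
    \<open>y\<close> and \<open>D\<close> as they are and changes
    \<open>theta z0 z0 = \<i> * g z0 z0\<close> by twice the imaginary part of
    \<open>a * theta x z0\<close>, times \<i>; this \<open>a\<close> makes the sum vanish.\<close>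
  define a where "a = - \<i> * complex_of_real (g z0 z0) / (2 * theta x z0)"
  define z where "z = z0 + jscale J a x"
  have "theta z0 x = - cnj (theta x z0)" by (rule theta_swap)
  then have "theta z z = theta z0 z0 + (a * theta x z0 - cnj (a * theta x z0))"
    by (simp add: z_def assms(1))
  also have "a * theta x z0 = - \<i> * complex_of_real (g z0 z0) / 2" using z0(2) by (simp add: a_def)
  finally have zz: "theta z z = 0" by (simp add: theta_def complex_eq_iff)
  have "theta y x = 0" using theta_swap[of y x] True by simp
  then have yz: "theta y z \<noteq> 0" and xz: "theta x z \<noteq> 0" using z0 assms(1) by (auto simp: z_def)
  have zy: "theta z y \<noteq> 0" using theta_swap[of z y] yz by simp
  have dz: "theta d z = 0" if "d \<in> D" for d using z0 Dxy that by (simp add: z_def)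
  obtain A c where A: "A \<in> Aut J g" "c \<noteq> 0" "A x = jscale J c z" "\<And>d. theta d x = 0 \<Longrightarrow> theta d z = 0 \<Longrightarrow> A d = d"
    by (rule move_transverse[OF assms(1) zz xz]) blast
  obtain B c' where B: "B \<in> Aut J g" "c' \<noteq> 0" "B z = jscale J c' y" "\<And>d. theta d z = 0 \<Longrightarrow> theta d y = 0 \<Longrightarrow> B d = d"
    by (rule move_transverse[OF zz assms(2) zy]) blast
  show ?thesis
  proof (rule that[of "\<lambda>x. B (A x)" "c * c'"])
    show "(\<lambda>x. B (A x)) \<in> Aut J g" using A(1) B(1) by (simp add: Aut_compose)
    show "B (A x) = jscale J (c * c') y" using A(3) B(3) by (simp add: clin_simps(7)[OF AutD(1)[OF B(1)]])
    show "B (A d) = d" if "d \<in> D" for d using A(4) B(4) Dxy dz that by simp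
  qed (use A B in auto)
qed

text \<open>Carrying a vector of \<open>W0\<close> outside \<open>W1\<close> to the line of a vector
  of \<open>W1\<close> outside \<open>W0\<close>, while fixing the intersection, enlarges the
  intersection. Both vectors exist as long as the subspaces differ, because the dimensions
  agree.\<close>

lemma Aut_transitive:
  assumes "isotropic_subspace W0" "isotropic_subspace W1" "dim W0 = dim W1"
  obtains A where "A \<in> Aut J g" "A ` W0 = W1"
proof -
  have "\<exists>A\<in>Aut J g. A ` W0 = W1"
    using assms
  proof (induction "dim W1 - dim (W0 \<inter> W1)" arbitrary: W0 rule: less_induct)
    case less
    note iso0 = isotropic_subspaceD[OF less.prems(1)] and iso1 = isotropic_subspaceD[OF less.prems(2)]
    show ?case
    proof (cases "W0 = W1")
      case True
      then show ?thesis using Aut_id by (intro bexI[of _ "\<lambda>x. x"]) auto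
    next
      case False
      have ne: "\<not> W0 \<subseteq> W1" "\<not> W1 \<subseteq> W0"
        using False less.prems(3) subspace_dim_equal[OF iso0(2) iso1(2)] subspace_dim_equal[OF iso1(2) iso0(2)] by auto
      then obtain x y where x: "x \<in> W0" "x \<notin> W1" and y: "y \<in> W1" "y \<notin> W0" by blast
      let ?D = "W0 \<inter> W1"
      have D: "complex_subspace J ?D"
        using iso0(1) iso1(1) by (auto simp: complex_subspace_def intro: subspace_inter)
      obtain A c where A: "A \<in> Aut J g" "c \<noteq> 0" "A x = jscale J c y" "\<And>d. d \<in> ?D \<Longrightarrow> A d = d"
        by (rule move[of x y ?D]) (use x y D iso0(3) iso1(3) in auto)
      note WA = isotropic_subspace_image[OF A(1) less.prems(1)]
      note WA' = isotropic_subspaceD[OF WA(1)]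
      have "y = jscale J (inverse c) (A x)" using A(2,3) by simp
      then have yA: "y \<in> A ` W0"
        using C.subspace_scale[OF WA'(1)[unfolded complex_subspace_iff]] x(1) by blast
      have DA: "?D \<subseteq> A ` W0" using A(4) by (metis IntD1 image_eqI subsetI)
      have "?D \<subset> A ` W0 \<inter> W1" using DA yA y by blast
      then have "dim ?D < dim (A ` W0 \<inter> W1)"
        using iso0(2) iso1(2) WA'(2) by (intro dim_psubset) (simp add: span_eq_iff[THEN iffD2] subspace_inter)
      moreover have "dim (A ` W0 \<inter> W1) \<le> dim W1" by (intro dim_subset) auto
      ultimately have "dim W1 - dim (A ` W0 \<inter> W1) < dim W1 - dim ?D" by linarith
      from less.hyps[OF this WA(1) less.prems(2)] WA(2) less.prems(3)
      obtain B where "B \<in> Aut J g" "B ` A ` W0 = W1" by auto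
      then show ?thesis using Aut_compose[OF _ A(1)] by (intro bexI[of _ "\<lambda>x. B (A x)"]) (auto simp: image_image)
    qed
  qed
  then show thesis using that by blast
qed

end

section \<open>Signature\<close>

locale pseudo_hermitian_basis = pseudo_hermitian_space J g
  for J :: "'v::euclidean_space \<Rightarrow> 'v" and g :: "'v \<Rightarrow> 'v \<Rightarrow> real" +
  fixes p q :: nat and e :: "nat \<Rightarrow> 'v"
  assumes orthonormal: "\<And>i j. i < p + q \<Longrightarrow> j < p + q \<Longrightarrow>
      g (e i) (e j) = (if i = j then signature_sign p i else 0) \<and> omega J g (e i) (e j) = 0"
    and spanning: "cspan J (e ` {..<p + q}) = UNIV"
begin

abbreviation sgn_c :: "nat \<Rightarrow> complex" where "sgn_c \<equiv> signature_sign p"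

lemma sgn_c_simps [simp]: "cnj (sgn_c i) = sgn_c i" "sgn_c i * sgn_c i = 1" "sgn_c i * (sgn_c i * x) = x"
  "complex_of_real (signature_sign p i) = sgn_c i"
  by (auto simp: signature_sign_def)

lemma theta_e:
  assumes "i < p + q" "j < p + q" shows "theta (e i) (e j) = (if i = j then \<i> * sgn_c i else 0)"
  using orthonormal[OF assms] by (auto simp: theta_def omega_def complex_eq_iff signature_sign_def)

text \<open>The scalar in front is the inverse of
  \<open>theta (e i) (e i) = \<i> * sgn_c i\<close>.\<close>

definition coord :: "nat \<Rightarrow> 'v \<Rightarrow> complex" where
  "coord i x = - \<i> * sgn_c i * theta x (e i)"

lemma coord_simps [simp]:
  "coord i 0 = 0" "coord i (x + y) = coord i x + coord i y" "coord i (x - y) = coord i x - coord i y"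
  "coord i (r *\<^sub>R x) = r *\<^sub>R coord i x" "coord i (J x) = \<i> * coord i x" "coord i (jscale J c x) = c * coord i x"
  by (simp_all add: coord_def algebra_simps)

lemma coord_sum: "coord i (\<Sum>l\<in>I. f l) = (\<Sum>l\<in>I. coord i (f l))"
  by (induction I rule: infinite_finite_induct) auto

lemma coord_e: "i < p + q \<Longrightarrow> j < p + q \<Longrightarrow> coord i (e j) = (if i = j then 1 else 0)"
  by (auto simp: coord_def theta_e signature_sign_def)

lemma cindep_e: "cindep (p + q) e"
  unfolding cindep_def
proof (intro allI impI)
  fix c i assume "(\<Sum>i<p + q. jscale J (c i) (e i)) = 0" "i < p + q"
  then have "coord i (\<Sum>j<p + q. jscale J (c j) (e j)) = 0" by simp
  moreover have "coord i (\<Sum>j<p + q. jscale J (c j) (e j)) = (\<Sum>j<p + q. if i = j then c j else 0)"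
    unfolding coord_sum using \<open>i < p + q\<close> by (intro sum.cong) (auto simp: coord_e)
  ultimately show "c i = 0" using \<open>i < p + q\<close> by simp
qed

lemma coord_expansion: "x = (\<Sum>i<p + q. jscale J (coord i x) (e i))"
proof -
  have "x \<in> cspan J (e ` {..<p + q})" using spanning by simp
  then obtain u where u: "x = (\<Sum>v\<in>e ` {..<p + q}. jscale J (u v) v)"
    using C.span_finite[of "e ` {..<p + q}"] by auto
  then have x: "x = (\<Sum>i<p + q. jscale J (u (e i)) (e i))"
    by (simp add: sum.reindex[OF cindep_inj[OF cindep_e]])
  have "coord i x = u (e i)" if "i < p + q" for i
  proof -
    have "coord i x = (\<Sum>j<p + q. if i = j then u (e j) else 0)"
      unfolding x coord_sum using that by (intro sum.cong) (auto simp: coord_e)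
    then show ?thesis using that by simp
  qed
  with x show ?thesis by simp
qed

lemma coord_eqI: "(\<And>i. i < p + q \<Longrightarrow> coord i x = coord i y) \<Longrightarrow> x = y"
  using coord_expansion[of x] coord_expansion[of y] by simp

lemma theta_coord: "theta x y = \<i> * (\<Sum>i<p + q. sgn_c i * coord i x * cnj (coord i y))"
proof -
  have "theta (e i) y = \<i> * sgn_c i * cnj (coord i y)" if "i < p + q" for i
    using theta_swap[of "e i" y] by (simp add: coord_def algebra_simps)
  then have "(\<Sum>i<p + q. coord i x * theta (e i) y) = \<i> * (\<Sum>i<p + q. sgn_c i * coord i x * cnj (coord i y))"
    by (simp add: sum_distrib_left algebra_simps)
  moreover have "theta x y = (\<Sum>i<p + q. coord i x * theta (e i) y)"
    using arg_cong[OF coord_expansion[of x], of "\<lambda>x. theta x y"] by (simp add: theta_sum)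
  ultimately show ?thesis by simp
qed

lemma dim_V: "DIM('v) = 2 * (p + q)"
  using dim_cspan_independent[OF cindep_independent[OF cindep_e]] card_image[OF cindep_inj[OF cindep_e]]
  by (simp add: spanning)

text \<open>On the span of basis vectors of one sign the Hermitian form is definite, so an isotropic
  subspace meets it only in zero and the two dimensions add up inside \<open>V\<close>.\<close>

lemma isotropic_dim_le_aux:
  assumes W: "isotropic_subspace W" and I: "I \<subseteq> {..<p + q}" and s: "\<And>i. i \<in> I \<Longrightarrow> sgn_c i = \<epsilon>" "\<epsilon> \<noteq> 0"
  shows "dim W + 2 * card I \<le> 2 * (p + q)"
proof -
  have fin: "finite I" using I finite_subset by blast
  have inj: "inj_on e I" using cindep_inj[OF cindep_e] I inj_on_subset by blast
  have ind: "C.independent (e ` I)"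
    using cindep_independent[OF cindep_e] I by (meson C.independent_mono image_mono)
  let ?V = "cspan J (e ` I)"
  have sV: "subspace ?V" using complex_subspace_cspan by (simp add: complex_subspace_def)
  have "x = 0" if x: "x \<in> W" "x \<in> ?V" for x
  proof -
    obtain u where u: "x = (\<Sum>v\<in>e ` I. jscale J (u v) v)"
      using x(2) C.span_finite[of "e ` I"] fin by auto
    have c0: "coord i x = 0" if "i < p + q" "i \<notin> I" for i
    proof -
      have "coord i (e l) = 0" if "l \<in> I" for l
        using coord_e[of i l] that \<open>i \<notin> I\<close> \<open>i < p + q\<close> I by auto
      then show ?thesis unfolding u coord_sum by (intro sum.neutral) auto
    qed
    have "0 = theta x x" using isotropic_subspaceD(3)[OF W] x by simp
    also have "\<dots> = \<i> * (\<Sum>i<p + q. \<epsilon> * complex_of_real ((cmod (coord i x))\<^sup>2))"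
      unfolding theta_coord using c0 s(1) by (intro arg_cong[where f = "\<lambda>z. \<i> * z"] sum.cong refl)
        (metis complex_norm_square lessThan_iff mult.assoc mult_zero_left mult_zero_right)
    also have "\<dots> = \<i> * \<epsilon> * complex_of_real (\<Sum>i<p + q. (cmod (coord i x))\<^sup>2)"
      by (simp add: sum_distrib_left mult.assoc)
    finally have "(\<Sum>i<p + q. (cmod (coord i x))\<^sup>2) = 0" using s(2) by (simp del: of_real_sum)
    then have "coord i x = 0" if "i < p + q" for i using that by (simp add: sum_nonneg_eq_0_iff)
    then show ?thesis by (intro coord_eqI) simp
  qed
  then have "W \<inter> ?V = {0}" using isotropic_subspaceD(2)[OF W] sV subspace_0 by blast
  then have "dim {x + y |x y. x \<in> W \<and> y \<in> ?V} = dim W + dim ?V"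
    using dim_sums_Int[OF isotropic_subspaceD(2)[OF W] sV] by simp
  moreover have "dim {x + y |x y. x \<in> W \<and> y \<in> ?V} \<le> 2 * (p + q)"
    using dim_subset_UNIV[of "{x + y |x y. x \<in> W \<and> y \<in> ?V}"] dim_V by simp
  moreover have "dim ?V = 2 * card I" using dim_cspan_independent[OF ind] card_image[OF inj] by simp
  ultimately show ?thesis by simp
qed

lemma isotropic_dim_le:
  assumes W: "isotropic_subspace W" shows "dim W \<le> 2 * min p q"
proof -
  have "dim W + 2 * card {p..<p + q} \<le> 2 * (p + q)"
    by (rule isotropic_dim_le_aux[OF W, of _ "-1"]) (auto simp: signature_sign_def)
  moreover have "dim W + 2 * card {..<p} \<le> 2 * (p + q)"
    by (rule isotropic_dim_le_aux[OF W, of _ 1]) (auto simp: signature_sign_def)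
  ultimately show ?thesis by simp
qed

text \<open>For \<open>i\<close> below both \<open>p\<close> and \<open>q\<close> the vectors
  \<open>e i\<close> and \<open>e (p + i)\<close> have opposite signs, so their sum is null.\<close>

definition std_isotropic :: "nat \<Rightarrow> 'v set" where
  "std_isotropic k = cspan J ((\<lambda>i. e i + e (p + i)) ` {..<k})"

lemma std_isotropic:
  assumes "k \<le> min p q"
  shows "isotropic_subspace (std_isotropic k)" "dim (std_isotropic k) = 2 * k"
proof -
  let ?f = "\<lambda>i. e i + e (p + i)"
  have t: "theta (?f i) (?f j) = 0" if "i < k" "j < k" for i j
    using that assms by (auto simp: theta_e signature_sign_def)
  have sub: "C.subspace {x. \<forall>y\<in>Y. theta x y = 0}" "C.subspace {y. \<forall>x\<in>Y. theta x y = 0}" for Y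
    by (auto simp: C.subspace_def)
  have "std_isotropic k \<subseteq> {x. \<forall>y\<in>?f ` {..<k}. theta x y = 0}"
    unfolding std_isotropic_def using t by (intro C.span_minimal sub) auto
  then have "?f ` {..<k} \<subseteq> {y. \<forall>x\<in>std_isotropic k. theta x y = 0}" by blast
  then have "std_isotropic k \<subseteq> {y. \<forall>x\<in>std_isotropic k. theta x y = 0}"
    by (subst std_isotropic_def) (intro C.span_minimal sub)
  then show "isotropic_subspace (std_isotropic k)"
    unfolding isotropic_subspace_def std_isotropic_def using complex_subspace_cspan by blast
  have ind: "cindep k ?f"
    unfolding cindep_def
  proof (intro allI impI)
    fix c i assume c: "(\<Sum>i<k. jscale J (c i) (?f i)) = 0" "i < k"
    then have "coord i (\<Sum>j<k. jscale J (c j) (?f j)) = 0" by simp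
    moreover have "coord i (\<Sum>j<k. jscale J (c j) (?f j)) = (\<Sum>j<k. if i = j then c j else 0)"
      unfolding coord_sum using c(2) assms by (intro sum.cong) (auto simp: coord_e)
    ultimately show "c i = 0" using c(2) by simp
  qed
  show "dim (std_isotropic k) = 2 * k"
    unfolding std_isotropic_def
    using dim_cspan_independent[OF cindep_independent[OF ind]] card_image[OF cindep_inj[OF ind]] by simp
qed

lemma max_isotropic_cdim_eq: "max_isotropic_cdim J g = min p q"
proof -
  let ?X = "{cdim J W |W. complex_subspace J W \<and> isotropic (omega J g) W}"
  have le: "k \<le> min p q" if k: "k \<in> ?X" for k
  proof -
    obtain W where W: "k = cdim J W" "isotropic_subspace W" using k isotropic_subspace_iff by blast
    then show ?thesis using isotropic_dim_le[OF W(2)] dim_eq_cdim[OF isotropic_subspaceD(1)[OF W(2)]] by simp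
  qed
  moreover have "min p q \<in> ?X"
  proof -
    note s = std_isotropic[OF order_refl]
    have "cdim J (std_isotropic (min p q)) = min p q"
      using s dim_eq_cdim[OF isotropic_subspaceD(1)[OF s(1)]] by simp
    then show ?thesis using s(1) isotropic_subspace_iff by force
  qed
  moreover have "finite ?X" using le by (intro finite_subset[of ?X "{..min p q}"]) (auto simp del: min.bounded_iff)
  ultimately show ?thesis unfolding max_isotropic_cdim_def by (intro Max_eqI)
qed

text \<open>By transitivity it is enough to extend the standard subspace, which its next generator
  does.\<close>

lemma isotropic_extension:
  assumes W: "isotropic_subspace W" "dim W = 2 * j" and j: "j < min p q"
  obtains w where "w \<notin> W" "isotropic_subspace (cspan J (insert w W))"
proof -
  note s = std_isotropic[of j] and s' = std_isotropic[of "Suc j"]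
  obtain A where A: "A \<in> Aut J g" "A ` std_isotropic j = W"
    using Aut_transitive[OF s(1) W(1)] s(2) W(2) j by auto
  have sub: "std_isotropic j \<subseteq> std_isotropic (Suc j)"
    unfolding std_isotropic_def by (intro C.span_mono image_mono) auto
  let ?w = "e j + e (p + j)"
  have w: "?w \<in> std_isotropic (Suc j)" unfolding std_isotropic_def by (intro C.span_base) auto
  have w': "?w \<notin> std_isotropic j"
  proof
    assume "?w \<in> std_isotropic j"
    then have "std_isotropic (Suc j) = std_isotropic j"
      unfolding std_isotropic_def by (simp add: lessThan_Suc C.span_redundant)
    then show False using s(2) s'(2) j by simp
  qed
  note i = isotropic_subspace_image[OF A(1) s'(1)]
  have c: "cspan J (insert (A ?w) W) \<subseteq> A ` std_isotropic (Suc j)"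
    using A(2) sub w isotropic_subspaceD(1)[OF i(1)] j
    by (intro C.span_minimal) (auto simp: complex_subspace_iff)
  show thesis
  proof (rule that[of "A ?w"])
    show "A ?w \<notin> W" unfolding A(2)[symmetric] using w' inj_image_mem_iff[OF bij_is_inj[OF AutD(2)[OF A(1)]]] by simp
    show "isotropic_subspace (cspan J (insert (A ?w) W))"
      using c isotropic_subspaceD(3)[OF i(1)] j complex_subspace_cspan
      unfolding isotropic_subspace_def by (meson Suc_leI subset_iff)
  qed
qed

section \<open>Isometries as pseudo-unitary matrices\<close>

definition matrix_of :: "('v \<Rightarrow> 'v) \<Rightarrow> nat \<Rightarrow> nat \<Rightarrow> complex" where
  "matrix_of A i j = (if i < p + q \<and> j < p + q then coord i (A (e j)) else 0)"

lemma coord_clin: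
  assumes "clin A" shows "coord i (A x) = (\<Sum>j<p + q. coord j x * coord i (A (e j)))"
proof -
  have "A x = A (\<Sum>j<p + q. jscale J (coord j x) (e j))" using coord_expansion by metis
  also have "\<dots> = (\<Sum>j<p + q. jscale J (coord j x) (A (e j)))"
    by (simp add: linear_sum[OF clinD(1)[OF assms]] clin_simps[OF assms])
  finally show ?thesis by (simp add: coord_sum)
qed

lemma matrix_of_U:
  assumes A: "A \<in> Aut J g" shows "matrix_of A \<in> carrier (U_group p q)"
proof -
  have "(\<Sum>l<p + q. cnj (matrix_of A l i) * sgn_c l * matrix_of A l j) = (if i = j then sgn_c i else 0)"
    if ij: "i < p + q" "j < p + q" for i j
  proof -
    \<comment> \<open>The indices appear reversed in \<open>theta\<close> because its second
      argument is the conjugate-linear one.\<close>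
    have "\<i> * (\<Sum>l<p + q. cnj (matrix_of A l i) * sgn_c l * matrix_of A l j) = theta (A (e j)) (A (e i))"
      unfolding theta_coord using ij by (intro arg_cong[where f = "\<lambda>z. \<i> * z"] sum.cong) (auto simp: matrix_of_def)
    also have "\<dots> = \<i> * (if i = j then sgn_c i else 0)" using AutD(4)[OF A] ij by (simp add: theta_e)
    finally show ?thesis by (simp only: mult_cancel_left) simp
  qed
  then show ?thesis by (simp add: U_group_def) (simp add: matrix_of_def)
qed

lemma Aut_group_iso_U_group: "Aut_group J g \<cong> U_group p q"
proof -
  have "matrix_of \<in> iso (Aut_group J g) (U_group p q)"
  proof (rule isoI)
    show "matrix_of \<in> hom (Aut_group J g) (U_group p q)"
    proof (rule homI)
      fix A B assume AB: "A \<in> carrier (Aut_group J g)" "B \<in> carrier (Aut_group J g)"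
      then have c: "clin A" using AutD(1) by (auto simp: Aut_group_def)
      have "matrix_of (A \<circ> B) i j = (\<Sum>l<p + q. matrix_of A i l * matrix_of B l j)" for i j
        using coord_clin[OF c, of i "B (e j)"]
        by (auto simp: matrix_of_def mult.commute intro!: sum.cong sum.neutral)
      then show "matrix_of (A \<otimes>\<^bsub>Aut_group J g\<^esub> B) = matrix_of A \<otimes>\<^bsub>U_group p q\<^esub> matrix_of B"
        by (auto simp: Aut_group_def U_group_def fun_eq_iff)
    qed (simp add: matrix_of_U Aut_group_def)
    show "bij_betw matrix_of (carrier (Aut_group J g)) (carrier (U_group p q))"
    proof (rule bij_betw_imageI)
      show "inj_on matrix_of (carrier (Aut_group J g))"
      proof (rule inj_onI, rule ext, rule coord_eqI)
        fix A B x i assume AB: "A \<in> carrier (Aut_group J g)" "B \<in> carrier (Aut_group J g)" "matrix_of A = matrix_of B"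
          and i: "i < p + q"
        then have c: "clin A" "clin B" using AutD(1) by (auto simp: Aut_group_def)
        have "coord i (A (e j)) = coord i (B (e j))" if "j < p + q" for j
          using fun_cong[OF fun_cong[OF AB(3)], of i j] i that by (simp add: matrix_of_def)
        then show "coord i (A x) = coord i (B x)" unfolding coord_clin[OF c(1), of i x] coord_clin[OF c(2), of i x] by simp
      qed
      show "matrix_of ` carrier (Aut_group J g) = carrier (U_group p q)"
      proof (intro equalityI subsetI)
        fix M assume M: "M \<in> carrier (U_group p q)"
        define A where "A x = (\<Sum>i<p + q. jscale J (\<Sum>j<p + q. M i j * coord j x) (e i))" for x
        have cA: "coord i (A x) = (\<Sum>j<p + q. M i j * coord j x)" if "i < p + q" for i x
        proof -
          have "coord i (A x) = (\<Sum>l<p + q. if i = l then (\<Sum>j<p + q. M i j * coord j x) else 0)"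
            unfolding A_def coord_sum using that by (intro sum.cong) (auto simp: coord_e)
          then show ?thesis using that by simp
        qed
        have clA: "clin A"
          by (rule clinI; rule coord_eqI) (simp_all add: cA algebra_simps sum.distrib sum_distrib_left scaleR_sum_right)
        have UM: "(\<Sum>l<p + q. cnj (M l i) * sgn_c l * M l j) = (if i = j then sgn_c i else 0)" if "i < p + q" "j < p + q" for i j
          using M that by (simp add: U_group_def)
        \<comment> \<open>Expanding in coordinates isolates a sum over \<open>l\<close>, which is
          the defining relation of the matrix group; the imaginary part of \<open>theta\<close> then
          gives \<open>g\<close>.\<close>
        have "theta (A x) (A y) = theta x y" for x y
        proof -
          have "theta (A x) (A y) = \<i> * (\<Sum>l<p + q. \<Sum>j<p + q. \<Sum>k<p + q. sgn_c l * (M l j * coord j x) * cnj (M l k * coord k y))"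
            unfolding theta_coord
            by (intro arg_cong[where f = "\<lambda>z. \<i> * z"] sum.cong refl)
              (simp only: cA lessThan_iff cnj_sum mult.assoc sum_product, simp only: sum_distrib_left)
          also have "(\<Sum>l<p + q. \<Sum>j<p + q. \<Sum>k<p + q. sgn_c l * (M l j * coord j x) * cnj (M l k * coord k y))
            = (\<Sum>j<p + q. \<Sum>k<p + q. \<Sum>l<p + q. sgn_c l * (M l j * coord j x) * cnj (M l k * coord k y))"
            by (subst sum.swap) (intro sum.cong refl sum.swap)
          also have "\<dots> = (\<Sum>j<p + q. \<Sum>k<p + q. (coord j x * cnj (coord k y)) * (\<Sum>l<p + q. cnj (M l k) * sgn_c l * M l j))"
            by (simp add: sum_distrib_left algebra_simps)
          also have "\<dots> = (\<Sum>j<p + q. \<Sum>k<p + q. if k = j then sgn_c j * coord j x * cnj (coord j y) else 0)"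
            by (intro sum.cong refl) (auto simp: UM)
          also have "\<dots> = (\<Sum>j<p + q. sgn_c j * coord j x * cnj (coord j y))"
            by (intro sum.cong refl) simp
          finally show ?thesis by (simp add: theta_coord)
        qed
        then have "g (A x) (A y) = g x y" for x y by (metis theta_def complex.sel(2))
        then have "A \<in> Aut J g" using clA by (intro AutI)
        moreover have "M = matrix_of A"
        proof (intro ext)
          fix i j
          show "M i j = matrix_of A i j"
          proof (cases "i < p + q \<and> j < p + q")
            case True
            have "matrix_of A i j = (\<Sum>l<p + q. M i l * coord l (e j))" using True by (simp add: matrix_of_def cA)
            also have "\<dots> = (\<Sum>l<p + q. if j = l then M i l else 0)"
              using True by (intro sum.cong) (auto simp: coord_e)
            finally show ?thesis using True by simp
          next
            case False
            then show ?thesis using M by (auto simp: matrix_of_def U_group_def)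
          qed
        qed
        ultimately show "M \<in> matrix_of ` carrier (Aut_group J g)" by (auto simp: Aut_group_def)
      qed (auto simp: matrix_of_U Aut_group_def)
    qed
  qed
  then show ?thesis unfolding is_iso_def by blast
qed

end

section \<open>Projectors onto supports and the stratification\<close>

definition orth_proj :: "('v::euclidean_space \<Rightarrow>\<^sub>L 'v) \<Rightarrow> 'v set \<Rightarrow> bool" where
  "orth_proj P W \<longleftrightarrow> (\<forall>x. P x \<in> W \<and> (\<forall>w\<in>W. (x - P x) \<bullet> w = 0))"

lemma orth_projD:
  assumes "orth_proj P W" "subspace W"
  shows "P x \<in> W" "w \<in> W \<Longrightarrow> (x - P x) \<bullet> w = 0" "w \<in> W \<Longrightarrow> P w = w" "P o\<^sub>L P = P" "P x \<bullet> y = x \<bullet> P y" "range P = W"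
proof -
  show 1: "P x \<in> W" "w \<in> W \<Longrightarrow> (x - P x) \<bullet> w = 0" for x w using assms(1) by (auto simp: orth_proj_def)
  show 2: "P w = w" if "w \<in> W" for w
  proof -
    have "w - P w \<in> W" using assms(2) that 1(1) by (rule subspace_diff)
    from 1(2)[OF this, of w] show ?thesis by simp
  qed
  show "P o\<^sub>L P = P" using 1 2 by (intro blinfun_eqI) simp
  have "P x \<bullet> y = P x \<bullet> P y" for x y
    using 1(2)[OF 1(1), of y x] unfolding inner_diff_left by (simp add: inner_commute[of "P x"])
  then show "P x \<bullet> y = x \<bullet> P y" by (metis inner_commute)
  show "range P = W" using 1(1) 2 by (auto intro: image_eqI[OF sym])
qed

lemma orth_proj_unique:
  assumes "orth_proj P W" "orth_proj Q W" "subspace W" shows "P = Q"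
proof (rule blinfun_eqI)
  note P = orth_projD[OF assms(1,3)] and Q = orth_projD[OF assms(2,3)]
  fix x
  have "P x - Q x \<in> W" using P(1) Q(1) assms(3) by (intro subspace_diff)
  then have "(x - Q x) \<bullet> (P x - Q x) - (x - P x) \<bullet> (P x - Q x) = 0" using P(2) Q(2) by simp
  then have "(P x - Q x) \<bullet> (P x - Q x) = 0" by (simp add: algebra_simps)
  then show "P x = Q x" by simp
qed

lemma orth_projI:
  assumes "P o\<^sub>L P = P" "\<And>x y. blinfun_apply P x \<bullet> y = x \<bullet> blinfun_apply P y"
  shows "orth_proj P (range P)"
  unfolding orth_proj_def
proof (intro allI conjI ballI)
  fix x w assume "w \<in> range P"
  then obtain y where "w = P y" by blast
  moreover have "P (P x) = P x" using assms(1) by (metis blinfun_apply_blinfun_compose)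
  ultimately show "(x - P x) \<bullet> w = 0" by (simp add: assms(2)[symmetric] blinfun.diff_right)
qed auto

text \<open>Dividing by \<open>r \<bullet> r\<close> avoids square roots, so the formula is rational
  in the vectors. A dependent vector has residue zero and contributes nothing, as
  \<open>inverse 0 = 0\<close>; the projector onto the span results for every list.\<close>

primrec gram_schmidt :: "'v::euclidean_space list \<Rightarrow> 'v \<Rightarrow>\<^sub>L 'v" where
  "gram_schmidt [] = 0"
| "gram_schmidt (v # vs) =
     (let r = v - gram_schmidt vs v
      in gram_schmidt vs + inverse (r \<bullet> r) *\<^sub>R (blinfun_scaleR_left r o\<^sub>L blinfun_inner_left r))"

lemma gram_schmidt_orth_proj: "orth_proj (gram_schmidt vs) (span (set vs))"
proof (induction vs)
  case (Cons v vs)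
  let ?P = "gram_schmidt vs" and ?W = "span (set vs)"
  note P = orth_projD[OF Cons subspace_span]
  define r where "r = v - ?P v"
  have app: "gram_schmidt (v # vs) x = ?P x + ((x \<bullet> r) / (r \<bullet> r)) *\<^sub>R r" for x
    by (simp add: Let_def r_def blinfun.add_left blinfun.scaleR_left blinfun_inner_left.rep_eq divide_inverse mult.commute)
  have sub: "?W \<subseteq> span (set (v # vs))" by (intro span_mono) auto
  have rW: "r \<bullet> w = 0" if "w \<in> ?W" for w using P(2)[OF that] by (simp add: r_def)
  have rin: "r \<in> span (set (v # vs))"
    unfolding r_def by (rule span_diff[OF span_base subsetD[OF sub P(1)]]) simp
  show ?case
    unfolding orth_proj_def
  proof (intro allI conjI ballI)
    fix x w
    show "gram_schmidt (v # vs) x \<in> span (set (v # vs))"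
      unfolding app by (rule span_add[OF subsetD[OF sub P(1)] span_scale[OF rin]])
    have r0: "(x - gram_schmidt (v # vs) x) \<bullet> r = 0"
    proof (cases "r = 0")
      case False
      moreover have "?P x \<bullet> r = 0" using rW[OF P(1), of x] by (simp only: inner_commute)
      ultimately show ?thesis unfolding app by (simp add: inner_diff_left inner_add_left)
    qed simp
    have W0: "(x - gram_schmidt (v # vs) x) \<bullet> w = 0" if "w \<in> ?W" for w
      using P(2)[OF that, of x] rW[OF that] unfolding app by (simp add: inner_diff_left inner_add_left)
    have "v = r + ?P v" by (simp add: r_def)
    then have "(x - gram_schmidt (v # vs) x) \<bullet> v = 0"
      using r0 W0[OF P(1)] by (metis add_0 inner_add_right)
    moreover have "(x - gram_schmidt (v # vs) x) \<bullet> w = 0" if "w \<in> set vs" for w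
      using W0 span_base[OF that] by blast
    ultimately have "span (set (v # vs)) \<subseteq> {w. (x - gram_schmidt (v # vs) x) \<bullet> w = 0}"
      by (intro span_minimal) (auto simp: subspace_def inner_add_right)
    then show "w \<in> span (set (v # vs)) \<Longrightarrow> (x - gram_schmidt (v # vs) x) \<bullet> w = 0" by blast
  qed
qed (simp add: orth_proj_def blinfun.zero_left)

lemma gram_schmidt_residue: "v - gram_schmidt vs v = 0 \<longleftrightarrow> v \<in> span (set vs)"
proof
  note P = orth_projD(1,3)[OF gram_schmidt_orth_proj[of vs] subspace_span]
  show "v \<in> span (set vs)" if "v - gram_schmidt vs v = 0"
    using P(1)[of v] that by simp
  show "v - gram_schmidt vs v = 0" if "v \<in> span (set vs)"
    using P(2)[OF that] by simp
qed

text \<open>Linear independence of a list, read from its tail in the order in which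
  \<open>gram_schmidt\<close> consumes it; it says that every residue is nonzero.\<close>

primrec lindep_free :: "'v::euclidean_space list \<Rightarrow> bool" where
  "lindep_free [] \<longleftrightarrow> True"
| "lindep_free (v # vs) \<longleftrightarrow> v \<notin> span (set vs) \<and> lindep_free vs"

lemma dim_lindep_free: "lindep_free vs \<Longrightarrow> dim (set vs) = length vs"
  by (induction vs) (auto simp: dim_insert)

lemma lindep_free_independent: "independent (set vs) \<Longrightarrow> distinct vs \<Longrightarrow> lindep_free vs"
  by (induction vs) (auto simp: independent_insert)

text \<open>The argument pairs are independent of \<open>S\<close>, so these values of
  \<open>S\<close> vary linearly with it.\<close>

definition samples :: "'v::euclidean_space bil \<Rightarrow> ('v \<times> 'v) list \<Rightarrow> 'v list" where
  "samples S ps = map (\<lambda>(X, Y). app2 S X Y) ps"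

lemma samples_simps: "samples S [] = []" "samples S (z # ps) = app2 S (fst z) (snd z) # samples S ps"
  "length (samples S ps) = length ps"
  by (auto simp: samples_def split: prod.splits)

lemma set_samples_subset_supp: "span (set (samples S ps)) \<subseteq> supp S"
  by (intro span_minimal subspace_supp) (auto simp: samples_def app2_in_supp)

lemma obtain_sample_basis:
  obtains ps where "lindep_free (samples S ps)" "span (set (samples S ps)) = supp S" "length ps = dim (supp S)"
proof -
  let ?X = "{app2 S X Y |X Y. True}"
  obtain B where B: "B \<subseteq> ?X" "independent B" "?X \<subseteq> span B" using maximal_independent_subset by blast
  have sB: "span B = supp S" unfolding supp_def using B(1,3) by (metis span_mono span_span subset_antisym)
  obtain vs where vs: "set vs = B" "distinct vs" using finite_distinct_list independent_bound[OF B(2)] by blast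
  have "\<forall>v\<in>B. \<exists>z. v = app2 S (fst z) (snd z)" using B(1) by fastforce
  then obtain z where z: "\<And>v. v \<in> B \<Longrightarrow> v = app2 S (fst (z v)) (snd (z v))" by metis
  have "samples S (map z vs) = vs" using z vs(1) by (auto simp: samples_def split_def intro!: map_idI)
  moreover have "length vs = dim (supp S)"
    using vs B(2) sB by (metis distinct_card dim_span dim_eq_card_independent)
  ultimately show thesis
    using that[of "map z vs"] lindep_free_independent[of vs] vs B(2) sB by simp
qed

lemma gram_schmidt_smooth:
  assumes "lindep_free (samples S0 ps)"
  obtains U where "open U" "S0 \<in> U" "smooth_on U (\<lambda>S. gram_schmidt (samples S ps))"
    "\<And>S. S \<in> U \<Longrightarrow> lindep_free (samples S ps)"
proof -
  have "\<exists>U. open U \<and> S0 \<in> U \<and> smooth_on U (\<lambda>S. gram_schmidt (samples S ps)) \<and> (\<forall>S\<in>U. lindep_free (samples S ps))"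
    using assms
  proof (induction ps)
    case Nil
    show ?case by (intro exI[of _ UNIV]) (auto simp: samples_simps intro: smooth_on_const)
  next
    case (Cons z ps)
    then obtain U where U: "open U" "S0 \<in> U" "smooth_on U (\<lambda>S. gram_schmidt (samples S ps))"
      "\<And>S. S \<in> U \<Longrightarrow> lindep_free (samples S ps)" by (auto simp: samples_simps)
    define r where "r S = app2 S (fst z) (snd z) - gram_schmidt (samples S ps) (app2 S (fst z) (snd z))" for S :: "'a bil"
    have ev: "smooth_on V (\<lambda>S. app2 S (fst z) (snd z))" for V :: "'a bil set"
      by (rule smooth_on_bounded_linear[OF bounded_linear_app2 smooth_on_ident])
    have r: "smooth_on U r" unfolding r_def[abs_def] using U(3) ev by (intro smooth_on_diff smooth_on_blinfun_apply smooth_on_ident smooth_on_const) auto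
    \<comment> \<open>The only singularity of the next Gram-Schmidt step is a vanishing residue, and
      residues stay nonzero on an open set.\<close>
    define V where "V = {S\<in>U. r S \<in> - {0}}"
    have "open V" unfolding V_def
      using continuous_open_preimage[OF smooth_on_imp_continuous_on[OF r] U(1) open_Compl[OF closed_singleton]]
      by (simp add: vimage_def Int_def)
    have VU: "V \<subseteq> U" by (auto simp: V_def)
    have rV: "r S \<noteq> 0" if "S \<in> V" for S using that by (simp add: V_def)
    have "smooth_on V (\<lambda>S. gram_schmidt (samples S ps) + inverse (r S \<bullet> r S) *\<^sub>R (blinfun_scaleR_left (r S) o\<^sub>L blinfun_inner_left (r S)))"
      using smooth_on_subset[OF U(3) VU] smooth_on_subset[OF r VU] rV
      by (intro smooth_on_add smooth_on_scaleR smooth_on_inverse smooth_on_inner smooth_on_blinfun_compose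
          smooth_on_bounded_linear[OF bounded_linear_blinfun_scaleR_left]
          smooth_on_bounded_linear[OF bounded_linear_blinfun_inner_left]) auto
    then have "smooth_on V (\<lambda>S. gram_schmidt (samples S (z # ps)))" by (simp add: samples_simps Let_def r_def)
    moreover have "S0 \<in> V" using Cons.prems U(2) gram_schmidt_residue by (auto simp: V_def r_def samples_simps)
    moreover have "lindep_free (samples S (z # ps))" if "S \<in> V" for S
      using rV[OF that] U(4) VU that gram_schmidt_residue by (auto simp: r_def samples_simps)
    ultimately show ?case using \<open>open V\<close> by blast
  qed
  then show thesis using that by blast
qed

text \<open>Values of \<open>S0\<close> that form a basis of its support stay independent for nearby
  \<open>S\<close>, and they span a subspace of the support of \<open>S\<close>. This bounds the
  dimension from below, and equality of dimensions makes that subspace the whole support.\<close>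

lemma supp_projector_smooth:
  fixes S0 :: "'v::euclidean_space bil"
  obtains U F where "open U" "S0 \<in> U" "smooth_on U F" "\<And>S. S \<in> U \<Longrightarrow> dim (supp S0) \<le> dim (supp S)"
    "\<And>S. S \<in> U \<Longrightarrow> dim (supp S) = dim (supp S0) \<Longrightarrow> orth_proj (F S) (supp S)"
proof -
  obtain ps where ps: "lindep_free (samples S0 ps)" "span (set (samples S0 ps)) = supp S0" "length ps = dim (supp S0)"
    by (rule obtain_sample_basis)
  obtain U where U: "open U" "S0 \<in> U" "smooth_on U (\<lambda>S. gram_schmidt (samples S ps))"
    "\<And>S. S \<in> U \<Longrightarrow> lindep_free (samples S ps)" by (rule gram_schmidt_smooth[OF ps(1)]) blast
  have d: "dim (span (set (samples S ps))) = dim (supp S0)" if "S \<in> U" for S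
    using dim_lindep_free[OF U(4)[OF that]] ps(3) by (simp add: samples_simps)
  show thesis
  proof (rule that[OF U(1,2,3)])
    fix S assume S: "S \<in> U"
    show "dim (supp S0) \<le> dim (supp S)"
      using d[OF S] dim_subset[OF set_samples_subset_supp, of S ps] by simp
    assume "dim (supp S) = dim (supp S0)"
    then have "span (set (samples S ps)) = supp S"
      using d[OF S] by (intro subspace_dim_equal subspace_span subspace_supp set_samples_subset_supp) simp
    then show "orth_proj (gram_schmidt (samples S ps)) (supp S)" using gram_schmidt_orth_proj[of "samples S ps"] by simp
  qed
qed

section \<open>Closures of the strata\<close>

context pseudo_hermitian_basis
begin

lemma CJ_stratum_closure_Suc:
  assumes "Suc j \<le> min p q" shows "CJ_stratum J g j \<subseteq> closure (CJ_stratum J g (Suc j))"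
proof
  fix S assume "S \<in> CJ_stratum J g j"
  then have S: "S \<in> tensors" "isotropic_subspace (supp S)" "dim (supp S) = 2 * j" by (auto simp: CJ_stratum_eq)
  obtain w where w: "w \<notin> supp S" "isotropic_subspace (cspan J (insert w (supp S)))"
    using isotropic_extension[OF S(2,3)] assms by auto
  have c: "cspan J (supp S) = supp S"
    using complex_subspace_supp[OF S(1)] C.span_eq_iff complex_subspace_iff by blast
  have d: "dim (cspan J (insert w (supp S))) = 2 * Suc j"
    using dim_cspan_insert[of w "supp S"] w(1) S(3) by (simp add: c)
  have in_Suc: "S + r *\<^sub>R sprod w w w \<in> CJ_stratum J g (Suc j)" if "r \<noteq> 0" for r
    using S(1) w d supp_add_cube[OF S(1) w(1) that]
    by (auto simp: CJ_stratum_eq intro: tensors_closed sprod_tensors)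
  have "(\<lambda>n. S + inverse (real (Suc n)) *\<^sub>R sprod w w w) \<longlonglongrightarrow> S + 0 *\<^sub>R sprod w w w"
    by (intro tendsto_intros LIMSEQ_inverse_real_of_nat)
  then show "S \<in> closure (CJ_stratum J g (Suc j))"
    unfolding closure_sequential using in_Suc by (intro exI[of _ "\<lambda>n. S + inverse (real (Suc n)) *\<^sub>R sprod w w w"]) auto
qed

lemma CJ_stratum_closure: "j \<le> k \<Longrightarrow> k \<le> min p q \<Longrightarrow> CJ_stratum J g j \<subseteq> closure (CJ_stratum J g k)"
proof (induction k rule: dec_induct)
  case (step n)
  then have "CJ_stratum J g j \<subseteq> closure (CJ_stratum J g n)" by simp
  also have "\<dots> \<subseteq> closure (closure (CJ_stratum J g (Suc n)))"
    using step by (intro closure_mono CJ_stratum_closure_Suc)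
  finally show ?case by simp
qed (rule closure_subset)

lemma CJ_stratification: "stratification (CJ J g) (min p q) (CJ_stratum J g)"
  unfolding stratification_def
proof (intro conjI ballI impI)
  have le: "cdim J (supp S) \<le> min p q" if "S \<in> CJ J g" for S
    using that isotropic_dim_le[of "supp S"] dim_eq_cdim[OF complex_subspace_supp[of S]] by (auto simp: CJ_eq')
  show "CJ J g = (\<Union>k\<in>{0..min p q}. CJ_stratum J g k)"
    using le by (fastforce simp: CJ_stratum_def)
  fix k assume k: "k \<in> {0..min p q}"
  show "CJ_stratum J g j \<inter> CJ_stratum J g k = {}" if "j \<noteq> k" for j
    using that by (auto simp: CJ_stratum_def)
  show "CJ J g \<inter> closure (CJ_stratum J g k) = (\<Union>j\<in>{0..k}. CJ_stratum J g j)"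
  proof (intro equalityI subsetI)
    fix S assume S: "S \<in> CJ J g \<inter> closure (CJ_stratum J g k)"
    \<comment> \<open>Some tensor of the stratum lies in this neighbourhood of \<open>S\<close>, so
      semicontinuity bounds the support of \<open>S\<close> by that of the nearby tensor.\<close>
    obtain U F where U: "open U" "S \<in> U" "\<And>T. T \<in> U \<Longrightarrow> dim (supp S) \<le> dim (supp T)"
      by (rule supp_projector_smooth[of S]) blast
    obtain T where T: "T \<in> U" "T \<in> CJ_stratum J g k"
      using S U(1,2) by (auto simp: closure_iff_nhds_not_empty)
    have "dim (supp S) \<le> 2 * k" using U(3)[OF T(1)] T(2) by (simp add: CJ_stratum_eq)
    then have "cdim J (supp S) \<le> k" using S dim_eq_cdim[OF complex_subspace_supp[of S]] by (simp add: CJ_eq')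
    then show "S \<in> (\<Union>j\<in>{0..k}. CJ_stratum J g j)" using S by (auto simp: CJ_stratum_def)
  next
    fix S assume "S \<in> (\<Union>j\<in>{0..k}. CJ_stratum J g j)"
    then obtain j where j: "j \<le> k" "S \<in> CJ_stratum J g j" by auto
    then show "S \<in> CJ J g \<inter> closure (CJ_stratum J g k)"
      using CJ_stratum_closure[OF j(1)] k by (auto simp: CJ_stratum_def)
  qed
qed

end

section \<open>Strata as unions over isotropic subspaces and as total spaces\<close>

context pseudo_hermitian_space
begin

lemma cone_CJ: "cone (CJ J g)"
  unfolding cone_def
proof (intro ballI allI impI)
  fix S and c :: real assume S: "S \<in> CJ J g"
  have "supp (c *\<^sub>R S) \<subseteq> supp S"
    by (subst supp_subset_iff) (auto simp: subspace_supp bil_simps intro!: subspace_scale app2_in_supp)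
  with S show "c *\<^sub>R S \<in> CJ J g"
    by (auto simp: CJ_eq isotropic_def intro: tensors_closed)
qed

lemma S30_reg_Union: "(\<Union>W\<in>isotropic_grassmannian J g k. S30_reg J g W) = lift ` CJ_stratum J g k"
proof -
  have "S30_reg J g W = lift ` {S \<in> tensors. supp S = W}" if "W \<in> isotropic_grassmannian J g k" for W
    using that by (intro S30_reg_eq) (simp add: isotropic_grassmannian_def)
  then show ?thesis by (auto simp: stratum_eq_Union)
qed

lemma S30_reg_real_Union: "(\<Union>W\<in>isotropic_grassmannian J g k. S30_reg_real J g W) = CJ_stratum J g k"
proof -
  have "S30_reg_real J g W = {S \<in> tensors. supp S = W}" if "W \<in> isotropic_grassmannian J g k" for W
    using that by (intro S30_reg_real_eq) (simp add: isotropic_grassmannian_def)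
  then show ?thesis by (auto simp: stratum_eq_Union)
qed

lemma realify_diffeomorphism:
  "diffeomorphism (\<Union>W\<in>isotropic_grassmannian J g k. S30_reg J g W) (CJ_stratum J g k) realify"
  unfolding S30_reg_Union
  by (rule diffeomorphismI[where h = lift])
    (auto intro: smooth_map_linear[OF bounded_linear_realify] smooth_map_linear[OF bounded_linear_lift])

lemma isotropic_projD:
  assumes "P \<in> isotropic_proj J g k"
  shows "orth_proj P (range P)" "isotropic_subspace (range P)" "dim (range P) = 2 * k" "subspace (range P)"
proof -
  show "orth_proj P (range P)" using assms by (intro orth_projI) (auto simp: isotropic_proj_def)
  show "isotropic_subspace (range P)" "dim (range P) = 2 * k"
    using assms by (auto simp: isotropic_proj_def isotropic_grassmannian_eq)
  then show "subspace (range P)" by (simp add: isotropic_subspaceD)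
qed

lemma isotropic_projI:
  assumes "orth_proj P W" "isotropic_subspace W" "dim W = 2 * k"
  shows "P \<in> isotropic_proj J g k" "range P = W"
  using orth_projD[OF assms(1) isotropic_subspaceD(2)[OF assms(2)]] assms(2,3)
  by (auto simp: isotropic_proj_def isotropic_grassmannian_eq)

lemma S30_reg_proj: "P \<in> isotropic_proj J g k \<Longrightarrow> S30_reg J g (range P) = lift ` {S \<in> tensors. supp S = range P}"
  using isotropic_projD(2) by (intro S30_reg_eq) (auto simp: isotropic_subspace_def)

lemma S30_proj: "P \<in> isotropic_proj J g k \<Longrightarrow> S30 J g (range P) = lift ` tensors_in (range P)"
  using isotropic_projD(2) by (intro S30_eq) (auto simp: isotropic_subspace_def)

lemma supp_realify: "P \<in> isotropic_proj J g k \<Longrightarrow> T \<in> S30_reg J g (range P) \<Longrightarrow> supp (realify T) = range P"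
  by (auto simp: S30_reg_proj)

text \<open>The base point is recovered from the tensor as the projector onto its support, which is
  unique. Within a stratum the dimension of the support is constant, so the local formula of
  \<open>supp_projector_smooth\<close> computes it.\<close>

lemma bundle_diffeomorphism:
  "diffeomorphism (SIGMA P : isotropic_proj J g k. S30_reg J g (range (blinfun_apply P)))
     (CJ_stratum J g k) (\<lambda>(P, T). realify T)"
proof (rule diffeomorphismI[where h = "\<lambda>S. (THE P. orth_proj P (supp S), lift S)"])
  have ex: "\<exists>P. orth_proj P (supp S)" for S :: "'v bil"
    by (rule supp_projector_smooth[of S]) blast
  have the: "(THE P. orth_proj P (supp S)) = P" if "orth_proj P (supp S)" for P S
    using that orth_proj_unique subspace_supp by blast
  fix x assume x: "x \<in> (SIGMA P : isotropic_proj J g k. S30_reg J g (range (blinfun_apply P)))"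
  then obtain P S where PS: "P \<in> isotropic_proj J g k" "x = (P, lift S)" "S \<in> tensors" "supp S = range P"
    using S30_reg_proj by blast
  then show "(case x of (P, T) \<Rightarrow> realify T) \<in> CJ_stratum J g k"
    using isotropic_projD[OF PS(1)] by (simp add: CJ_stratum_eq)
  show "(THE P. orth_proj P (supp (case x of (P, T) \<Rightarrow> realify T)), lift (case x of (P, T) \<Rightarrow> realify T)) = x"
    using the[of P S] isotropic_projD(1)[OF PS(1)] by (simp add: PS)
next
  have ex: "\<exists>P. orth_proj P (supp S)" for S :: "'v bil"
    by (rule supp_projector_smooth[of S]) blast
  have the: "(THE P. orth_proj P (supp S)) = P" if "orth_proj P (supp S)" for P S
    using that orth_proj_unique subspace_supp by blast
  fix S assume S: "S \<in> CJ_stratum J g k"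
  then have S': "S \<in> tensors" "isotropic_subspace (supp S)" "dim (supp S) = 2 * k" by (auto simp: CJ_stratum_eq)
  obtain P where P: "orth_proj P (supp S)" using ex by blast
  show "(THE P. orth_proj P (supp S), lift S) \<in> (SIGMA P : isotropic_proj J g k. S30_reg J g (range (blinfun_apply P)))"
    using isotropic_projI[OF P S'(2,3)] S30_reg_proj[OF isotropic_projI(1)[OF P S'(2,3)]] S'(1)
    by (simp add: the[OF P])
  show "(case (THE P. orth_proj P (supp S), lift S) of (P, T) \<Rightarrow> realify T) = S" by simp
next
  have "bounded_linear (\<lambda>x :: ('v \<Rightarrow>\<^sub>L 'v) \<times> ('v \<times> 'v) bil. realify (snd x))"
    by (rule bounded_linear_compose[OF bounded_linear_realify bounded_linear_snd])
  then show "smooth_map (SIGMA P : isotropic_proj J g k. S30_reg J g (range (blinfun_apply P))) (\<lambda>(P, T). realify T)"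
    by (rule smooth_map_linear) auto
next
  show "smooth_map (CJ_stratum J g k) (\<lambda>S. (THE P. orth_proj P (supp S), lift S))"
  proof (rule smooth_mapI)
    fix S0 assume S0: "S0 \<in> CJ_stratum J g k"
    obtain U F where U: "open U" "S0 \<in> U" "smooth_on U F"
      "\<And>S. S \<in> U \<Longrightarrow> dim (supp S) = dim (supp S0) \<Longrightarrow> orth_proj (F S) (supp S)"
      by (rule supp_projector_smooth[of S0]) blast
    have "smooth_on U (\<lambda>S. (F S, lift S))"
      by (intro smooth_on_Pair U(3) smooth_on_bounded_linear[OF bounded_linear_lift] smooth_on_ident)
    moreover have "(F S, lift S) = (THE P. orth_proj P (supp S), lift S)" if "S \<in> CJ_stratum J g k \<inter> U" for S
    proof -
      have "orth_proj (F S) (supp S)" using that S0 by (intro U(4)) (auto simp: CJ_stratum_eq)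
      then have "(THE P. orth_proj P (supp S)) = F S"
        by (intro the_equality) (auto intro: orth_proj_unique subspace_supp)
      then show ?thesis by simp
    qed
    ultimately show "\<exists>U F. open U \<and> S0 \<in> U \<and> smooth_on U F \<and>
        (\<forall>S\<in>CJ_stratum J g k \<inter> U. F S = (THE P. orth_proj P (supp S), lift S))"
      using U(1,2) by (intro exI[of _ U] exI[of _ "\<lambda>S. (F S, lift S)"]) auto
  qed
qed

end

section \<open>Zariski open fibres\<close>

definition cform :: "'v::euclidean_space \<Rightarrow> 'v \<times> 'v \<Rightarrow> complex" where
  "cform b z = Complex (fst z \<bullet> b) (snd z \<bullet> b)"

lemma cform_simps [simp]:
  "cform b (x + y) = cform b x + cform b y" "cform b (x - y) = cform b x - cform b y"
  "cform b (r *\<^sub>R x) = r *\<^sub>R cform b x" "cform b (iC x) = \<i> * cform b x" "cform b (jscale iC c x) = c * cform b x"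
  by (auto simp: cform_def complex_eq_iff inner_add_left inner_diff_left iC_def jscale_def algebra_simps)

lemma cform_linear: "Vector_Spaces.linear (jscale iC) (*) (cform b)"
proof -
  have "vector_space ((*) :: complex \<Rightarrow> complex \<Rightarrow> complex)"
    by unfold_locales (simp_all add: algebra_simps)
  then show ?thesis
    unfolding Vector_Spaces.linear_iff
    by (intro conjI allI iC.C.vector_space_axioms cform_simps) assumption
qed

lemma cform_separates:
  assumes "\<And>b. b \<in> Basis \<Longrightarrow> cform b z = 0" shows "z = 0"
proof (rule prod_eqI; rule euclidean_eqI)
  fix b :: 'a assume "b \<in> Basis"
  from assms[OF this] show "fst z \<bullet> b = fst 0 \<bullet> b" "snd z \<bullet> b = snd 0 \<bullet> b"
    by (simp_all add: cform_def complex_eq_iff)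
qed

lemma cpoly_diff: "p \<in> cpoly I \<Longrightarrow> q \<in> cpoly I \<Longrightarrow> (\<lambda>x. p x - q x) \<in> cpoly I"
  using cpoly.add[of p I "\<lambda>x. -1 * q x"] cpoly.mult[OF cpoly.const[of "-1"], of q I] by simp

text \<open>Elimination multiplies by pivots and never divides, so the coordinates of the reduced
  vectors remain polynomials. For the empty family the constant 1 expresses that it is
  independent.\<close>

lemma cindep_polynomials:
  fixes v :: "nat \<Rightarrow> 'e::real_vector \<Rightarrow> 'v::euclidean_space \<times> 'v"
  assumes "\<And>i b. i < k \<Longrightarrow> (\<lambda>T. cform b (v i T)) \<in> cpoly I"
  shows "\<exists>P\<subseteq>cpoly I. \<forall>T. iC.cindep k (\<lambda>i. v i T) \<longleftrightarrow> (\<exists>p\<in>P. p T \<noteq> 0)"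
  using assms
proof (induction k arbitrary: v)
  case 0
  show ?case by (intro exI[of _ "{\<lambda>T. 1}"]) (auto simp: iC.cindep_def intro: cpoly.const)
next
  case (Suc k)
  let ?v = "\<lambda>b i T. jscale iC (cform b (v k T)) (v i T) - jscale iC (cform b (v i T)) (v k T)"
  have "\<forall>b. \<exists>P\<subseteq>cpoly I. \<forall>T. iC.cindep k (\<lambda>i. ?v b i T) \<longleftrightarrow> (\<exists>p\<in>P. p T \<noteq> 0)"
    by (intro allI Suc.IH) (auto intro!: cpoly_diff cpoly.mult Suc.prems)
  from choice[OF this] obtain P where P: "\<And>b. P b \<subseteq> cpoly I"
    "\<And>b T. iC.cindep k (\<lambda>i. ?v b i T) \<longleftrightarrow> (\<exists>p\<in>P b. p T \<noteq> 0)" by blast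
  \<comment> \<open>A product is nonzero exactly when the pivot is nonzero and the polynomial for
    the reduced family is.\<close>
  define Q where "Q = (\<Union>b\<in>Basis. (\<lambda>p T. cform b (v k T) * p T) ` P b)"
  have "Q \<subseteq> cpoly I" using P(1) Suc.prems by (auto simp: Q_def intro!: cpoly.mult)
  moreover have "iC.cindep (Suc k) (\<lambda>i. v i T) \<longleftrightarrow> (\<exists>p\<in>Q. p T \<noteq> 0)" for T
  proof -
    have "iC.cindep (Suc k) (\<lambda>i. v i T) \<longleftrightarrow>
        (\<exists>b\<in>Basis. cform b (v k T) \<noteq> 0 \<and> iC.cindep k (\<lambda>i. ?v b i T))"
      by (rule iC.cindep_Suc_iff) (auto intro: cform_linear cform_separates)
    then show ?thesis unfolding P(2) by (auto simp: Q_def)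
  qed
  ultimately show ?case by blast
qed

section \<open>Zariski openness of full support\<close>

context pseudo_hermitian_space
begin

lemma cindep_iota: "iC.cindep k (\<lambda>i. (1/2) *\<^sub>R iota (v i)) \<longleftrightarrow> cindep k v"
proof -
  have "(\<Sum>i<k. jscale iC (c i) ((1/2) *\<^sub>R iota (v i))) = (1/2) *\<^sub>R iota (\<Sum>i<k. jscale J (c i) (v i))" for c
    by (simp add: linear_sum[OF bounded_linear.linear[OF bounded_linear_iota]] scaleR_sum_right)
  moreover have "iota x = 0 \<longleftrightarrow> x = 0" for x using iota_simps(1,7) by metis
  ultimately show ?thesis by (simp add: iC.cindep_def cindep_def)
qed

text \<open>The support lies in \<open>W\<close>, so \<open>k\<close> independent values fill it.
  Conversely the real span of the values is stable under \<open>J\<close>, hence a complex basis can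
  be chosen among the values.\<close>

lemma full_support_iff:
  assumes W: "complex_subspace J W" "cdim J W = k" and S: "S \<in> tensors_in W"
  shows "supp S = W \<longleftrightarrow> (\<exists>X Y. cindep k (\<lambda>i. app2 S (X i) (Y i)))"
proof
  have t: "S \<in> tensors" "supp S \<subseteq> W" using S tensors_in_supp[OF W(1)] by auto
  {
    assume "supp S = W"
    have "supp S = cspan J {app2 S X Y |X Y. True}"
      unfolding supp_def using J_supp[OF t(1) app2_in_supp] unfolding supp_def by (intro cspan_eq_span[symmetric]) auto
    with \<open>supp S = W\<close> W(2) have "cdim J (cspan J {app2 S X Y |X Y. True}) = k" by simp
    then obtain v where v: "cindep k v" "\<And>i. i < k \<Longrightarrow> v i \<in> {app2 S X Y |X Y. True}"
      by (rule obtain_cindep) blast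
    then have "\<forall>i. \<exists>z. i < k \<longrightarrow> v i = app2 S (fst z) (snd z)" by fastforce
    then obtain z where "\<And>i. i < k \<Longrightarrow> v i = app2 S (fst (z i)) (snd (z i))" by metis
    then have "cindep k (\<lambda>i. app2 S (fst (z i)) (snd (z i)))" using v(1) by (simp add: cindep_def)
    then show "\<exists>X Y. cindep k (\<lambda>i. app2 S (X i) (Y i))"
      by (intro exI[of _ "\<lambda>i. fst (z i)"] exI[of _ "\<lambda>i. snd (z i)"])
  }
  assume "\<exists>X Y. cindep k (\<lambda>i. app2 S (X i) (Y i))"
  then obtain X Y where "cindep k (\<lambda>i. app2 S (X i) (Y i))" by blast
  from cindep_dim[OF this complex_subspace_supp[OF t(1)] app2_in_supp]
  have "dim W \<le> dim (supp S)" using dim_eq_cdim complex_subspace_supp[OF t(1)] W by simp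
  then show "supp S = W"
    using t(2) W(1) by (intro subspace_dim_equal subspace_supp) (auto simp: complex_subspace_def)
qed

text \<open>For fixed argument pairs independence of the values is the nonvanishing of some
  polynomial in the tensor; the union of these polynomial families over all choices of pairs detects
  full support.\<close>

lemma S30_reg_zariski_open:
  assumes W: "complex_subspace J W"
  shows "zariski_open_in iB (S30 J g W) (S30_reg J g W)"
proof -
  define k where "k = cdim J W"
  let ?v = "\<lambda>XY :: nat \<Rightarrow> 'v \<times> 'v. \<lambda>i T. app2 T (fst (XY i), 0 :: 'v) (snd (XY i), 0 :: 'v)"
  have "(\<lambda>T. cform b (?v XY i T)) \<in> cpoly iB" for XY i and b :: 'v
    by (rule cpoly.linear_form) (auto intro!: linearI simp: bil_simps)
  then have "\<forall>XY. \<exists>P\<subseteq>cpoly iB. \<forall>T. iC.cindep k (\<lambda>i. ?v XY i T) \<longleftrightarrow> (\<exists>p\<in>P. p T \<noteq> 0)"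
    by (intro allI cindep_polynomials)
  from choice[OF this] obtain P where P: "\<And>XY. P XY \<subseteq> cpoly iB"
    "\<And>XY T. iC.cindep k (\<lambda>i. ?v XY i T) \<longleftrightarrow> (\<exists>p\<in>P XY. p T \<noteq> 0)" by blast
  have "T \<in> S30_reg J g W \<longleftrightarrow> (\<exists>p\<in>(\<Union>XY. P XY). p T \<noteq> 0)" if T: "T \<in> S30 J g W" for T
  proof -
    obtain S where S: "T = lift S" "S \<in> tensors_in W" using T S30_eq[OF W] by blast
    have "T \<in> S30_reg J g W \<longleftrightarrow> supp S = W"
      using S by (auto simp: S30_reg_eq[OF W] lift_eq_iff tensors_in_def)
    also have "\<dots> \<longleftrightarrow> (\<exists>X Y. cindep k (\<lambda>i. app2 S (X i) (Y i)))"
      using full_support_iff[OF W _ S(2)] k_def by blast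
    also have "\<dots> \<longleftrightarrow> (\<exists>XY :: nat \<Rightarrow> 'v \<times> 'v. cindep k (\<lambda>i. app2 S (fst (XY i)) (snd (XY i))))"
    proof
      assume "\<exists>X Y. cindep k (\<lambda>i. app2 S (X i) (Y i))"
      then obtain X Y where "cindep k (\<lambda>i. app2 S (X i) (Y i))" by blast
      then show "\<exists>XY :: nat \<Rightarrow> 'v \<times> 'v. cindep k (\<lambda>i. app2 S (fst (XY i)) (snd (XY i)))"
        by (intro exI[of _ "\<lambda>i. (X i, Y i)"]) simp
    next
      assume "\<exists>XY :: nat \<Rightarrow> 'v \<times> 'v. cindep k (\<lambda>i. app2 S (fst (XY i)) (snd (XY i)))"
      then obtain XY where "cindep k (\<lambda>i. app2 S (fst (XY i)) (snd (XY i)))" by blast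
      then show "\<exists>X Y. cindep k (\<lambda>i. app2 S (X i) (Y i))"
        by (intro exI[of _ "\<lambda>i. fst (XY i)"] exI[of _ "\<lambda>i. snd (XY i)"])
    qed
    also have "\<dots> \<longleftrightarrow> (\<exists>XY. iC.cindep k (\<lambda>i. ?v XY i T))"
      by (simp add: S(1) cindep_iota)
    also have "\<dots> \<longleftrightarrow> (\<exists>p\<in>(\<Union>XY. P XY). p T \<noteq> 0)" unfolding P(2) by blast
    finally show ?thesis .
  qed
  moreover have "S30_reg J g W \<subseteq> S30 J g W" by (auto simp: S30_reg_def)
  ultimately have "S30_reg J g W = {T \<in> S30 J g W. \<exists>p\<in>(\<Union>XY. P XY). p T \<noteq> 0}" by blast
  then show ?thesis unfolding zariski_open_in_def using P(1) by (intro exI[of _ "\<Union>XY. P XY"]) blast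
qed

lemma tw_add: "clin G \<Longrightarrow> tw G (S + T) = tw G S + tw G T"
  and tw_scaleR: "clin G \<Longrightarrow> tw G (r *\<^sub>R S) = r *\<^sub>R tw G S"
  and tw_Jbil: "clin G \<Longrightarrow> tw G (Jbil S) = Jbil (tw G S)"
  by (rule bil_eqI; simp add: app2_tw bil_simps clin_simps)+

lemma tw_jscale: "clin G \<Longrightarrow> tw G (jscale Jbil c S) = jscale Jbil c (tw G S)"
  by (simp add: jscale_def tw_add tw_scaleR tw_Jbil)

lemma bounded_bilinear_g: "bounded_bilinear g"
  using bilinear_g bilinear_conv_bounded_bilinear by blast

lemma smooth_on_adj:
  fixes f :: "'c::real_normed_vector \<Rightarrow> 'v \<Rightarrow>\<^sub>L 'v"
  assumes "smooth_on U f" "smooth_on U h"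
  shows "smooth_on U (\<lambda>z. adj (f z) (h z))"
  unfolding adj_def
  by (intro smooth_on_sum smooth_on_scaleR smooth_on_const bounded_bilinear.smooth_on[OF bounded_bilinear_g]
      smooth_on_blinfun_apply assms)

text \<open>For complex linear operators \<open>tw\<close> is given by an explicit expression in the
  operator, its adjoint and the tensor; on the open set it may be replaced by that
  expression.\<close>

lemma smooth_on_tw:
  fixes f :: "'c::real_normed_vector \<Rightarrow> 'v \<Rightarrow>\<^sub>L 'v"
  assumes "smooth_on U f" "smooth_on U h" and c: "\<And>z. z \<in> U \<Longrightarrow> clin (f z)" and U: "open U"
  shows "smooth_on U (\<lambda>z. tw (f z) (h z))"
proof -
  have "smooth_on U (\<lambda>z. f z (app2 (h z) (adj (f z) X) (adj (f z) Y)))" for X Y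
    by (intro smooth_on_blinfun_apply assms(1,2) smooth_on_adj smooth_on_const)
  then have "smooth_on U (\<lambda>z. app2 (tw (f z) (h z)) X Y)" for X Y
    by (rule smooth_on_cong[OF U, rotated]) (simp add: app2_tw c)
  then show ?thesis by (intro smooth_on_blinfunI)
qed

end

section \<open>The bundle \<open>S\<^sup>3 U\<^sub>k\<close>\<close>

context pseudo_hermitian_space
begin

definition Jb :: "'v \<Rightarrow>\<^sub>L 'v" where "Jb = Blinfun J"

lemma Jb_apply [simp]: "blinfun_apply Jb = J"
  unfolding Jb_def using linJ by (intro bounded_linear_Blinfun_apply linear_conv_bounded_linear[THEN iffD1])

text \<open>The auxiliary inner product need not be invariant under \<open>J\<close>, so an
  orthogonal projector onto a complex subspace need not be complex linear. The average is, and it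
  still depends linearly on \<open>P\<close>.\<close>

definition cproj_of :: "('v \<Rightarrow>\<^sub>L 'v) \<Rightarrow> ('v \<Rightarrow>\<^sub>L 'v)" where
  "cproj_of P = (1/2) *\<^sub>R (P - (Jb o\<^sub>L P o\<^sub>L Jb))"

lemma cproj_of_apply: "cproj_of P x = (1/2) *\<^sub>R (P x - J (P (J x)))"
  by (simp add: cproj_of_def bil_simps)

lemma clin_cproj_of: "clin (cproj_of P)"
  by (rule clinI) (simp_all add: cproj_of_apply bil_simps algebra_simps)

lemma cproj_cproj_of:
  assumes "orth_proj P W" "complex_subspace J W" shows "cproj (cproj_of P) W"
proof -
  have "subspace W" using assms(2) by (simp add: complex_subspace_def)
  note P = orth_projD[OF assms(1) this]
  show ?thesis
    using cproj_average[OF linear_blinfun P(1) P(3) assms(2)] by (simp add: cproj_of_apply[abs_def])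
qed

lemma smooth_on_cproj_of: "smooth_on U f \<Longrightarrow> smooth_on U (\<lambda>z. cproj_of (f z))"
  unfolding cproj_of_def by (intro smooth_on_scaleR smooth_on_diff smooth_on_const smooth_on_blinfun_compose)

text \<open>Kato's transformation: it intertwines the two projectors and is close to the identity for
  \<open>P\<close> near \<open>P0\<close>.\<close>

definition transport :: "('v \<Rightarrow>\<^sub>L 'v) \<Rightarrow> ('v \<Rightarrow>\<^sub>L 'v) \<Rightarrow> ('v \<Rightarrow>\<^sub>L 'v)" where
  "transport P0 P = (cproj_of P0 o\<^sub>L cproj_of P) + ((id_blinfun - cproj_of P0) o\<^sub>L (id_blinfun - cproj_of P))"

lemma clin_transport: "clin (transport P0 P)"
  using clin_cproj_of by (intro clinI) (simp_all add: transport_def bil_simps clin_simps algebra_simps)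

lemma smooth_on_transport: "smooth_on U f \<Longrightarrow> smooth_on U (\<lambda>z. transport P0 (f z))"
  unfolding transport_def
  by (intro smooth_on_add smooth_on_diff smooth_on_const smooth_on_blinfun_compose smooth_on_cproj_of)

text \<open>The radius is the one at which \<open>near_id_inj\<close> provides an inverse with a
  uniform bound.\<close>

definition transport_nhd :: "('v \<Rightarrow>\<^sub>L 'v) \<Rightarrow> ('v \<Rightarrow>\<^sub>L 'v) set" where
  "transport_nhd P0 = {P. norm (id_blinfun - transport P0 P) < 1/2}"

lemma open_transport_nhd: "open (transport_nhd P0)"
proof -
  have "continuous_on UNIV (transport P0)"
    using smooth_on_transport[OF smooth_on_ident] smooth_on_imp_continuous_on by blast
  then show ?thesis unfolding transport_nhd_def
    by (intro open_Collect_less continuous_intros)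
qed

lemma transport_self:
  assumes "orth_proj P W" "complex_subspace J W" shows "transport P P = id_blinfun" "P \<in> transport_nhd P"
proof -
  note C = cprojD[OF cproj_cproj_of[OF assms]]
  show "transport P P = id_blinfun"
    by (rule blinfun_eqI) (simp add: transport_def bil_simps C(3)[OF C(2)])
  then show "P \<in> transport_nhd P" by (simp add: transport_nhd_def)
qed

lemma transport_bij:
  assumes "P \<in> transport_nhd P0" shows "inj (transport P0 P)" "bij (transport P0 P)"
  using assms near_id_inj(2)[of "transport P0 P"] binv_bij(3) by (auto simp: transport_nhd_def)

lemma binv_transport:
  assumes "P \<in> transport_nhd P0"
  shows "clin (binv (transport P0 P))" "bij (binv (transport P0 P))"
proof -
  have "blinfun_apply (binv (transport P0 P)) = inv_into UNIV (transport P0 P)"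
    using binv_bij(1)[OF transport_bij(1)[OF assms]] binv_bij(2)[OF transport_bij(1)[OF assms]]
      transport_bij(1)[OF assms] by (metis inv_f_eq ext)
  then show "clin (binv (transport P0 P))" "bij (binv (transport P0 P))"
    using clin_inv[OF clin_transport transport_bij(2)[OF assms]] bij_imp_bij_inv[OF transport_bij(2)[OF assms]] by auto
qed

text \<open>On \<open>W\<close> the second summand of \<open>transport\<close> vanishes and the
  first is the projector into \<open>W0\<close>; injectivity and equal dimensions make the image all
  of \<open>W0\<close>.\<close>

lemma transport_image:
  assumes P: "orth_proj P W" "complex_subspace J W" and P0: "orth_proj P0 W0" "complex_subspace J W0"
    and dim: "dim W = dim W0" and near: "P \<in> transport_nhd P0"
  shows "transport P0 P ` W = W0" "binv (transport P0 P) ` W0 = W"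
proof -
  have W: "subspace W" "subspace W0" using P(2) P0(2) by (auto simp: complex_subspace_def)
  note C = cprojD[OF cproj_cproj_of[OF P]] and C0 = cprojD[OF cproj_cproj_of[OF P0]]
  have "transport P0 P w \<in> W0" if "w \<in> W" for w
    using C0(2) C(3)[OF that] by (simp add: transport_def bil_simps)
  then have "transport P0 P ` W \<subseteq> W0" by blast
  moreover have "dim (transport P0 P ` W) = dim W"
    by (intro dim_image_eq linear_blinfun) (use transport_bij(1)[OF near] in \<open>auto intro: inj_on_subset\<close>)
  ultimately show im: "transport P0 P ` W = W0"
    using W dim by (intro subspace_dim_equal linear_subspace_image linear_blinfun) auto
  show "binv (transport P0 P) ` W0 = W"
    unfolding im[symmetric] image_image binv_bij(1)[OF transport_bij(1)[OF near]] by simp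
qed

lemma tw_tensors_in:
  assumes "clin G" "G ` W = W'" "S \<in> tensors_in W" shows "tw G S \<in> tensors_in W'"
  using assms tw_tensors by (auto simp: tensors_in_def app2_tw)

lemma tw_binv:
  assumes "P \<in> transport_nhd P0"
  shows "tw (binv (transport P0 P)) (tw (transport P0 P) S) = S" "tw (transport P0 P) (tw (binv (transport P0 P)) S) = S"
proof -
  note b = binv_bij(1,2)[OF transport_bij(1)[OF assms]]
  show "tw (binv (transport P0 P)) (tw (transport P0 P) S) = S"
    using tw_compose[OF binv_transport(1)[OF assms] clin_transport[of P0 P], of S] by (simp add: b tw_id)
  show "tw (transport P0 P) (tw (binv (transport P0 P)) S) = S"
    using tw_compose[OF clin_transport[of P0 P] binv_transport(1)[OF assms], of S] by (simp add: b tw_id)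
qed

text \<open>Twisting by the transport sends tensors with values in one range to tensors with values
  in the other, and maps supports along. The same chart therefore trivializes the bundle and its
  regular part.\<close>

lemma S3_bundle_trivialization:
  fixes P0 :: "'v \<Rightarrow>\<^sub>L 'v"
  assumes P0: "P0 \<in> isotropic_proj J g k"
  defines "U \<equiv> isotropic_proj J g k \<inter> transport_nhd P0"
    and "\<Phi> \<equiv> \<lambda>P T. lift (tw (transport P0 P) (realify T))"
  shows "local_trivialization iB (\<lambda>P. S30 J g (range (blinfun_apply P))) U (S30 J g (range (blinfun_apply P0))) \<Phi>"
    "P \<in> U \<Longrightarrow> \<Phi> P ` S30_reg J g (range (blinfun_apply P)) = S30_reg J g (range (blinfun_apply P0))"
proof -
  define \<Psi> where "\<Psi> P T = lift (tw (binv (transport P0 P)) (realify T))" for P T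
  have U: "P \<in> isotropic_proj J g k" "P \<in> transport_nhd P0" if "P \<in> U" for P using that by (auto simp: U_def)
  have im: "transport P0 P ` range P = range P0" "binv (transport P0 P) ` range P0 = range P" if "P \<in> U" for P
    using isotropic_projD[OF U(1)[OF that]] isotropic_projD[OF P0] U(2)[OF that]
    by (intro transport_image; simp add: isotropic_subspaceD(1))+
  note F = S30_proj[OF U(1)] and F0 = S30_proj[OF P0]
  have lin: "\<Phi> P (x + y) = \<Phi> P x + \<Phi> P y" for P x y
    by (simp add: \<Phi>_def realify_add tw_add clin_transport lift_add)
  have scale: "\<Phi> P (jscale iB c x) = jscale iB c (\<Phi> P x)" if P: "P \<in> U" and x: "x \<in> S30 J g (range P)" for P c x
  proof -
    \<comment> \<open>\<open>realify\<close> alone is only real linear. On a fibre every element is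
      a lift, and there multiplication by a complex scalar corresponds to the structure
      \<open>Jbil\<close>, which \<open>tw\<close> respects.\<close>
    obtain S where "x = lift S" using x F[OF P] by auto
    then show ?thesis by (simp add: \<Phi>_def lift_jscale[symmetric] tw_jscale clin_transport)
  qed
  have smooth: "smooth_on (transport_nhd P0 \<times> UNIV) (\<lambda>z. (fst z, \<Phi> (fst z) (snd z)))"
    unfolding \<Phi>_def
    by (intro smooth_on_Pair smooth_on_fst smooth_on_ident smooth_on_bounded_linear[OF bounded_linear_lift]
        smooth_on_tw smooth_on_transport smooth_on_bounded_linear[OF bounded_linear_realify] smooth_on_snd
        clin_transport open_Times open_transport_nhd open_UNIV)
  have smooth': "smooth_on (transport_nhd P0 \<times> UNIV) (\<lambda>z. (fst z, \<Psi> (fst z) (snd z)))"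
    unfolding \<Psi>_def
    by (intro smooth_on_Pair smooth_on_fst smooth_on_ident smooth_on_bounded_linear[OF bounded_linear_lift]
        smooth_on_tw smooth_on_binv smooth_on_transport smooth_on_bounded_linear[OF bounded_linear_realify] smooth_on_snd
        binv_transport(1) open_Times open_transport_nhd open_UNIV) (auto simp: transport_nhd_def)
  have "diffeomorphism (Sigma U (\<lambda>P. S30 J g (range (blinfun_apply P)))) (U \<times> S30 J g (range P0)) (\<lambda>(P, T). (P, \<Phi> P T))"
  proof (rule diffeomorphismI[where h = "\<lambda>(P, T). (P, \<Psi> P T)"])
    fix x assume "x \<in> Sigma U (\<lambda>P. S30 J g (range (blinfun_apply P)))"
    then obtain P S where x: "P \<in> U" "x = (P, lift S)" "S \<in> tensors_in (range P)" by (auto simp: F)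
    show "(case x of (P, T) \<Rightarrow> (P, \<Phi> P T)) \<in> U \<times> S30 J g (range P0)"
      using tw_tensors_in[OF clin_transport im(1)[OF x(1)] x(3)] x by (simp add: \<Phi>_def F0)
    show "(case case x of (P, T) \<Rightarrow> (P, \<Phi> P T) of (P, T) \<Rightarrow> (P, \<Psi> P T)) = x"
      using x by (simp add: \<Phi>_def \<Psi>_def tw_binv[OF U(2)])
  next
    fix y assume "y \<in> U \<times> S30 J g (range P0)"
    then obtain P S where y: "P \<in> U" "y = (P, lift S)" "S \<in> tensors_in (range P0)" by (auto simp: F0)
    show "(case y of (P, T) \<Rightarrow> (P, \<Psi> P T)) \<in> Sigma U (\<lambda>P. S30 J g (range (blinfun_apply P)))"
      using tw_tensors_in[OF binv_transport(1)[OF U(2)[OF y(1)]] im(2)[OF y(1)] y(3)] y by (simp add: \<Psi>_def F)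
    show "(case case y of (P, T) \<Rightarrow> (P, \<Psi> P T) of (P, T) \<Rightarrow> (P, \<Phi> P T)) = y"
      using y by (simp add: \<Phi>_def \<Psi>_def tw_binv[OF U(2)])
  next
    show "smooth_map (Sigma U (\<lambda>P. S30 J g (range (blinfun_apply P)))) (\<lambda>(P, T). (P, \<Phi> P T))"
      by (rule smooth_mapI, intro exI[of _ "transport_nhd P0 \<times> UNIV"] exI[of _ "\<lambda>z. (fst z, \<Phi> (fst z) (snd z))"])
        (auto intro!: smooth open_Times open_transport_nhd simp: U)
    show "smooth_map (U \<times> S30 J g (range P0)) (\<lambda>(P, T). (P, \<Psi> P T))"
      by (rule smooth_mapI, intro exI[of _ "transport_nhd P0 \<times> UNIV"] exI[of _ "\<lambda>z. (fst z, \<Psi> (fst z) (snd z))"])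
        (auto intro!: smooth' open_Times open_transport_nhd simp: U)
  qed
  with lin scale show "local_trivialization iB (\<lambda>P. S30 J g (range (blinfun_apply P))) U (S30 J g (range (blinfun_apply P0))) \<Phi>"
    unfolding local_trivialization_def by blast
  show "\<Phi> P ` S30_reg J g (range P) = S30_reg J g (range P0)" if P: "P \<in> U"
  proof -
    note b = transport_bij[OF U(2)[OF P]] and b' = binv_transport[OF U(2)[OF P]]
    have "S \<in> tensors \<and> supp S = range P0 \<longleftrightarrow> (\<exists>T\<in>tensors. supp T = range P \<and> S = tw (transport P0 P) T)" for S
    proof
      assume S: "S \<in> tensors \<and> supp S = range P0"
      then show "\<exists>T\<in>tensors. supp T = range P \<and> S = tw (transport P0 P) T"
        using im(2)[OF P] b'
        by (intro bexI[of _ "tw (binv (transport P0 P)) S"]) (auto simp: supp_tw tw_tensors tw_binv[OF U(2)[OF P]])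
    next
      assume "\<exists>T\<in>tensors. supp T = range P \<and> S = tw (transport P0 P) T"
      then show "S \<in> tensors \<and> supp S = range P0"
        using im(1)[OF P] b by (auto simp: supp_tw[OF clin_transport] tw_tensors[OF clin_transport])
    qed
    then have "{S \<in> tensors. supp S = range P0} = tw (transport P0 P) ` {S \<in> tensors. supp S = range P}" by blast
    then show ?thesis unfolding S30_reg_proj[OF U(1)[OF P]] S30_reg_proj[OF P0] \<Phi>_def by (simp add: image_image)
  qed
qed

lemma S3_bundle_zariski_open:
  "zariski_open_subbundle iB (isotropic_proj J g k)
     (\<lambda>P. S30 J g (range (blinfun_apply P))) (\<lambda>P. S30_reg J g (range (blinfun_apply P)))"
  unfolding zariski_open_subbundle_def
proof (intro conjI ballI)
  fix P assume P: "P \<in> isotropic_proj J g k"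
  note W = isotropic_subspaceD(1)[OF isotropic_projD(2)[OF P]]
  show "zariski_open_in iB (S30 J g (range P)) (S30_reg J g (range P))" by (rule S30_reg_zariski_open[OF W])
  obtain S where "S \<in> tensors" "supp S = range P" by (rule obtain_regular[OF W])
  then show "S30_reg J g (range P) \<noteq> {}" by (auto simp: S30_reg_eq[OF W])
  have "openin (top_of_set (isotropic_proj J g k)) (isotropic_proj J g k \<inter> transport_nhd P)"
    using open_transport_nhd by (rule openin_open_Int)
  moreover have "P \<in> isotropic_proj J g k \<inter> transport_nhd P"
    using P transport_self(2)[OF isotropic_projD(1)[OF P] W] by simp
  ultimately show "\<exists>U \<Phi>. openin (top_of_set (isotropic_proj J g k)) U \<and> P \<in> U \<and>
      local_trivialization iB (\<lambda>P. S30 J g (range (blinfun_apply P))) U (S30 J g (range (blinfun_apply P))) \<Phi> \<and>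
      (\<forall>b\<in>U. \<Phi> b ` S30_reg J g (range (blinfun_apply b)) = S30_reg J g (range (blinfun_apply P)))"
    using S3_bundle_trivialization[OF P]
    by (intro exI[of _ "isotropic_proj J g k \<inter> transport_nhd P"]
        exI[of _ "\<lambda>Q T. lift (tw (transport P Q) (realify T))"] conjI ballI)
qed

end

section \<open>Orbit spaces\<close>

lemma openin_orbit_space:
  "openin (orbit_space X orb) Q \<longleftrightarrow> Q \<subseteq> orb ` X \<and> openin (top_of_set X) {x \<in> X. orb x \<in> Q}"
proof -
  have "istopology (\<lambda>Q. Q \<subseteq> orb ` X \<and> openin (top_of_set X) {x \<in> X. orb x \<in> Q})"
    unfolding istopology_def
  proof (intro conjI allI impI)
    fix Q R assume Q: "Q \<subseteq> orb ` X \<and> openin (top_of_set X) {x \<in> X. orb x \<in> Q}"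
      and R: "R \<subseteq> orb ` X \<and> openin (top_of_set X) {x \<in> X. orb x \<in> R}"
    then show "Q \<inter> R \<subseteq> orb ` X" by blast
    have "{x \<in> X. orb x \<in> Q \<inter> R} = {x \<in> X. orb x \<in> Q} \<inter> {x \<in> X. orb x \<in> R}" by blast
    then show "openin (top_of_set X) {x \<in> X. orb x \<in> Q \<inter> R}" using Q R by (simp add: openin_Int)
  next
    fix K assume K: "\<forall>Q\<in>K. Q \<subseteq> orb ` X \<and> openin (top_of_set X) {x \<in> X. orb x \<in> Q}"
    then show "\<Union>K \<subseteq> orb ` X" by blast
    have "{x \<in> X. orb x \<in> \<Union>K} = \<Union>((\<lambda>Q. {x \<in> X. orb x \<in> Q}) ` K)" by blast
    then show "openin (top_of_set X) {x \<in> X. orb x \<in> \<Union>K}" using K by auto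
  qed
  then show ?thesis unfolding orbit_space_def by (simp add: topology_inverse')
qed

lemma topspace_orbit_space: "topspace (orbit_space X orb) = orb ` X"
proof
  show "topspace (orbit_space X orb) \<subseteq> orb ` X"
    using openin_orbit_space openin_topspace by metis
  have "{x \<in> X. orb x \<in> orb ` X} = X" by blast
  then have "openin (orbit_space X orb) (orb ` X)" by (simp add: openin_orbit_space)
  then show "orb ` X \<subseteq> topspace (orbit_space X orb)" by (rule openin_subset)
qed

text \<open>The map induced by inclusion is injective by \<open>same\<close>, surjective by
  \<open>meets\<close>, and continuous because both sides carry quotient topologies. Its openness is
  the substantial part: open sets of \<open>X\<close> must have open saturations in
  \<open>Y\<close>.\<close>

lemma orbit_space_homeomorphic:
  fixes X Y :: "'a::topological_space set"
  assumes XY: "X \<subseteq> Y"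
    and same: "\<And>x x'. x \<in> X \<Longrightarrow> x' \<in> X \<Longrightarrow> oX x = oX x' \<longleftrightarrow> oY x = oY x'"
    and meets: "\<And>y. y \<in> Y \<Longrightarrow> \<exists>x\<in>X. oY x = oY y"
    and open_sat: "\<And>V. openin (top_of_set X) V \<Longrightarrow> openin (top_of_set Y) {y \<in> Y. \<exists>x\<in>V. oY x = oY y}"
  shows "\<exists>h. homeomorphic_map (orbit_space X oX) (orbit_space Y oY) h \<and> (\<forall>x\<in>X. h (oX x) = oY x)"
proof -
  \<comment> \<open>A representative is chosen in each orbit; \<open>same\<close> makes the result
    independent of the choice.\<close>
  define h where "h Q = oY (SOME x. x \<in> X \<and> oX x = Q)" for Q
  have h: "h (oX x) = oY x" if "x \<in> X" for x
  proof -
    have "(SOME x'. x' \<in> X \<and> oX x' = oX x) \<in> X \<and> oX (SOME x'. x' \<in> X \<and> oX x' = oX x) = oX x"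
      by (rule someI[of _ x]) (use that in auto)
    then show ?thesis unfolding h_def using same that by blast
  qed
  have "homeomorphic_map (orbit_space X oX) (orbit_space Y oY) h"
  proof (rule bijective_open_imp_homeomorphic_map)
    show "h ` topspace (orbit_space X oX) = topspace (orbit_space Y oY)"
    proof (unfold topspace_orbit_space, intro equalityI subsetI)
      fix Q assume "Q \<in> oY ` Y"
      then obtain x where "x \<in> X" "Q = oY x" using meets by fastforce
      then show "Q \<in> h ` oX ` X" using h by (metis imageI)
    qed (use h XY in auto)
    show "inj_on h (topspace (orbit_space X oX))"
      unfolding topspace_orbit_space
    proof (rule inj_onI)
      fix P Q assume "P \<in> oX ` X" "Q \<in> oX ` X" and eq: "h P = h Q"
      then obtain x x' where "x \<in> X" "P = oX x" "x' \<in> X" "Q = oX x'" by blast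
      with eq show "P = Q" using same[of x x'] by (simp add: h)
    qed
    show "continuous_map (orbit_space X oX) (orbit_space Y oY) h"
      unfolding continuous_map_def topspace_orbit_space
    proof (intro conjI allI impI)
      fix Q assume "openin (orbit_space Y oY) Q"
      then obtain O' where O': "open O'" "{y \<in> Y. oY y \<in> Q} = Y \<inter> O'" by (auto simp: openin_orbit_space openin_open)
      have "{x \<in> X. oX x \<in> {P \<in> oX ` X. h P \<in> Q}} = X \<inter> (Y \<inter> O')"
        unfolding O'(2)[symmetric] using h XY by auto
      also have "\<dots> = X \<inter> O'" using XY by blast
      finally show "openin (orbit_space X oX) {P \<in> oX ` X. h P \<in> Q}"
        using O'(1) by (auto simp: openin_orbit_space openin_open)
    qed (use h XY in auto)
    show "open_map (orbit_space X oX) (orbit_space Y oY) h"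
      unfolding open_map_def
    proof (intro allI impI)
      fix Q assume "openin (orbit_space X oX) Q"
      then have Q: "Q \<subseteq> oX ` X" "openin (top_of_set X) {x \<in> X. oX x \<in> Q}" by (auto simp: openin_orbit_space)
      have "{y \<in> Y. oY y \<in> h ` Q} = {y \<in> Y. \<exists>x\<in>{x \<in> X. oX x \<in> Q}. oY x = oY y}"
      proof (intro Collect_cong conj_cong refl iffI)
        fix y assume "oY y \<in> h ` Q"
        then obtain x where "x \<in> X" "oX x \<in> Q" "oY y = h (oX x)" using Q(1) by blast
        then show "\<exists>x\<in>{x \<in> X. oX x \<in> Q}. oY x = oY y" using h by auto
      next
        fix y assume "\<exists>x\<in>{x \<in> X. oX x \<in> Q}. oY x = oY y"
        then obtain x where "x \<in> X" "oX x \<in> Q" "oY x = oY y" by blast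
        then show "oY y \<in> h ` Q" using h by (intro image_eqI[of _ _ "oX x"]) auto
      qed
      moreover have "h ` Q \<subseteq> oY ` Y"
      proof safe
        fix P assume "P \<in> Q"
        then obtain x where "x \<in> X" "P = oX x" using Q(1) by blast
        then show "h P \<in> oY ` Y" using h XY by auto
      qed
      ultimately show "openin (orbit_space Y oY) (h ` Q)" using open_sat[OF Q(2)] by (simp add: openin_orbit_space)
    qed
  qed
  with h show ?thesis by blast
qed

section \<open>Comparing the unitary and the general linear orbits\<close>

context pseudo_hermitian_space
begin

lemma tw_sprod: "clin B \<Longrightarrow> tw B (sprod a b c) = sprod (B a) (B b) (B c)"
  by (rule bil_eqI, rule theta_eqI) (simp add: app2_tw app2_sprod theta_trip theta_adj clin_adj algebra_simps clin_simps)

lemma map_prod_iota: "a \<in> W \<Longrightarrow> complex_subspace J W \<Longrightarrow> A \<in> GL J W \<Longrightarrow> map_prod A A (iota a) = iota (A a)"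
  by (simp add: iota_def GL_def linear_neg)

lemma U_orbit_eq: "U_orbit J g S = {tw A S |A. A \<in> Aut J g}"
  unfolding U_orbit_def using act_eq_tw by metis

text \<open>\<open>L\<close> is prescribed only on symmetric products of vectors of
  \<open>W\<close>. Expanding \<open>S\<close> in these and using linearity determines
  \<open>L\<close> on the lift, where it agrees with the action of the extension
  \<open>B\<close>.\<close>

lemma induced_action:
  assumes W: "isotropic_subspace W" and L: "induces_S3 J g W A L" and A: "A \<in> GL J W"
    and B: "B \<in> Aut J g" "\<And>w. w \<in> W \<Longrightarrow> B w = A w" and S: "S \<in> tensors_in W"
  shows "L (lift S) = lift (tw B S)"
proof -
  note cW = isotropic_subspaceD(1)[OF W] and cB = AutD(1)[OF B(1)]
  interpret L: Vector_Spaces.linear "jscale iB" "jscale iB" L using L by (simp add: induces_S3_def)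
  obtain X \<tau> where X: "X \<subseteq> W" "finite X" and
    e: "lift S = (\<Sum>a\<in>X. \<Sum>b\<in>X. \<Sum>c\<in>X. jscale iB (\<tau> a b c / 12) (sym3 (omega J g) (iota a) (iota b) (iota c)))"
    by (rule sprod_expansion[OF cW S]) blast
  have "L (lift S) = (\<Sum>a\<in>X. \<Sum>b\<in>X. \<Sum>c\<in>X. jscale iB (\<tau> a b c / 12) (L (sym3 (omega J g) (iota a) (iota b) (iota c))))"
    unfolding e by (simp add: L.sum L.scale)
  also have "\<dots> = (\<Sum>a\<in>X. \<Sum>b\<in>X. \<Sum>c\<in>X. lift (jscale Jbil (\<tau> a b c / 12) (tw B (2 *\<^sub>R sprod a b c))))"
  proof (intro sum.cong refl)
    fix a b c assume "a \<in> X" "b \<in> X" "c \<in> X"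
    then have abc: "a \<in> W" "b \<in> W" "c \<in> W" using X by auto
    then have "L (sym3 (omega J g) (iota a) (iota b) (iota c)) = sym3 (omega J g) (iota (B a)) (iota (B b)) (iota (B c))"
      using L by (auto simp: induces_S3_def W10_eq[OF cW] map_prod_iota[OF _ cW A] B(2))
    then show "jscale iB (\<tau> a b c / 12) (L (sym3 (omega J g) (iota a) (iota b) (iota c)))
        = lift (jscale Jbil (\<tau> a b c / 12) (tw B (2 *\<^sub>R sprod a b c)))"
      by (simp add: lift_jscale sym3_iota tw_scaleR[OF cB] tw_sprod[OF cB])
  qed
  also have "\<dots> = lift (tw B (\<Sum>a\<in>X. \<Sum>b\<in>X. \<Sum>c\<in>X. jscale Jbil (\<tau> a b c / 12) (2 *\<^sub>R sprod a b c)))"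
  proof -
    have lin: "linear (\<lambda>S. lift (tw B S))"
      by (intro linearI) (simp_all add: tw_add[OF cB] tw_scaleR[OF cB] lift_add lift_scaleR)
    show ?thesis by (simp add: linear_sum[OF lin] tw_jscale[OF cB])
  qed
  also have "(\<Sum>a\<in>X. \<Sum>b\<in>X. \<Sum>c\<in>X. jscale Jbil (\<tau> a b c / 12) (2 *\<^sub>R sprod a b c)) = S"
  proof -
    have "lift (\<Sum>a\<in>X. \<Sum>b\<in>X. \<Sum>c\<in>X. jscale Jbil (\<tau> a b c / 12) (2 *\<^sub>R sprod a b c)) = lift S"
      unfolding e by (simp add: linear_sum[OF bounded_linear.linear[OF bounded_linear_lift]] lift_jscale sym3_iota)
    then show ?thesis by (simp add: lift_eq_iff)
  qed
  finally show ?thesis .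
qed

text \<open>The complexification of \<open>tw\<close>, defined on all complex tensors. It supplies a
  globally complex linear \<open>L\<close>, as \<open>induces_S3\<close> requires.\<close>

definition lift_action :: "('v \<Rightarrow> 'v) \<Rightarrow> ('v \<times> 'v) bil \<Rightarrow> ('v \<times> 'v) bil" where
  "lift_action A T = blin2 (\<lambda>Z1 Z2. map_prod A A (app2 T (map_prod (adj A) (adj A) Z1) (map_prod (adj A) (adj A) Z2)))"

lemma map_prod_clin:
  assumes "clin A"
  shows "map_prod A A (x + y) = map_prod A A x + map_prod A A y" "map_prod A A (r *\<^sub>R x) = r *\<^sub>R map_prod A A x"
    "map_prod A A (iC x) = iC (map_prod A A x)" "map_prod A A (iota a) = iota (A a)" "rho (map_prod A A x) = A (rho x)"
  by (auto simp: prod_eq_iff clin_simps[OF assms] iC_def iota_def rho_def)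

lemma app2_lift_action:
  "clin A \<Longrightarrow> app2 (lift_action A T) Z1 Z2 = map_prod A A (app2 T (map_prod (adj A) (adj A) Z1) (map_prod (adj A) (adj A) Z2))"
  unfolding lift_action_def
  by (rule blin2_apply, rule bilinearI) (simp_all add: bil_simps map_prod_clin clin_adj)

lemma lift_action_lift: "clin A \<Longrightarrow> lift_action A (lift S) = lift (tw A S)"
  by (rule bil_eqI) (simp add: app2_lift_action map_prod_clin clin_adj app2_tw)

lemma lift_action_induces:
  assumes A: "clin A" and W: "complex_subspace J W"
  shows "induces_S3 J g W A (lift_action A)"
  unfolding induces_S3_def
proof (intro conjI ballI)
  have "lift_action A (jscale iB c T) = jscale iB c (lift_action A T)" for c T
    by (rule bil_eqI) (simp add: app2_lift_action A, simp add: jscale_def map_prod_clin[OF A])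
  moreover have "lift_action A (S + T) = lift_action A S + lift_action A T" for S T
    by (rule bil_eqI) (simp add: app2_lift_action A bil_simps map_prod_clin)
  ultimately show "Vector_Spaces.linear (jscale iB) (jscale iB) (lift_action A)"
    unfolding Vector_Spaces.linear_iff by (intro conjI allI iB.C.vector_space_axioms)
  fix u1 u2 u3 assume "u1 \<in> W10 J W" "u2 \<in> W10 J W" "u3 \<in> W10 J W"
  then obtain a b c where u: "u1 = iota a" "u2 = iota b" "u3 = iota c" using W10_eq[OF W] by blast
  show "lift_action A (sym3 (omega J g) u1 u2 u3) = sym3 (omega J g) (map_prod A A u1) (map_prod A A u2) (map_prod A A u3)"
    by (simp add: u sym3_iota lift_action_lift A tw_scaleR tw_sprod map_prod_clin)
qed

lemma GL_orbit_eq: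
  assumes W: "isotropic_subspace W" and S: "S \<in> tensors" "supp S = W"
  shows "GL_orbit J g W S = U_orbit J g S \<inter> {T. supp T = W}"
proof (intro equalityI subsetI)
  note cW = isotropic_subspaceD(1)[OF W]
  have SW: "S \<in> tensors_in W" using S tensors_in_supp[OF cW] by simp
  {
    fix R assume "R \<in> GL_orbit J g W S"
    then obtain A L T where R: "R = realify (L T)" and A: "A \<in> GL J W" and L: "induces_S3 J g W A L"
      and T: "T \<in> S30_reg J g W" "realify T = S" unfolding GL_orbit_def by blast
    obtain B where B: "B \<in> Aut J g" "\<And>w. w \<in> W \<Longrightarrow> B w = A w" "B ` W = W"
      by (rule GL_extends[OF W A]) blast
    have "T = lift S" using T S30_reg_eq[OF cW] by auto
    then have "R = tw B S" using induced_action[OF W L A B(1,2) SW] R by simp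
    then show "R \<in> U_orbit J g S \<inter> {T. supp T = W}"
      using B S by (auto simp: U_orbit_eq supp_tw AutD)
  next
    fix R assume "R \<in> U_orbit J g S \<inter> {T. supp T = W}"
    then obtain A where A: "A \<in> Aut J g" "R = tw A S" "supp R = W" by (auto simp: U_orbit_eq)
    note cA = AutD(1)[OF A(1)]
    have "A ` W = W" using A S(2) by (simp add: supp_tw AutD)
    then have "A \<in> GL J W"
      using cA AutD(2)[OF A(1)] by (auto simp: GL_def clin_def bij_betw_def intro: inj_on_subset)
    moreover have "lift S \<in> S30_reg J g W" using S S30_reg_eq[OF cW] by blast
    moreover have "R = realify (lift_action A (lift S))" using A(2) by (simp add: lift_action_lift cA)
    ultimately show "R \<in> GL_orbit J g W S"
      unfolding GL_orbit_def
      by (intro CollectI exI[of _ A] exI[of _ "lift_action A"] exI[of _ "lift S"] conjI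
          lift_action_induces[OF cA cW] realify_lift)
  }
qed

lemma U_orbit_self: "S \<in> U_orbit J g S"
  unfolding U_orbit_eq by (intro CollectI exI[of _ "\<lambda>x. x"] conjI Aut_id) (simp add: tw_id)

lemma U_orbit_cong: "T \<in> U_orbit J g S \<Longrightarrow> U_orbit J g T = U_orbit J g S"
proof -
  assume "T \<in> U_orbit J g S"
  then obtain A where A: "A \<in> Aut J g" "T = act A S" by (auto simp: U_orbit_def)
  have "act B S \<in> U_orbit J g T" if B: "B \<in> Aut J g" for B
  proof -
    have "act B S = act B (act (inv_into UNIV A) T)" by (simp add: A(2) act_inv(1)[OF A(1)])
    also have "\<dots> = act (\<lambda>x. B (inv_into UNIV A x)) T" by (rule act_compose[OF B Aut_inv[OF A(1)]])
    finally show ?thesis using Aut_compose[OF B Aut_inv[OF A(1)]] by (auto simp: U_orbit_def)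
  qed
  moreover have "act B T \<in> U_orbit J g S" if B: "B \<in> Aut J g" for B
    using Aut_compose[OF B A(1)] by (auto simp: U_orbit_def A(2) act_compose[OF B A(1)])
  ultimately show ?thesis by (auto simp: U_orbit_def)
qed

lemma U_orbit_act: "A \<in> Aut J g \<Longrightarrow> U_orbit J g (act A S) = U_orbit J g S"
  by (rule U_orbit_cong) (auto simp: U_orbit_def)

section \<open>Local sections and openness of the orbit map\<close>

definition adjB :: "('v \<Rightarrow>\<^sub>L 'v) \<Rightarrow> ('v \<Rightarrow>\<^sub>L 'v)" where
  "adjB A = Blinfun (adj A)"

lemma adjB_apply [simp]: "blinfun_apply (adjB A) = adj A"
  unfolding adjB_def using linear_adj by (intro bounded_linear_Blinfun_apply linear_conv_bounded_linear[THEN iffD1])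

lemma smooth_on_adjB: "smooth_on U f \<Longrightarrow> smooth_on U (\<lambda>z. adjB (f z))"
  by (intro smooth_on_blinfunI) (simp add: smooth_on_adj smooth_on_const)

lemma binv_clin:
  assumes "clin (blinfun_apply A)" "inj (blinfun_apply A)" shows "clin (binv A)"
proof -
  have "blinfun_apply (binv A) = inv_into UNIV A"
    using binv_bij(2)[OF assms(2)] assms(2) by (metis inv_f_eq ext)
  then show ?thesis using clin_inv[OF assms(1)] binv_bij(3)[OF assms(2)] by simp
qed

text \<open>The isometries are those of \<open>graph_isometry\<close>; they depend smoothly on the projector onto the support.\<close>

lemma local_section:
  assumes S0: "S0 \<in> CJ_stratum J g k"
  obtains U \<kappa> where "open U" "S0 \<in> U" "continuous_on U \<kappa>" "\<kappa> S0 = S0"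
    "\<And>S. S \<in> U \<Longrightarrow> S \<in> CJ_stratum J g k \<Longrightarrow> \<exists>A\<in>Aut J g. \<kappa> S = act A S \<and> A ` supp S = supp S0"
proof -
  define W where "W = supp S0"
  have W: "isotropic_subspace W" "dim W = 2 * k" using S0 by (auto simp: CJ_stratum_eq W_def)
  obtain \<pi> where p: "witt_proj \<pi> W" by (rule obtain_witt_proj[OF W(1)])
  note pD = witt_projD[OF p]
  obtain U F where U: "open U" "S0 \<in> U" "smooth_on U F"
    "\<And>S. S \<in> U \<Longrightarrow> dim (supp S) = dim (supp S0) \<Longrightarrow> orth_proj (F S) (supp S)"
    by (rule supp_projector_smooth[of S0]) blast
  define p0 where "p0 = Blinfun \<pi>"
  have p0 [simp]: "blinfun_apply p0 = \<pi>"
    unfolding p0_def using clinD(1)[OF pD(1)] by (intro bounded_linear_Blinfun_apply linear_conv_bounded_linear[THEN iffD1])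
  define C where "C S = cproj_of (F S)" for S
  \<comment> \<open>On \<open>W\<close> this is the projector onto the support of \<open>S\<close>
    followed by \<pi>, on the kernel of \<pi> it is the identity. It equals the identity at
    \<open>S0\<close>, hence is invertible nearby.\<close>
  define N where "N S = (p0 o\<^sub>L C S o\<^sub>L p0) + (id_blinfun - p0)" for S
  define U' where "U' = U \<inter> {S \<in> U. norm (id_blinfun - N S) < 1/2}"
  have sC: "smooth_on U C" unfolding C_def[abs_def] by (intro smooth_on_cproj_of U(3))
  have sN: "smooth_on U N" unfolding N_def[abs_def]
    by (intro smooth_on_add smooth_on_diff smooth_on_const smooth_on_blinfun_compose sC)
  have "open U'" unfolding U'_def
    using continuous_on_open_vimage[OF U(1), of "\<lambda>S. norm (id_blinfun - N S)"] smooth_on_imp_continuous_on[OF sN]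
    by (auto simp: vimage_def Int_def conj_commute intro!: continuous_intros dest!: spec[of _ "{..<1/2}"])
  have U'U: "U' \<subseteq> U" by (auto simp: U'_def)
  have near: "norm (id_blinfun - N S) \<le> 1/2" if "S \<in> U'" for S using that by (simp add: U'_def)
  have cC: "clin (C S)" for S unfolding C_def by (rule clin_cproj_of)
  have cN: "clin (N S)" for S
    by (rule clinI) (simp_all add: N_def bil_simps clin_simps[OF pD(1)] clin_simps[OF cC])
  note b = binv_bij[OF near_id_inj(2)[OF near]]
  have cb: "clin (binv (N S))" if "S \<in> U'" for S
    using cN near_id_inj(2)[OF near[OF that]] by (rule binv_clin)
  \<comment> \<open>Inverting \<open>N S\<close> corrects the projector so that \<pi> after
    \<open>R S\<close> is \<pi>: the range lies in the support of \<open>S\<close>, and the kernel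
    is that of \<pi>.\<close>
  define R where "R S = C S o\<^sub>L binv (N S) o\<^sub>L p0" for S
  define E where "E = id_blinfun - p0 - adjB p0"
  define A where "A S = R S + E - (adjB (R S) o\<^sub>L E) + adjB p0" for S
  have sR: "smooth_on U' R" unfolding R_def[abs_def]
    by (intro smooth_on_blinfun_compose smooth_on_binv near \<open>open U'\<close> smooth_on_const smooth_on_subset[OF sC U'U] smooth_on_subset[OF sN U'U])
  have sA: "smooth_on U' A" unfolding A_def[abs_def]
    by (intro smooth_on_add smooth_on_diff smooth_on_blinfun_compose smooth_on_adjB sR smooth_on_const)
  have cR: "clin (R S)" if "S \<in> U'" for S
    using clin_compose[OF cC clin_compose[OF cb[OF that] pD(1)]] by (simp add: R_def clin_def linear_blinfun)
  have A_apply: "A S x = R S x + (x - \<pi> x - adj \<pi> x) - adj (R S) (x - \<pi> x - adj \<pi> x) + adj \<pi> x" for S x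
    by (simp add: A_def E_def bil_simps)
  have cA: "clin (A S)" if "S \<in> U'" for S
    by (rule clinI) (simp_all add: A_apply clin_simps[OF cR[OF that]] clin_simps[OF clin_adj[OF cR[OF that]]]
        clin_simps[OF pD(1)] clin_simps[OF clin_adj[OF pD(1)]] algebra_simps)
  \<comment> \<open>Over the stratum \<open>A S\<close> is an isometry from \<open>W\<close> onto
    the support of \<open>S\<close>, so its adjoint is the inverse and brings the support back to
    \<open>W\<close>. The formula with the adjoint also makes sense, smoothly, off the
    stratum.\<close>
  define \<kappa> where "\<kappa> S = tw (adjB (A S)) S" for S
  have "smooth_on U' \<kappa>" unfolding \<kappa>_def[abs_def]
    by (intro smooth_on_tw smooth_on_adjB sA smooth_on_ident \<open>open U'\<close>) (simp add: clin_adj cA)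
  then have cont: "continuous_on U' \<kappa>" by (rule smooth_on_imp_continuous_on)
  have C0: "cproj (C S0) W"
    unfolding C_def using U(4)[OF U(2)] W(1) by (intro cproj_cproj_of) (auto simp: W_def isotropic_subspaceD(1))
  have N0: "N S0 = id_blinfun"
    by (rule blinfun_eqI) (simp add: N_def bil_simps cprojD(3)[OF C0 pD(2)] pD(5))
  have "S0 \<in> U'" using U(2) N0 by (simp add: U'_def)
  have R0: "R S0 x = \<pi> x" for x
  proof -
    have "binv (N S0) (\<pi> x) = \<pi> x" using b(1)[OF \<open>S0 \<in> U'\<close>, of "\<pi> x"] N0 by simp
    then show ?thesis by (simp add: R_def cprojD(3)[OF C0 pD(2)])
  qed
  have "adj (R S0) (x - \<pi> x - adj \<pi> x) = 0" for x
  proof -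
    have pp: "adj \<pi> (adj \<pi> x) = adj \<pi> x" using adj_compose[OF pD(1) pD(1)] by (simp add: pD(5) fun_eq_iff)
    have "blinfun_apply (R S0) = \<pi>" using R0 by auto
    then show ?thesis using pD(7)[OF pD(2)] pp by simp
  qed
  then have "blinfun_apply (A S0) = (\<lambda>x. x)" by (simp add: fun_eq_iff A_apply R0)
  then have \<kappa>0: "\<kappa> S0 = S0" by (simp add: \<kappa>_def adj_id tw_id)
  have "\<exists>B\<in>Aut J g. \<kappa> S = act B S \<and> B ` supp S = supp S0" if S: "S \<in> U'" "S \<in> CJ_stratum J g k" for S
  proof -
    have W': "isotropic_subspace (supp S)" "dim (supp S) = 2 * k" using S(2) by (auto simp: CJ_stratum_eq)
    have CS: "cproj (C S) (supp S)"
      unfolding C_def using U(4)[of S] S(1) U'U W W' by (intro cproj_cproj_of) (auto simp: W_def isotropic_subspaceD(1))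
    note bS = b(1,2)[OF S(1)]
    have NS: "N S x = \<pi> (C S (\<pi> x)) + (x - \<pi> x)" for x by (simp add: N_def bil_simps)
    have N\<pi>: "N S (\<pi> x) = \<pi> (N S x)" for x
      by (simp add: N_def bil_simps clin_simps[OF pD(1)] pD(5))
    have b\<pi>: "binv (N S) (\<pi> x) = \<pi> (binv (N S) x)" for x
      using bS(1)[of "\<pi> (binv (N S) x)"] by (simp add: N\<pi> bS(2))
    have R1: "R S x \<in> supp S" "R S (\<pi> x) = R S x" for x
      using cprojD(2)[OF CS] by (simp_all add: R_def pD(5))
    have R2: "\<pi> (R S x) = \<pi> x" for x
    proof -
      have "\<pi> (R S x) = N S (\<pi> (binv (N S) x))"
        by (simp add: R_def b\<pi> NS pD(5))
      also have "\<dots> = \<pi> x" by (simp add: N\<pi> bS(2))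
      finally show ?thesis .
    qed
    note G = graph_isometry[OF p W'(1) cR[OF S(1)] R1(1) R1(2) R2, folded A_apply]
    have GA: "blinfun_apply (A S) \<in> Aut J g" using G(1) by simp
    have "A S ` W \<subseteq> supp S" using G(2) R1(1) by auto
    then have im: "A S ` W = supp S"
      using isotropic_subspace_image[OF GA W(1)] W(2) W' isotropic_subspaceD(2)
      by (intro subspace_dim_equal) auto
    have adjA: "adj (A S) = inv_into UNIV (A S)" by (rule adj_Aut[OF GA])
    have "inv_into UNIV (A S) ` supp S = W"
      unfolding im[symmetric] image_image using AutD(2)[OF GA] by (simp add: bij_def)
    then show ?thesis
      using Aut_inv[OF GA] by (intro bexI[of _ "inv_into UNIV (A S)"]) (simp_all add: \<kappa>_def adjA act_eq_tw W_def)
  qed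
  then show thesis using that[OF \<open>open U'\<close> \<open>S0 \<in> U'\<close> cont \<kappa>0] by blast
qed

lemma orbit_spaces_homeomorphic:
  assumes W: "W \<in> isotropic_grassmannian J g k"
  shows "\<exists>h. homeomorphic_map (orbit_space (S30_reg_real J g W) (GL_orbit J g W))
      (orbit_space (CJ_stratum J g k) (U_orbit J g)) h \<and>
    (\<forall>S\<in>S30_reg_real J g W. h (GL_orbit J g W S) = U_orbit J g S)"
proof (rule orbit_space_homeomorphic)
  have W': "isotropic_subspace W" "dim W = 2 * k" using W by (auto simp: isotropic_grassmannian_eq)
  have X: "S30_reg_real J g W = {S \<in> tensors. supp S = W}" using S30_reg_real_eq isotropic_subspaceD(1)[OF W'(1)] by blast
  show "S30_reg_real J g W \<subseteq> CJ_stratum J g k" using X W' by (auto simp: CJ_stratum_eq)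
  show "GL_orbit J g W S = GL_orbit J g W T \<longleftrightarrow> U_orbit J g S = U_orbit J g T"
    if S: "S \<in> S30_reg_real J g W" and T: "T \<in> S30_reg_real J g W" for S T
  proof
    assume "GL_orbit J g W S = GL_orbit J g W T"
    then have "U_orbit J g S \<inter> {T. supp T = W} = U_orbit J g T \<inter> {T. supp T = W}"
      using S T X GL_orbit_eq[OF W'(1)] by simp
    then have "S \<in> U_orbit J g T" using U_orbit_self S X by blast
    then show "U_orbit J g S = U_orbit J g T" by (rule U_orbit_cong)
  next
    assume "U_orbit J g S = U_orbit J g T"
    then show "GL_orbit J g W S = GL_orbit J g W T" using S T X GL_orbit_eq[OF W'(1)] by simp
  qed
  have move: "\<exists>A\<in>Aut J g. act A S \<in> S30_reg_real J g W" if S: "S \<in> CJ_stratum J g k" for S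
  proof -
    have S': "S \<in> tensors" "isotropic_subspace (supp S)" "dim (supp S) = 2 * k" using S by (auto simp: CJ_stratum_eq)
    obtain A where "A \<in> Aut J g" "A ` supp S = W"
      using Aut_transitive[OF S'(2) W'(1)] S'(3) W'(2) by auto
    then show ?thesis using S'(1) X by (intro bexI[of _ A]) (auto simp: act_eq_tw supp_tw AutD tw_tensors)
  qed
  show "\<exists>T\<in>S30_reg_real J g W. U_orbit J g T = U_orbit J g S" if "S \<in> CJ_stratum J g k" for S
    using move[OF that] U_orbit_act by blast
  fix V assume "openin (top_of_set (S30_reg_real J g W)) V"
  then obtain V' where V': "open V'" "V = S30_reg_real J g W \<inter> V'" by (auto simp: openin_open)
  show "openin (top_of_set (CJ_stratum J g k)) {S \<in> CJ_stratum J g k. \<exists>T\<in>V. U_orbit J g T = U_orbit J g S}"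
  proof (subst openin_subopen, intro ballI)
    fix S assume "S \<in> {S \<in> CJ_stratum J g k. \<exists>T\<in>V. U_orbit J g T = U_orbit J g S}"
    then obtain T where S: "S \<in> CJ_stratum J g k" and T: "T \<in> V" "U_orbit J g T = U_orbit J g S" by blast
    obtain A where A: "A \<in> Aut J g" "T = act A S"
      using T(2) U_orbit_self[of T] by (auto simp: U_orbit_def)
    have Tk: "T \<in> CJ_stratum J g k" using act_CJ(2)[OF A(1) S] A(2) by simp
    have sT: "supp T = W" using T(1) V'(2) X by simp
    obtain U \<kappa> where U: "open U" "T \<in> U" "continuous_on U \<kappa>" "\<kappa> T = T"
      "\<And>S. S \<in> U \<Longrightarrow> S \<in> CJ_stratum J g k \<Longrightarrow> \<exists>A\<in>Aut J g. \<kappa> S = act A S \<and> A ` supp S = supp T"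
      by (rule local_section[OF Tk]) blast
    \<comment> \<open>Tensors near \<open>T\<close> that \<kappa> moves into \<open>V'\<close>. On
      the stratum \<kappa> stays in the orbit and yields support \<open>W\<close>, so the orbits of
      all such tensors meet \<open>V\<close>.\<close>
    define O1 where "O1 = U \<inter> \<kappa> -` V'"
    have O1: "open O1" unfolding O1_def by (rule continuous_open_preimage[OF U(3,1) V'(1)])
    have "bounded_linear (act A)"
    proof (rule bounded_linear_bilI)
      fix X Y
      have "bounded_linear A" using clinD(1)[OF AutD(1)[OF A(1)]] linear_conv_bounded_linear by blast
      from bounded_linear_compose[OF this bounded_linear_app2]
      show "bounded_linear (\<lambda>T. app2 (act A T) X Y)" by (simp add: act_eq_tw A(1) app2_tw AutD(1))
    qed
    then have "continuous_on UNIV (act A)" by (rule linear_continuous_on)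
    then have O2: "open (act A -` O1)" using O1 by (simp add: open_vimage)
    show "\<exists>Q. openin (top_of_set (CJ_stratum J g k)) Q \<and> S \<in> Q \<and>
        Q \<subseteq> {S \<in> CJ_stratum J g k. \<exists>T\<in>V. U_orbit J g T = U_orbit J g S}"
    proof (intro exI conjI)
      show "openin (top_of_set (CJ_stratum J g k)) (CJ_stratum J g k \<inter> act A -` O1)" using O2 by (rule openin_open_Int)
      show "S \<in> CJ_stratum J g k \<inter> act A -` O1" using S A(2) U(2,4) T(1) V'(2) by (simp add: O1_def)
      show "CJ_stratum J g k \<inter> act A -` O1 \<subseteq> {S \<in> CJ_stratum J g k. \<exists>T\<in>V. U_orbit J g T = U_orbit J g S}"
      proof safe
        fix S' assume S': "S' \<in> CJ_stratum J g k" "act A S' \<in> O1"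
        let ?z = "act A S'"
        have z: "?z \<in> CJ_stratum J g k" using act_CJ(2)[OF A(1) S'(1)] .
        obtain B where B: "B \<in> Aut J g" "\<kappa> ?z = act B ?z" "B ` supp ?z = supp T"
          using U(5)[OF _ z] S'(2) by (auto simp: O1_def)
        have "\<kappa> ?z \<in> S30_reg_real J g W"
          using act_CJ(2)[OF B(1) z] act_CJ(3)[OF B(1), of ?z] B(2,3) sT X by (simp add: CJ_stratum_eq)
        then have "\<kappa> ?z \<in> V" using S'(2) V'(2) by (simp add: O1_def)
        moreover have "U_orbit J g (\<kappa> ?z) = U_orbit J g S'" using B U_orbit_act A(1) by simp
        ultimately show "\<exists>T\<in>V. U_orbit J g T = U_orbit J g S'" by blast
      qed
    qed
  qed
qed

end

theorem theorem15:
  fixes J :: "'v::euclidean_space \<Rightarrow> 'v" and g :: "'v \<Rightarrow> 'v \<Rightarrow> real" and p q n N :: nat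
  assumes "pseudo_hermitian J g"
    and "complex_signature J g p q"
    and "p + q = n" and "n = cdim J (UNIV :: 'v set)"
    and "N = max_isotropic_cdim J g"
  shows "(cone (CJ J g) \<and> stratification (CJ J g) N (CJ_stratum J g)) \<and>
    (real N \<le> real n / 2 \<and> N = min p q) \<and>
    (\<forall>k\<in>{0..N}.
           CJ_stratum J g k = (\<Union>W\<in>isotropic_grassmannian J g k. S30_reg_real J g W) \<and>
           diffeomorphism (\<Union>W\<in>isotropic_grassmannian J g k. S30_reg J g W) (CJ_stratum J g k) realify) \<and>
    (\<forall>k\<in>{0..N}.
           zariski_open_subbundle iB (isotropic_proj J g k)
             (\<lambda>P. S30 J g (range (blinfun_apply P))) (\<lambda>P. S30_reg J g (range (blinfun_apply P))) \<and>
           diffeomorphism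
             (SIGMA P : isotropic_proj J g k. S30_reg J g (range (blinfun_apply P)))
             (CJ_stratum J g k) (\<lambda>(P, T). realify T) \<and>
           (\<forall>P\<in>isotropic_proj J g k. \<forall>T\<in>S30_reg J g (range (blinfun_apply P)).
             supp (realify T) = range (blinfun_apply P))) \<and>
    (Aut J (omega J g) = Aut J g \<and> Aut_group J g \<cong> U_group p q) \<and>
    (\<forall>A\<in>Aut J g. act A ` CJ J g = CJ J g \<and>
           (\<forall>k\<in>{0..N}. act A ` CJ_stratum J g k = CJ_stratum J g k)) \<and>
    (\<forall>k\<in>{0..N}. \<forall>W\<in>isotropic_grassmannian J g k.
           \<exists>h. homeomorphic_map
                 (orbit_space (S30_reg_real J g W) (GL_orbit J g W))
                 (orbit_space (CJ_stratum J g k) (U_orbit J g)) h \<and>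
               (\<forall>S\<in>S30_reg_real J g W. h (GL_orbit J g W S) = U_orbit J g S))"
proof -
  obtain e :: "nat \<Rightarrow> 'v" where "pseudo_hermitian_basis J g p q e"
    using assms(1,2) unfolding complex_signature_def pseudo_hermitian_basis_def
      pseudo_hermitian_basis_axioms_def pseudo_hermitian_space_def by blast
  then interpret pseudo_hermitian_basis J g p q e .
  have N: "N = min p q" using assms(5) max_isotropic_cdim_eq by simp
  show ?thesis
  proof (intro conjI ballI)
    show "cone (CJ J g)" by (rule cone_CJ)
    show "stratification (CJ J g) N (CJ_stratum J g)" unfolding N by (rule CJ_stratification)
    show "real N \<le> real n / 2" using N assms(3) by auto
    show "N = min p q" by (rule N)
    show "Aut J (omega J g) = Aut J g" by (rule Aut_omega)
    show "Aut_group J g \<cong> U_group p q" by (rule Aut_group_iso_U_group)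
  qed (auto simp: S30_reg_real_Union realify_diffeomorphism S3_bundle_zariski_open bundle_diffeomorphism
      supp_realify act_image orbit_spaces_homeomorphic)
qed

end
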